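(* Let $0<p<q<\infty$, let $g$ be a holomorphic function on $\mathbb{B}_n$, and let $\alpha=n\left(\frac1p-\frac1q\right)$. (a) If $\alpha\le 1$, then $J_g:H^p\to H^q$ is bounded if and only if $g\in\Lambda(\alpha)$. Moreover, $\|J_g\|_{H^p\to H^q}\asymp\|g\|_{\Lambda(\alpha)}$. (b) If $\alpha>1$, then $J_g:H^p\to H^q$ is bounded if and only if $g$ is constant, that is, $J_g\equiv 0$.
   Context: $\mathbb{B}_n$ is the open unit ball of $\mathbb{C}^n$, $\mathbb{S}_n=\partial\mathbb{B}_n$, and $\sigma$ is surface measure on $\mathbb{S}_n$ normalized so that $\sigma(\mathbb{S}_n)=1$. For $g$ holomorphic on $\mathbb{B}_n$, $Rg(z)=\sum_{k=1}^n z_k\frac{\partial g}{\partial z_k}(z)$ is the radial derivative, and for $f$ holomorphic on $\mathbb{B}_n$, $$J_gf(z)=\int_0^1 f(tz)\,Rg(tz)\,\frac{dt}{t},\qquad z\in\mathbb{B}_n.$$ For $0<p<\infty$, $H^p$ is the space of holomorphic $f$ on $\mathbb{B}_n$ with $\|f\|_{H^p}^p=\sup_{0<r<1}\int_{\mathbb{S}_n}|f(r\zeta)|^p\,d\sigma(\zeta)<\infty$. $J_g:H^p\to H^q$ is bounded if it maps $H^p$ into $H^q$ and $\|J_g\|_{H^p\to H^q}:=\sup_{\|f\|_{H^p}\le1}\|J_gf\|_{H^q}<\infty$. For $0<\alpha\le1$, $\Lambda(\alpha)$ is the space of holomorphic $g$ on $\mathbb{B}_n$ with $$\|g\|_{\Lambda(\alpha)}=\sup_{z\in\mathbb{B}_n}(1-|z|^2)^{1-\alpha}|Rg(z)|<\infty.$$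 $A\asymp B$ means that $A$ and $B$ are comparable, i.e. $C^{-1}A\le B\le CA$ with a constant $C>0$ independent of $g$. *)

theory Defs
  imports "HOL-Analysis.Analysis"
begin

section \<open>Holomorphic functions of several variables and the radial derivative\<close>

text \<open>Complex Fr\'echet differentiability: the real derivative exists and is complex linear.
  All uses are with \<^term>\<open>S = ball 0 1\<close>, an open set, so that values of \<^term>\<open>f\<close>
  outside \<^term>\<open>S\<close> are irrelevant.\<close>

definition holomorphic_several :: "(complex^'n \<Rightarrow> complex) \<Rightarrow> (complex^'n) set \<Rightarrow> bool" where
  "holomorphic_several f S \<longleftrightarrow>
     (\<forall>z\<in>S. \<exists>D. (f has_derivative D) (at z) \<and> (\<forall>c v. D (c *s v) = c * D v))"

definition complex_partial :: "'n \<Rightarrow> (complex^'n \<Rightarrow> complex) \<Rightarrow> complex^'n \<Rightarrow> complex" where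
  "complex_partial k g z = deriv (\<lambda>w. g (\<chi> j. if j = k then w else z $ j)) (z $ k)"

definition radial_deriv :: "(complex^'n \<Rightarrow> complex) \<Rightarrow> complex^'n \<Rightarrow> complex" where
  "radial_deriv g z = (\<Sum>k\<in>UNIV. z $ k * complex_partial k g z)"

text \<open>At \<^term>\<open>t = 0\<close> the integrand takes the junk value \<^term>\<open>0\<close> (division by zero),
  which does not affect the integral.\<close>

definition J_op ::
  "(complex^'n \<Rightarrow> complex) \<Rightarrow> (complex^'n \<Rightarrow> complex) \<Rightarrow> complex^'n \<Rightarrow> complex" where
  "J_op g f z =
     integral {0..1} (\<lambda>t. f (t *\<^sub>R z) * radial_deriv g (t *\<^sub>R z) / complex_of_real t)"


section \<open>Normalized surface measure on the unit sphere\<close>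

text \<open>Surface measure via polar coordinates: the measure of \<^term>\<open>E\<close> is the (real) dimension
  times the volume of the cone \<open>{t *\<^sub>R x | 0 < t < 1, x \<in> E}\<close>. See
  \<open>emeasure_surface_measure\<close> below.\<close>

definition surface_measure :: "'a::euclidean_space measure" where
  "surface_measure =
     scale_measure (of_nat DIM('a))
       (distr (restrict_space lborel (ball 0 1 - {0})) (restrict_space borel (sphere 0 1))
          (\<lambda>x. x /\<^sub>R norm x))"

definition normalized_surface_measure :: "'a::euclidean_space measure" where
  "normalized_surface_measure = uniform_measure surface_measure (sphere 0 1)"

lemma space_surface_measure [simp]:
  "space (surface_measure :: 'a::euclidean_space measure) = sphere 0 1"
  by (simp add: surface_measure_def space_restrict_space space_scale_measure)

lemma sets_surface_measure [simp]:
  "sets (surface_measure :: 'a::euclidean_space measure) = sets (restrict_space borel (sphere 0 1))"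
  by (simp add: surface_measure_def)

lemma emeasure_surface_measure:
  fixes E :: "'a::euclidean_space set"
  assumes E: "E \<in> sets borel" "E \<subseteq> sphere 0 1"
  shows "emeasure surface_measure E =
           of_nat DIM('a) * emeasure lborel {t *\<^sub>R x | t x. 0 < t \<and> t < 1 \<and> x \<in> E}"
proof -
  let ?B = "ball 0 1 - {0} :: 'a set"
  have EE: "E \<in> sets (restrict_space borel (sphere 0 1))"
    using E by (auto simp: sets_restrict_space_iff)
  have "continuous_on ?B (\<lambda>x. x /\<^sub>R norm x)"
    by (auto intro!: continuous_intros)
  hence "(\<lambda>x. x /\<^sub>R norm x) \<in> borel_measurable (restrict_space borel ?B)"
    by (rule borel_measurable_continuous_on_restrict)
  hence "(\<lambda>x. x /\<^sub>R norm x) \<in> borel_measurable (restrict_space lborel ?B)"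
    by (simp cong: measurable_cong_sets sets_restrict_space_cong)
  hence meas: "(\<lambda>x. x /\<^sub>R norm x) \<in>
      restrict_space lborel ?B \<rightarrow>\<^sub>M restrict_space borel (sphere 0 1)"
    by (intro measurable_restrict_space2) (auto simp: space_restrict_space)
  have cone: "(\<lambda>x. x /\<^sub>R norm x) -` E \<inter> ?B = {t *\<^sub>R x | t x. 0 < t \<and> t < 1 \<and> x \<in> E}"
    (is "?L = ?R")
  proof
    show "?L \<subseteq> ?R"
    proof
      fix x assume x: "x \<in> ?L"
      hence "x = norm x *\<^sub>R (x /\<^sub>R norm x)" "0 < norm x" "norm x < 1" "x /\<^sub>R norm x \<in> E"
        by auto
      thus "x \<in> ?R" by blast
    qed
    show "?R \<subseteq> ?L" using E(2) by (auto simp: subset_iff)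
  qed
  have "emeasure (distr (restrict_space lborel ?B) (restrict_space borel (sphere 0 1))
          (\<lambda>x. x /\<^sub>R norm x)) E = emeasure (restrict_space lborel ?B) ?R"
    using cone by (subst emeasure_distr[OF meas EE]) (simp add: space_restrict_space)
  also have "\<dots> = emeasure lborel ?R"
    by (rule emeasure_restrict_space) (auto simp flip: cone)
  finally have "emeasure (distr (restrict_space lborel ?B) (restrict_space borel (sphere 0 1))
          (\<lambda>x. x /\<^sub>R norm x)) E = emeasure lborel ?R" .
  thus ?thesis by (simp add: surface_measure_def)
qed

lemma emeasure_surface_measure_sphere:
  "emeasure surface_measure (sphere 0 1 :: 'a::euclidean_space set) =
     of_nat DIM('a) * emeasure lborel (ball 0 1 :: 'a set)"
proof -
  have cone: "{t *\<^sub>R x | t x. 0 < t \<and> t < 1 \<and> x \<in> sphere 0 1} = ball 0 1 - {0 :: 'a}"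
    (is "?L = ?R")
  proof
    show "?L \<subseteq> ?R" by auto
    show "?R \<subseteq> ?L"
    proof
      fix x :: 'a assume x: "x \<in> ?R"
      hence "x = norm x *\<^sub>R (x /\<^sub>R norm x)" "0 < norm x" "norm x < 1"
          "x /\<^sub>R norm x \<in> sphere 0 1"
        by auto
      thus "x \<in> ?L" by blast
    qed
  qed
  have "emeasure lborel (ball 0 1 - {0 :: 'a}) = emeasure lborel (ball 0 1 :: 'a set)"
    by (rule emeasure_Diff_null_set) auto
  thus ?thesis
    using emeasure_surface_measure[of "sphere 0 1 :: 'a set"] by (simp only: cone) auto
qed

lemma emeasure_normalized_surface_measure_sphere:
  "emeasure normalized_surface_measure (sphere 0 1 :: 'a::euclidean_space set) = 1"
proof -
  have "emeasure lborel (ball 0 1 :: 'a set) \<noteq> 0"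
    using content_ball_pos[of 1 "0::'a"] by (auto simp: measure_def)
  moreover have "emeasure lborel (ball 0 1 :: 'a set) \<noteq> top"
    using emeasure_bounded_finite[of "ball 0 1 :: 'a set"] by auto
  ultimately show ?thesis
    unfolding normalized_surface_measure_def
    by (subst emeasure_uniform_measure)
       (auto simp: emeasure_surface_measure_sphere sets_restrict_space_iff ennreal_mult_less_top less_top
               of_nat_less_top
             intro!: ennreal_divide_self)
qed


section \<open>Hardy spaces and Lipschitz-type spaces\<close>

text \<open>The norms take values in \<open>[0, \<infinity>]\<close>, so that they are meaningful for every function;
  the spaces consist of the holomorphic functions of finite norm.\<close>

definition hardy_integral :: "real \<Rightarrow> (complex^'n \<Rightarrow> complex) \<Rightarrow> ennreal" where
  "hardy_integral p f =
     (SUP r\<in>{0<..<1}. \<integral>\<^sup>+\<zeta>. ennreal (cmod (f (r *\<^sub>R \<zeta>)) powr p) \<partial>normalized_surface_measure)"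

definition hardy_norm :: "real \<Rightarrow> (complex^'n \<Rightarrow> complex) \<Rightarrow> ennreal" where
  "hardy_norm p f =
     (if hardy_integral p f = \<infinity> then \<infinity>
      else ennreal (enn2real (hardy_integral p f) powr (1 / p)))"

definition hardy_space :: "real \<Rightarrow> (complex^'n \<Rightarrow> complex) set" where
  "hardy_space p = {f. holomorphic_several f (ball 0 1) \<and> hardy_integral p f < \<infinity>}"

definition Lip_norm :: "real \<Rightarrow> (complex^'n \<Rightarrow> complex) \<Rightarrow> ennreal" where
  "Lip_norm \<alpha> g =
     (SUP z\<in>ball 0 1. ennreal ((1 - (norm z)\<^sup>2) powr (1 - \<alpha>) * cmod (radial_deriv g z)))"

definition Lip_space :: "real \<Rightarrow> (complex^'n \<Rightarrow> complex) set" where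
  "Lip_space \<alpha> = {g. holomorphic_several g (ball 0 1) \<and> Lip_norm \<alpha> g < \<infinity>}"

definition J_norm :: "real \<Rightarrow> real \<Rightarrow> (complex^'n \<Rightarrow> complex) \<Rightarrow> ennreal" where
  "J_norm p q g = (SUP f\<in>{f \<in> hardy_space p. hardy_norm p f \<le> 1}. hardy_norm q (J_op g f))"

definition J_bounded :: "real \<Rightarrow> real \<Rightarrow> (complex^'n \<Rightarrow> complex) \<Rightarrow> bool" where
  "J_bounded p q g \<longleftrightarrow>
     (\<forall>f\<in>hardy_space p. J_op g f \<in> hardy_space q) \<and> J_norm p q g < \<infinity>"

end

theory Submission
  imports Defs "HOL-Complex_Analysis.Conformal_Mappings"
begin

unbundle no fps_syntax

text \<open>
  Sufficiency follows Hedberg's argument. On a radius \<open>t \<mapsto> t z\<close> the function \<open>f\<close> is bounded both by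
  its radial maximal function \<open>F\<close> and, by the growth estimate in \<open>H\<^sup>p\<close>, by
  \<open>A (1 - t)\<close> to the power \<open>- n / p\<close> with \<open>A\<close> a multiple of its norm. Integrating the smaller of the two
  against \<open>(1 - t)\<close> to the power \<open>\<alpha> - 1\<close> bounds \<open>J_op g f\<close> by a multiple of
  \<open>F\<close> to the power \<open>p / q\<close>, so that the maximal theorem for \<open>F\<close> suffices.
  The maximal theorem is reduced to complex lines through the origin: there \<open>\<bar>f\<bar>\<close> to the power \<open>p / 2\<close> lies
  below its Poisson integral, and the \<open>L\<^sup>2\<close> bound for the Poisson maximal function comes from a
  \<open>T T\<^sup>*\<close> argument which needs neither a covering lemma nor interpolation.

  Necessity tests \<open>J_op g\<close> on powers of \<open>1 / (1 - \<langle>z, a\<rangle>)\<close> and uses that the radial derivative of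
  \<open>J_op g f\<close> is \<open>f\<close> times the radial derivative of \<open>g\<close>. If \<open>\<alpha> > 1\<close> the resulting bound tends to zero
  at the boundary, and the maximum principle makes \<open>g\<close> constant.

  The sharp growth exponent \<open>n / p\<close>, and dually the size of the caps \<open>{z. \<bar>1 - z\<^sub>k\<bar> < t}\<close>, comes from averaging over
  ellipsoids with semi-axis \<open>\<delta>\<close> in the complex direction of \<open>a\<close> and the square root of \<open>\<delta>\<close> in the
  orthogonal directions, where \<open>\<delta> = 1 - norm a\<close>.
\<close>

section \<open>Lebesgue measure and the sphere\<close>

text \<open>The link between the maximal theorem and Hedberg's splitting is the identity 1 -
  \<alpha>/\<beta> = p/q for \<beta> = n/p: the q-th power of the pointwise bound is linear in the
  p-th power of the maximal function, so one scheme covers all p < q, including p < 1. The maximal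
  operator is not linear and has no adjoint. A measurable choice of radius at each point makes it
  linear, and a constant independent of that choice bounds the supremum. The exponent p/2 is taken
  because the square of |f|^(p/2) is |f|^p, which brings the problem into L^2. Measurability is an
  obstacle throughout: nothing is known about f outside the ball, the surface measure lives on a
  restricted sigma-algebra, and a supremum over all radii is uncountable. Hence functions are
  extended by zero, a copy of the measure on all Borel sets replaces the surface measure, and
  maximal functions range over rational radii. The test functions are natural powers, so no branch
  of a complex power has to be chosen; an exponent N with N p > n makes their spherical means
  bounded by a pure power of 1 - |a|.\<close>

lemma nn_integral_lborel_translate:
  fixes f :: "'a::euclidean_space \<Rightarrow> ennreal"
  assumes [measurable]: "f \<in> borel_measurable borel"
  shows "(\<integral>\<^sup>+x. f (c + x) \<partial>lborel) = (\<integral>\<^sup>+x. f x \<partial>lborel)"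
proof -
  have "(\<integral>\<^sup>+x. f x \<partial>lborel) = (\<integral>\<^sup>+x. f x \<partial>distr lborel borel ((+) c))"
    by (simp add: lborel_distr_plus)
  also have "\<dots> = (\<integral>\<^sup>+x. f (c + x) \<partial>lborel)"
    by (subst nn_integral_distr) auto
  finally show ?thesis by simp
qed

lemma nn_integral_lborel_scale:
  fixes f :: "'a::euclidean_space \<Rightarrow> ennreal"
  assumes [measurable]: "f \<in> borel_measurable borel" and c: "c \<noteq> 0"
  shows "(\<integral>\<^sup>+x. f x \<partial>lborel) = ennreal (\<bar>c\<bar> ^ DIM('a)) * (\<integral>\<^sup>+x. f (c *\<^sub>R x) \<partial>lborel)"
  by (subst lborel_affine[OF c, of 0])
     (simp add: nn_integral_density nn_integral_distr nn_integral_cmult)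

lemma emeasure_lborel_unit_ball:
  "emeasure lborel (ball 0 1 :: 'a::euclidean_space set) \<noteq> 0"
  "emeasure lborel (ball 0 1 :: 'a::euclidean_space set) \<noteq> \<infinity>"
  "emeasure lborel (ball 0 1 :: 'a::euclidean_space set) \<noteq> top"
proof -
  show "emeasure lborel (ball 0 1 :: 'a set) \<noteq> 0"
    using content_ball_pos[of 1 "0::'a"] by (auto simp: measure_def)
  show "emeasure lborel (ball 0 1 :: 'a set) \<noteq> top" "emeasure lborel (ball 0 1 :: 'a set) \<noteq> \<infinity>"
    using emeasure_bounded_finite[of "ball 0 1 :: 'a set"] by auto
qed

lemma ball_in_borel [measurable]: "ball a r \<in> sets borel"
  by simp

text \<open>Uniqueness of Haar measure by Tonelli: for the translation invariant measure
  \<open>\<mu> = distr lborel borel T\<close> one has \<open>\<mu>(A) \<lambda>(B) = \<lambda>(A) \<mu>(-B)\<close>, and \<open>\<mu>(B) = \<lambda>(B)\<close> for the unit ball.\<close>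

lemma nn_integral_lborel_orthogonal:
  fixes T :: "'a::euclidean_space \<Rightarrow> 'a" and f :: "'a \<Rightarrow> ennreal"
  assumes T: "orthogonal_transformation T" and f[measurable]: "f \<in> borel_measurable borel"
  shows "(\<integral>\<^sup>+x. f (T x) \<partial>lborel) = (\<integral>\<^sup>+x. f x \<partial>lborel)"
proof -
  have lin: "linear T" and nrm: "norm (T x) = norm x" for x
    using T by (auto simp: orthogonal_transformation)
  have surj: "surj T" using T by (rule orthogonal_transformation_surj)
  have T_m[measurable]: "T \<in> borel_measurable borel"
    using lin by (intro borel_measurable_continuous_onI linear_continuous_on linear_conv_bounded_linear[THEN iffD1])
  let ?B = "indicator (ball (0::'a) 1) :: 'a \<Rightarrow> ennreal"
  let ?v = "emeasure lborel (ball (0::'a) 1)"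
  have shift: "(\<integral>\<^sup>+x. h (T x + y) \<partial>lborel) = (\<integral>\<^sup>+x. h (T x) \<partial>lborel)"
    if [measurable]: "h \<in> borel_measurable borel" for h :: "'a \<Rightarrow> ennreal" and y
  proof -
    obtain z where z: "y = T z" using surj by auto
    have "(\<integral>\<^sup>+x. h (T x + y) \<partial>lborel) = (\<integral>\<^sup>+x. h (T (z + x)) \<partial>lborel)"
      using lin by (simp add: z linear_add add.commute)
    also have "\<dots> = (\<integral>\<^sup>+x. h (T x) \<partial>lborel)"
      by (rule nn_integral_lborel_translate[of "\<lambda>x. h (T x)" z]) simp
    finally show ?thesis .
  qed
  have "(\<integral>\<^sup>+x. f (T x) \<partial>lborel) * ?v = (\<integral>\<^sup>+x. \<integral>\<^sup>+y. f (T x) * ?B y \<partial>lborel \<partial>lborel)"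
    by (subst nn_integral_cmult) (auto simp: nn_integral_multc)
  also have "\<dots> = (\<integral>\<^sup>+x. \<integral>\<^sup>+y. f (T x) * ?B (- T x + y) \<partial>lborel \<partial>lborel)"
    by (rule nn_integral_cong, rule nn_integral_lborel_translate[of "\<lambda>y. f (T x) * ?B y" "- T x" for x, symmetric]) simp
  also have "\<dots> = (\<integral>\<^sup>+y. \<integral>\<^sup>+x. f (T x) * ?B (y - T x) \<partial>lborel \<partial>lborel)"
    by (subst lborel_pair.Fubini') (auto simp: algebra_simps)
  also have "\<dots> = (\<integral>\<^sup>+y. \<integral>\<^sup>+x. f (T x + y) * ?B (y - (T x + y)) \<partial>lborel \<partial>lborel)"
    by (rule nn_integral_cong, rule shift[of "\<lambda>z. f z * ?B (y - z)" y for y, symmetric]) simp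
  \<comment> \<open>Norm preservation enters here: the indicator is evaluated at
    \<open>- T x\<close>, which has the norm of \<open>x\<close>.\<close>
  also have "\<dots> = (\<integral>\<^sup>+y. \<integral>\<^sup>+x. f (T x + y) * ?B x \<partial>lborel \<partial>lborel)"
    by (auto simp: nrm indicator_def intro!: nn_integral_cong)
  also have "\<dots> = (\<integral>\<^sup>+x. \<integral>\<^sup>+y. f (T x + y) * ?B x \<partial>lborel \<partial>lborel)"
    by (subst lborel_pair.Fubini') auto
  also have "\<dots> = (\<integral>\<^sup>+x. \<integral>\<^sup>+y. f y * ?B x \<partial>lborel \<partial>lborel)"
    by (rule nn_integral_cong, rule nn_integral_lborel_translate[of "\<lambda>y. f y * ?B x" "T x" for x]) simp
  also have "\<dots> = (\<integral>\<^sup>+x. f x \<partial>lborel) * ?v"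
    by (simp add: nn_integral_multc nn_integral_cmult)
  finally have "(\<integral>\<^sup>+x. f (T x) \<partial>lborel) * ?v / ?v = (\<integral>\<^sup>+x. f x \<partial>lborel) * ?v / ?v"
    by (rule arg_cong)
  thus ?thesis
    by (simp only: mult_divide_eq_ennreal[OF emeasure_lborel_unit_ball(1,3)])
qed

text \<open>The normalized surface measure, carried by the Borel sets of the whole space instead of
  the restricted sigma-algebra of the sphere, so that Borel functions of the ambient space can be
  integrated directly. The origin, where the projection takes the value 0, is a null set.\<close>

definition sph :: "'a::euclidean_space measure" where
  "sph = distr (uniform_measure lborel (ball 0 1)) borel (\<lambda>x. x /\<^sub>R norm x)"

lemma sets_sph [simp, measurable_cong]: "sets (sph :: 'a::euclidean_space measure) = sets borel"
  and space_sph [simp]: "space (sph :: 'a::euclidean_space measure) = UNIV"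
  by (simp_all add: sph_def)

lemma emeasure_sph_UNIV [simp]: "emeasure (sph :: 'a::euclidean_space measure) UNIV = 1"
  unfolding sph_def using emeasure_lborel_unit_ball[where 'a='a]
  by (subst emeasure_distr) (auto simp: emeasure_uniform_measure top.not_eq_extremum intro!: ennreal_divide_self)

interpretation sph: finite_measure "sph :: 'a::euclidean_space measure"
  by (rule finite_measureI) simp

interpretation sph_pair: pair_sigma_finite "sph :: 'a::euclidean_space measure" "sph :: 'b::euclidean_space measure" ..

interpretation sph_lborel: pair_sigma_finite "sph :: 'a::euclidean_space measure" "lborel :: 'b::euclidean_space measure" ..

lemma nn_integral_sph:
  fixes f :: "'a::euclidean_space \<Rightarrow> ennreal"
  assumes [measurable]: "f \<in> borel_measurable borel"
  shows "(\<integral>\<^sup>+x. f x \<partial>sph) =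
    (\<integral>\<^sup>+x. f (x /\<^sub>R norm x) * indicator (ball 0 1) x \<partial>lborel) / emeasure lborel (ball (0::'a) 1)"
  unfolding sph_def by (subst nn_integral_distr) (auto simp: nn_integral_uniform_measure)

lemma AE_sph: "AE x in (sph :: 'a::euclidean_space measure). norm x = 1"
proof -
  have "AE x in lborel. x \<noteq> (0::'a)"
    by (rule AE_lborel_singleton)
  hence "AE x in uniform_measure lborel (ball (0::'a) 1). norm (x /\<^sub>R norm x) = 1"
    by (intro AE_uniform_measureI) auto
  thus ?thesis
    unfolding sph_def by (subst AE_distr_iff) auto
qed

lemma nn_integral_sph_cong:
  assumes "\<And>x::'a::euclidean_space. norm x = 1 \<Longrightarrow> f x = g x"
  shows "(\<integral>\<^sup>+x. f x \<partial>sph) = (\<integral>\<^sup>+x. g x \<partial>sph)"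
  using AE_sph assms by (intro nn_integral_cong_AE) (auto elim: eventually_mono)

lemma nn_integral_sph_mono:
  assumes "\<And>x::'a::euclidean_space. norm x = 1 \<Longrightarrow> f x \<le> g x"
  shows "(\<integral>\<^sup>+x. f x \<partial>sph) \<le> (\<integral>\<^sup>+x. g x \<partial>sph)"
  using AE_sph assms by (intro nn_integral_mono_AE) (auto elim: eventually_mono)

text \<open>The passage from the measure in the definition of \<open>hardy_integral\<close> to
  \<open>sph\<close>; the factor \<open>DIM('a)\<close> in the surface measure cancels against the
  same factor in its total mass.\<close>

lemma nn_integral_normalized_surface_measure:
  fixes f :: "'a::euclidean_space \<Rightarrow> ennreal"
  assumes [measurable]: "f \<in> borel_measurable borel"
  shows "(\<integral>\<^sup>+x. f x \<partial>normalized_surface_measure) = (\<integral>\<^sup>+x. f x \<partial>sph)"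
proof -
  let ?S = "sphere (0::'a) 1" and ?v = "emeasure lborel (ball (0::'a) 1)"
  let ?d = "of_nat DIM('a) :: ennreal"
  let ?B = "ball 0 1 - {0} :: 'a set"
  have "(\<lambda>x. x /\<^sub>R norm x) \<in> borel_measurable (restrict_space lborel ?B)"
    by (rule measurable_restrict_space1) simp
  hence meas: "(\<lambda>x. x /\<^sub>R norm x) \<in> restrict_space lborel ?B \<rightarrow>\<^sub>M restrict_space borel ?S"
    by (intro measurable_restrict_space2) (auto simp: space_restrict_space)
  have fm: "f \<in> borel_measurable (restrict_space borel ?S)"
    by (rule measurable_restrict_space1) simp
  have fm3: "f \<in> borel_measurable (distr (restrict_space lborel ?B) (restrict_space borel ?S) (\<lambda>x. x /\<^sub>R norm x))"
    using fm by simp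
  have fm2: "f \<in> borel_measurable surface_measure"
    using fm by (simp cong: measurable_cong_sets)
  have "(\<integral>\<^sup>+x. f x \<partial>normalized_surface_measure) =
        (\<integral>\<^sup>+x. f x * indicator ?S x \<partial>surface_measure) / emeasure surface_measure ?S"
    unfolding normalized_surface_measure_def
    by (rule nn_integral_uniform_measure) (auto simp: fm2 sets_restrict_space_iff)
  also have "(\<integral>\<^sup>+x. f x * indicator ?S x \<partial>surface_measure) = (\<integral>\<^sup>+x. f x \<partial>surface_measure)"
    by (intro nn_integral_cong) (auto simp: indicator_def)
  also have "\<dots> = ?d * (\<integral>\<^sup>+x. f (x /\<^sub>R norm x) \<partial>restrict_space lborel ?B)"
    unfolding surface_measure_def
    by (subst nn_integral_scale_measure[OF fm3]) (simp add: nn_integral_distr[OF meas fm3])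
  also have "(\<integral>\<^sup>+x. f (x /\<^sub>R norm x) \<partial>restrict_space lborel ?B) =
      (\<integral>\<^sup>+x. f (x /\<^sub>R norm x) * indicator ?B x \<partial>lborel)"
    by (rule nn_integral_restrict_space) auto
  also have "\<dots> = (\<integral>\<^sup>+x. f (x /\<^sub>R norm x) * indicator (ball 0 1) x \<partial>lborel)"
  proof (rule nn_integral_cong_AE)
    have "AE x in lborel. x \<noteq> (0::'a)"
      by (rule AE_lborel_singleton)
    thus "AE x in lborel. f (x /\<^sub>R norm x) * indicator ?B x = f (x /\<^sub>R norm x) * indicator (ball 0 1) x"
      by eventually_elim (auto simp: indicator_def)
  qed
  also have "emeasure surface_measure ?S = ?d * ?v"
    by (rule emeasure_surface_measure_sphere)
  also have "?d * (\<integral>\<^sup>+x. f (x /\<^sub>R norm x) * indicator (ball 0 1) x \<partial>lborel) / (?d * ?v) =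
      (\<integral>\<^sup>+x. f (x /\<^sub>R norm x) * indicator (ball 0 1) x \<partial>lborel) / ?v"
    using divide_mult_eq[of ?d "(\<integral>\<^sup>+x. f (x /\<^sub>R norm x) * indicator (ball 0 1) x \<partial>lborel)" ?v]
    by (simp add: mult.commute)
  finally show ?thesis
    by (simp add: nn_integral_sph)
qed

text \<open>\<open>T\<close> commutes with the radial projection, so invariance of Lebesgue measure
  on the ball passes to the sphere.\<close>

lemma nn_integral_sph_orthogonal:
  fixes T :: "'a::euclidean_space \<Rightarrow> 'a" and f :: "'a \<Rightarrow> ennreal"
  assumes T: "orthogonal_transformation T" and f[measurable]: "f \<in> borel_measurable borel"
  shows "(\<integral>\<^sup>+x. f (T x) \<partial>sph) = (\<integral>\<^sup>+x. f x \<partial>sph)"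
proof -
  have lin: "linear T" and nrm: "norm (T x) = norm x" for x
    using T by (auto simp: orthogonal_transformation)
  have T_m[measurable]: "T \<in> borel_measurable borel"
    using lin by (intro borel_measurable_continuous_onI linear_continuous_on linear_conv_bounded_linear[THEN iffD1])
  have "(\<integral>\<^sup>+x. f (T (x /\<^sub>R norm x)) * indicator (ball 0 1) x \<partial>lborel) =
        (\<integral>\<^sup>+x. f (T x /\<^sub>R norm (T x)) * indicator (ball 0 1) (T x) \<partial>lborel)"
    by (simp add: nrm linear_scale[OF lin] indicator_def)
  also have "\<dots> = (\<integral>\<^sup>+x. f (x /\<^sub>R norm x) * indicator (ball 0 1) x \<partial>lborel)"
    by (rule nn_integral_lborel_orthogonal[OF T, of "\<lambda>x. f (x /\<^sub>R norm x) * indicator (ball 0 1) x"]) simp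
  finally show ?thesis
    by (simp add: nn_integral_sph)
qed

section \<open>Integration in polar coordinates over a spherical shell\<close>

lemma nn_integral_powr_tail:
  assumes "a > 0" "c > 0"
  shows "(\<integral>\<^sup>+t. (if c < t then ennreal (t powr (- a - 1)) else 0) \<partial>lborel) = ennreal (c powr (- a) / a)"
proof -
  have "(\<integral>\<^sup>+t. (if c < t then ennreal (t powr (- a - 1)) else 0) \<partial>lborel) =
        (\<integral>\<^sup>+t. ennreal (t powr (- a - 1)) * indicator {c..} t \<partial>lborel)"
    by (rule nn_integral_cong_AE) (use AE_lborel_singleton[of c] in \<open>auto simp: indicator_def elim!: eventually_mono\<close>)
  also have "\<dots> = ennreal (0 - (- (c powr (- a) / a)))"
  proof (rule nn_integral_FTC_atLeast)
    show "((\<lambda>t. - (t powr (- a) / a)) \<longlongrightarrow> 0) at_top"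
      using tendsto_divide[OF tendsto_minus[OF tendsto_neg_powr[OF _ filterlim_ident]] tendsto_const, of "- a" a] assms
      by simp
    show "DERIV (\<lambda>t. - (t powr (- a) / a)) t :> t powr (- a - 1)" if "c \<le> t" for t
      using that assms by (auto intro!: derivative_eq_intros simp: field_simps)
  qed auto
  finally show ?thesis by simp
qed

text \<open>Polar coordinates without a disintegration of Lebesgue measure: the definition of
  \<open>sph\<close> turns the left side into a double integral over r and a ball variable x, and
  the substitutions r = t |x| and z = t x lead to an integral over z in which the t-integral is
  elementary.\<close>

lemma nn_integral_sph_shell:
  fixes h :: "'a::euclidean_space \<Rightarrow> ennreal"
  assumes [measurable]: "h \<in> borel_measurable borel" and c: "0 \<le> c"
  shows "(\<integral>\<^sup>+r. (\<integral>\<^sup>+x. h (r *\<^sub>R x) \<partial>sph) * indicator {c<..<1} r \<partial>lborel) =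
    (\<integral>\<^sup>+z. h z * ennreal (norm z powr (1 - real DIM('a))) * indicator {z. c < norm z \<and> norm z < 1} z \<partial>lborel)
      / (DIM('a) * emeasure lborel (ball (0::'a) 1))"
proof -
  let ?v = "emeasure lborel (ball (0::'a) 1)" and ?B = "ball (0::'a) 1"
  let ?d = "DIM('a)"
  let ?I = "indicator {z. c < norm z \<and> norm z < 1} :: 'a \<Rightarrow> ennreal"
  let ?X = "\<lambda>x t. ennreal (norm x) * (h (t *\<^sub>R x) * indicator ?B x * indicator {c<..<1} (t * norm x))"
  let ?Y = "\<lambda>z t. h z * ennreal (norm z) * ?I z * (if norm z < t then ennreal (t powr (- real ?d - 1)) else 0)"
  let ?Z = "\<lambda>x r. h (r *\<^sub>R (x /\<^sub>R norm x)) * indicator ?B x * indicator {c<..<1} r"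
  have "(\<integral>\<^sup>+r. (\<integral>\<^sup>+x. h (r *\<^sub>R x) \<partial>sph) * indicator {c<..<1} r \<partial>lborel) =
    (\<integral>\<^sup>+r. (\<integral>\<^sup>+x. ?Z x r \<partial>lborel) / ?v \<partial>lborel)"
    by (rule nn_integral_cong, subst nn_integral_sph, simp, subst nn_integral_multc, simp)
       (simp add: divide_ennreal_def mult_ac)
  also have "\<dots> = (\<integral>\<^sup>+r. \<integral>\<^sup>+x. ?Z x r \<partial>lborel \<partial>lborel) / ?v"
    by (rule nn_integral_divide) simp
  also have "(\<integral>\<^sup>+r. \<integral>\<^sup>+x. ?Z x r \<partial>lborel \<partial>lborel) =
     (\<integral>\<^sup>+x. \<integral>\<^sup>+r. ?Z x r \<partial>lborel \<partial>lborel)"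
    by (rule lborel_pair.Fubini') simp
  \<comment> \<open>Substituting r = t |x| removes the normalization, since r x / |x| = t x; the
    Jacobian is the factor |x|.\<close>
  also have "\<dots> = (\<integral>\<^sup>+x. \<integral>\<^sup>+t. ?X x t \<partial>lborel \<partial>lborel)"
  proof (rule nn_integral_cong_AE)
    have "AE x in lborel. x \<noteq> (0::'a)"
      by (rule AE_lborel_singleton)
    thus "AE x in lborel. (\<integral>\<^sup>+r. ?Z x r \<partial>lborel) =
       (\<integral>\<^sup>+t. ?X x t \<partial>lborel)"
    proof eventually_elim
      case (elim x)
      thus ?case
        by (subst nn_integral_real_affine[where c="norm x" and t=0])
           (auto simp: nn_integral_cmult mult_ac intro!: arg_cong2[where f="(*)"] nn_integral_cong)
    qed
  qed
  also have "\<dots> = (\<integral>\<^sup>+t. \<integral>\<^sup>+x. ?X x t \<partial>lborel \<partial>lborel)"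
    by (rule lborel_pair.Fubini') simp
  \<comment> \<open>For fixed t > 0 put z = t x. The Jacobian t^(-d) and |x| = |z| / t combine to
    the exponent -d - 1, and |x| < 1 becomes |z| < t. For t \<le> 0 both integrands vanish, the
    first one because c \<ge> 0.\<close>
  also have "\<dots> = (\<integral>\<^sup>+t. \<integral>\<^sup>+z. ?Y z t \<partial>lborel \<partial>lborel)"
  proof (rule nn_integral_cong)
    fix t :: real
    show "(\<integral>\<^sup>+x. ?X x t \<partial>lborel) =
       (\<integral>\<^sup>+z. ?Y z t \<partial>lborel)"
    proof (cases "t > 0")
      case False
      have "t * norm x \<le> 0" for x :: 'a
        by (rule mult_nonpos_nonneg) (use False in auto)
      hence "\<not> c < t * norm x" for x :: 'a
        using c by (meson le_less_trans not_le)
      hence 1: "t * norm x \<notin> {c<..<1}" for x :: 'a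
        by (meson greaterThanLessThan_iff)
      have 2: "\<not> norm z < t" for z :: 'a
        using False norm_ge_zero[of z] by linarith
      show ?thesis
        by (simp only: indicator_simps(2)[OF 1] 2 if_False mult_zero_right nn_integral_const mult_zero_left)
    next
      case True
      have e: "ennreal (t ^ ?d) * ennreal (t powr (- real ?d - 1)) * ennreal (t * x) = ennreal x" if "x \<ge> 0" for x
      proof -
        have "t ^ ?d * t powr (- real ?d - 1) * t = 1"
          using True by (simp add: powr_realpow[symmetric] powr_add[symmetric] powr_minus powr_mult_base mult.commute)
        thus ?thesis using True that
          by (simp add: ennreal_mult'[symmetric] ennreal_mult[symmetric] mult.assoc[symmetric])
      qed
      let ?G = "\<lambda>z. ?Y z t"
      have eq: "?X x t =
            ennreal (t ^ ?d) * ?G (t *\<^sub>R x)" for x :: 'a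
      proof -
        have "indicator ?B x * indicator {c<..<1} (t * norm x) =
            ?I (t *\<^sub>R x) * (if norm (t *\<^sub>R x) < t then 1 else 0 :: ennreal)"
          using True by (auto simp: indicator_def)
        hence "?X x t =
          (ennreal (t ^ ?d) * ennreal (t powr (- real ?d - 1)) * ennreal (t * norm x)) *
          (h (t *\<^sub>R x) * (?I (t *\<^sub>R x) * (if norm (t *\<^sub>R x) < t then 1 else 0)))"
          by (subst e[OF norm_ge_zero]) (simp only: mult.assoc)
        also have "\<dots> = ennreal (t ^ ?d) * (h (t *\<^sub>R x) * ennreal (t * norm x) * ?I (t *\<^sub>R x) *
            (if norm (t *\<^sub>R x) < t then ennreal (t powr (- real ?d - 1)) else 0))"
          by (cases "norm (t *\<^sub>R x) < t") (simp_all only: mult_ac if_True if_False mult_zero_left mult_1_left)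
        also have "ennreal (t * norm x) = ennreal (norm (t *\<^sub>R x))"
          using True by simp
        finally show ?thesis .
      qed
      have "(\<integral>\<^sup>+z. ?G z \<partial>lborel) = ennreal (\<bar>t\<bar> ^ ?d) * (\<integral>\<^sup>+x. ?G (t *\<^sub>R x) \<partial>lborel)"
        by (rule nn_integral_lborel_scale) (measurable, use True in simp)
      also have "\<dots> = ennreal (t ^ ?d) * (\<integral>\<^sup>+x. ?G (t *\<^sub>R x) \<partial>lborel)"
        by (simp only: abs_of_pos[OF True])
      also have "\<dots> = (\<integral>\<^sup>+x. ennreal (t ^ ?d) * ?G (t *\<^sub>R x) \<partial>lborel)"
        by (rule nn_integral_cmult[symmetric]) simp
      finally show ?thesis
        by (simp only: eq)
    qed
  qed
  also have "\<dots> = (\<integral>\<^sup>+z. \<integral>\<^sup>+t. ?Y z t \<partial>lborel \<partial>lborel)"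
    by (rule lborel_pair.Fubini') simp
  \<comment> \<open>The t-integral over t > |z| is \<open>nn_integral_powr_tail\<close> with
    exponent d, which gives |z|^(-d) / d.\<close>
  also have "\<dots> = (\<integral>\<^sup>+z. h z * ennreal (norm z powr (1 - real ?d)) * ?I z / ?d \<partial>lborel)"
  proof (rule nn_integral_cong)
    fix z :: 'a
    show "(\<integral>\<^sup>+t. ?Y z t \<partial>lborel) =
       h z * ennreal (norm z powr (1 - real ?d)) * ?I z / ?d"
    proof (cases "z = 0")
      case False
      have "ennreal (norm z) * ennreal (norm z powr (- real ?d) / real ?d) = ennreal (norm z powr (1 - real ?d)) / ?d"
      proof -
        have "norm z * (norm z powr (- real ?d) / real ?d) = norm z powr (1 + - real ?d) / real ?d"
          using powr_mult_base[of "norm z" "- real ?d"] by simp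
        hence "ennreal (norm z) * ennreal (norm z powr (- real ?d) / real ?d) = ennreal (norm z powr (1 - real ?d) / real ?d)"
          by (simp only: ennreal_mult''[symmetric] norm_ge_zero powr_ge_zero of_nat_0_le_iff divide_nonneg_nonneg) simp
        thus ?thesis
          by (simp add: divide_ennreal[symmetric] ennreal_of_nat_eq_real_of_nat)
      qed
      moreover have "(\<integral>\<^sup>+t. ?Y z t \<partial>lborel) =
          h z * ?I z * (ennreal (norm z) * ennreal (norm z powr (- real ?d) / real ?d))"
        using False by (subst nn_integral_cmult) (simp_all add: nn_integral_powr_tail mult_ac)
      ultimately show ?thesis
        by (simp add: ennreal_times_divide mult_ac)
    qed (use c in \<open>auto simp: indicator_def\<close>)
  qed
  also have "\<dots> = (\<integral>\<^sup>+z. h z * ennreal (norm z powr (1 - real ?d)) * ?I z \<partial>lborel) / ?d"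
    by (rule nn_integral_divide) simp
  also have "\<dots> / ?v = (\<integral>\<^sup>+z. h z * ennreal (norm z powr (1 - real ?d)) * ?I z \<partial>lborel) / (?d * ?v)"
    using emeasure_lborel_unit_ball[where 'a='a]
    by (simp add: divide_ennreal_def ennreal_inverse_mult top.not_eq_extremum mult.assoc of_nat_less_top)
  finally show ?thesis .
qed

section \<open>Holomorphic functions of several variables\<close>

lemma norm_vector_scalar_mult: "norm (c *s v) = cmod c * norm (v :: complex^'n)"
  by (simp add: norm_vec_def norm_mult L2_set_right_distrib)

lemma linear_vector_scalar_mult_left: "linear (\<lambda>w::complex. w *s (v :: complex^'n))"
  by (rule linearI) (auto simp: vec_eq_iff algebra_simps)

lemma linear_vector_scalar_mult_right: "linear (\<lambda>v. w *s (v :: complex^'n))"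
  by (rule linearI) (auto simp: vec_eq_iff algebra_simps)

lemma of_real_vector_scalar_mult: "complex_of_real t *s v = t *\<^sub>R (v :: complex^'n)"
  by (simp add: vec_eq_iff scaleR_conv_of_real[where 'a=complex])

lemma scaleR_vector_scalar_mult: "t *\<^sub>R (c *s v) = (complex_of_real t * c) *s (v :: complex^'n)"
  by (simp add: vec_eq_iff scaleR_conv_of_real[where 'a=complex])

lemma continuous_on_vector_scalar_mult [continuous_intros]:
  fixes f :: "'a::topological_space \<Rightarrow> complex" and g :: "'a \<Rightarrow> complex^'n"
  assumes "continuous_on S f" "continuous_on S g"
  shows "continuous_on S (\<lambda>x. f x *s g x)"
  unfolding vector_scalar_mult_def by (intro continuous_intros assms)

definition cderiv :: "(complex^'n \<Rightarrow> complex) \<Rightarrow> complex^'n \<Rightarrow> complex^'n \<Rightarrow> complex" where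
  "cderiv f z = frechet_derivative f (at z)"

lemma
  assumes "holomorphic_several f S" "z \<in> S"
  shows has_derivative_cderiv: "(f has_derivative cderiv f z) (at z)"
    and cderiv_scale: "cderiv f z (c *s v) = c * cderiv f z v"
proof -
  obtain D where D: "(f has_derivative D) (at z)" "\<And>c v. D (c *s v) = c * D v"
    using assms unfolding holomorphic_several_def by blast
  have "cderiv f z = D"
    unfolding cderiv_def using frechet_derivative_at[OF D(1)] by simp
  thus "(f has_derivative cderiv f z) (at z)" "cderiv f z (c *s v) = c * cderiv f z v"
    using D by auto
qed

lemma linear_cderiv:
  assumes "holomorphic_several f S" "z \<in> S"
  shows "linear (cderiv f z)"
  using has_derivative_linear[OF has_derivative_cderiv[OF assms]] .

lemma holomorphic_severalI:
  assumes "\<And>z. z \<in> S \<Longrightarrow> (f has_derivative D z) (at z)"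
    and "\<And>z c v. z \<in> S \<Longrightarrow> D z (c *s v) = c * D z v"
  shows "holomorphic_several f S"
  using assms unfolding holomorphic_several_def by blast

lemma holomorphic_several_continuous_on:
  assumes "holomorphic_several f S"
  shows "continuous_on S f"
  using has_derivative_cderiv[OF assms] has_derivative_continuous
  by (blast intro: continuous_at_imp_continuous_on)

lemma holomorphic_several_cong:
  assumes "open S" "\<And>z. z \<in> S \<Longrightarrow> f z = g z" "holomorphic_several g S"
  shows "holomorphic_several f S"
  using assms has_derivative_transform_within_open[of g _ _ UNIV S f]
  unfolding holomorphic_several_def by metis

lemma holomorphic_several_local:
  assumes "\<And>z. z \<in> S \<Longrightarrow> \<exists>T. z \<in> T \<and> holomorphic_several f T"
  shows "holomorphic_several f S"
  using assms unfolding holomorphic_several_def by blast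

lemma holomorphic_several_const: "holomorphic_several (\<lambda>_. c) S"
  by (rule holomorphic_severalI[where D="\<lambda>_ _. 0"]) auto

lemma holomorphic_several_component: "holomorphic_several (\<lambda>z. z $ k) S"
  by (rule holomorphic_severalI[where D="\<lambda>_ v. v $ k"])
     (auto intro!: bounded_linear_imp_has_derivative bounded_linear_vec_nth)

lemma holomorphic_several_add:
  assumes "holomorphic_several f S" "holomorphic_several g S"
  shows "holomorphic_several (\<lambda>z. f z + g z) S"
  by (rule holomorphic_severalI[where D="\<lambda>z v. cderiv f z v + cderiv g z v"])
     (auto intro!: has_derivative_add has_derivative_cderiv[of _ S] assms
       simp: cderiv_scale[OF assms(1)] cderiv_scale[OF assms(2)] algebra_simps)

lemma holomorphic_several_mult:
  assumes "holomorphic_several f S" "holomorphic_several g S"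
  shows "holomorphic_several (\<lambda>z. f z * g z) S"
proof (rule holomorphic_severalI[where D="\<lambda>z v. f z * cderiv g z v + cderiv f z v * g z"])
  fix z c v assume z: "z \<in> S"
  show "((\<lambda>z. f z * g z) has_derivative (\<lambda>v. f z * cderiv g z v + cderiv f z v * g z)) (at z)"
    by (intro has_derivative_mult has_derivative_cderiv[of _ S] assms z)
  show "f z * cderiv g z (c *s v) + cderiv f z (c *s v) * g z = c * (f z * cderiv g z v + cderiv f z v * g z)"
    by (simp add: cderiv_scale[OF assms(1) z] cderiv_scale[OF assms(2) z] algebra_simps)
qed

lemma holomorphic_several_sum:
  assumes "finite I" "\<And>i. i \<in> I \<Longrightarrow> holomorphic_several (f i) S"
  shows "holomorphic_several (\<lambda>z. \<Sum>i\<in>I. f i z) S"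
  using assms by (induction I) (auto intro: holomorphic_several_const holomorphic_several_add)

lemma holomorphic_several_power:
  assumes "holomorphic_several f S"
  shows "holomorphic_several (\<lambda>z. f z ^ m) S"
  by (induction m) (auto intro: holomorphic_several_const holomorphic_several_mult assms)

lemma holomorphic_several_compose_affine:
  fixes T :: "complex^'n \<Rightarrow> complex^'m"
  assumes f: "holomorphic_several f V" and T: "linear T" "\<And>c v. T (c *s v) = c *s T v"
    and sub: "\<And>z. z \<in> S \<Longrightarrow> b + T z \<in> V"
  shows "holomorphic_several (\<lambda>z. f (b + T z)) S"
proof (rule holomorphic_severalI[where D="\<lambda>z v. cderiv f (b + T z) (T v)"])
  fix z assume z: "z \<in> S"
  have "((\<lambda>z. b + T z) has_derivative T) (at z)"
    using T(1) by (auto intro!: derivative_eq_intros bounded_linear_imp_has_derivative simp: linear_conv_bounded_linear)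
  from has_derivative_compose[OF this has_derivative_cderiv[OF f sub[OF z]]]
  show "((\<lambda>z. f (b + T z)) has_derivative (\<lambda>v. cderiv f (b + T z) (T v))) (at z)" .
  show "cderiv f (b + T z) (T (c *s v)) = c * cderiv f (b + T z) (T v)" for c v
    by (simp add: T(2) cderiv_scale[OF f sub[OF z]])
qed

section \<open>One-variable slices and Cauchy's formula\<close>

lemma slice_has_field_derivative:
  assumes f: "holomorphic_several f S" and w: "a + w *s v \<in> S"
  shows "((\<lambda>w. f (a + w *s v)) has_field_derivative cderiv f (a + w *s v) v) (at w)"
proof -
  have "((\<lambda>w::complex. a + w *s v) has_derivative (\<lambda>w. w *s v)) (at w)"
    using linear_vector_scalar_mult_left[of v]
    by (auto intro!: derivative_eq_intros bounded_linear_imp_has_derivative simp: linear_conv_bounded_linear)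
  from has_derivative_compose[OF this has_derivative_cderiv[OF f w]]
  show ?thesis
    unfolding has_field_derivative_def
    by (rule has_derivative_eq_rhs) (auto simp: cderiv_scale[OF f w] mult.commute)
qed

lemma slice_holomorphic_on:
  assumes f: "holomorphic_several f S" and "\<And>w. w \<in> W \<Longrightarrow> a + w *s v \<in> S"
  shows "(\<lambda>w. f (a + w *s v)) holomorphic_on W"
  using slice_has_field_derivative[OF f] assms(2)
  by (meson field_differentiable_at_within field_differentiable_def holomorphic_onI)

abbreviation circ :: "real \<Rightarrow> complex" where
  "circ t \<equiv> exp (2 * of_real pi * \<i> * of_real t)"

lemma norm_circ [simp]: "cmod (circ t) = 1"
  using norm_exp_i_times[of "2 * pi * t"] by (simp add: mult_ac)

lemma has_integral_circlepath:
  assumes "(f has_contour_integral I) (circlepath 0 r)"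
  shows "((\<lambda>t. f (of_real r * circ t) * (2 * of_real pi * \<i> * of_real r * circ t)) has_integral I) {0..1}"
proof -
  have "((\<lambda>t. f (circlepath 0 r t) * vector_derivative (circlepath 0 r) (at t within {0..1})) has_integral I) {0..1}"
    using assms by (simp add: has_contour_integral_def)
  thus ?thesis
    by (rule has_integral_eq[rotated]) (simp add: vector_derivative_circlepath01, simp add: circlepath)
qed

text \<open>Expresses a directional derivative through values of \<open>f\<close> on a circle.
  Continuity and holomorphy of derivatives then reduce to those of \<open>f\<close> itself.\<close>

lemma cderiv_Cauchy:
  assumes f: "holomorphic_several f S" and r: "r > 0" and sub: "\<And>w. w \<in> cball 0 r \<Longrightarrow> z + w *s v \<in> S"
  shows "cderiv f z v = integral {0..1} (\<lambda>t. f (z + (of_real r * circ t) *s v) * (1 / (of_real r * circ t)))"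
proof -
  let ?h = "\<lambda>w. f (z + w *s v)"
  have hol: "?h holomorphic_on cball 0 r"
    by (rule slice_holomorphic_on[OF f sub])
  have "z + 0 *s v \<in> S" using sub[of 0] r by auto
  hence d: "deriv ?h 0 = cderiv f z v"
    using slice_has_field_derivative[OF f, of z 0 v] DERIV_imp_deriv by force
  \<comment> \<open>The formula for higher derivatives, at order 1, has a squared denominator; one
    of its two factors is cancelled by the derivative of the path.\<close>
  have "((\<lambda>u. ?h u / (u - 0) ^ (Suc 1)) has_contour_integral (2 * pi * \<i>) / fact 1 * (deriv ^^ 1) ?h 0) (circlepath 0 r)"
    using hol r by (intro Cauchy_has_contour_integral_higher_derivative_circlepath)
      (auto intro: holomorphic_on_imp_continuous_on holomorphic_on_subset)
  from has_integral_circlepath[OF this]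
  have "((\<lambda>t. 1 / (2 * of_real pi * \<i>) * (?h (of_real r * circ t) / (of_real r * circ t - 0) ^ Suc 1 * (2 * of_real pi * \<i> * of_real r * circ t)))
         has_integral 1 / (2 * of_real pi * \<i>) * ((2 * pi * \<i>) / fact 1 * (deriv ^^ 1) ?h 0)) {0..1}"
    by (rule has_integral_mult_right)
  hence "((\<lambda>t. ?h (of_real r * circ t) * (1 / (of_real r * circ t))) has_integral cderiv f z v) {0..1}"
    using r by (simp add: d power2_eq_square field_simps)
  thus ?thesis by (simp add: integral_unique)
qed

text \<open>Differentiation under the integral requires a derivative jointly continuous in the point
  and the parameter, while only \<open>K\<close> is assumed continuous. The Cauchy formula on a
  small circle in each basis direction supplies that continuity.\<close>

lemma holomorphic_several_integral:
  fixes K :: "complex^'n \<Rightarrow> 'b::euclidean_space \<Rightarrow> complex"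
  assumes U: "open U"
    and holo: "\<And>t. t \<in> cbox a b \<Longrightarrow> holomorphic_several (\<lambda>z. K z t) U"
    and cont: "continuous_on (U \<times> cbox a b) (\<lambda>(z, t). K z t)"
  shows "holomorphic_several (\<lambda>z. integral (cbox a b) (K z)) U"
proof (rule holomorphic_several_local)
  fix z0 assume "z0 \<in> U"
  then obtain e where e: "e > 0" "cball z0 e \<subseteq> U"
    using U open_contains_cball by blast
  define r where "r = e / 2"
  have r: "r > 0" using e by (simp add: r_def)
  let ?V = "ball z0 r"
  have VU: "?V \<subseteq> U"
    using e by (force simp: r_def subset_iff)
  have sub: "z + w *s i \<in> U" if "z \<in> ?V" "w \<in> cball 0 r" "i \<in> Basis" for z w and i :: "complex^'n"
  proof -
    have "norm (w *s i) \<le> r" using that by (simp add: norm_vector_scalar_mult)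
    moreover have "dist z0 (z + w *s i) \<le> dist z0 z + norm (w *s i)"
      by (metis dist_norm add_diff_cancel_left' dist_commute dist_triangle)
    ultimately have "dist z0 (z + w *s i) \<le> e" using that(1) by (simp add: r_def)
    thus ?thesis using e by (auto simp: mem_cball)
  qed
  \<comment> \<open>The Leibniz rule asks for a derivative valued in bounded linear maps; its
    continuity can be checked on basis vectors.\<close>
  define D where "D z t = Blinfun (cderiv (\<lambda>z. K z t) z)" for z t
  have D: "blinfun_apply (D z t) = cderiv (\<lambda>z. K z t) z" if "z \<in> U" "t \<in> cbox a b" for z t
    unfolding D_def using that
    by (intro bounded_linear_Blinfun_apply linear_conv_bounded_linear[THEN iffD1] linear_cderiv[OF holo])
  have contD: "continuous_on (?V \<times> cbox a b) (\<lambda>(z, t). D z t)"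
  proof (rule continuous_on_blinfun_componentwise)
    fix i :: "complex^'n" assume i: "i \<in> Basis"
    have "continuous_on (?V \<times> cbox a b)
      (\<lambda>p. integral (cbox 0 1) (\<lambda>s. K (fst p + (of_real r * circ s) *s i) (snd p) * (1 / (of_real r * circ s))))"
    proof (rule integral_continuous_on_param)
      have "continuous_on ((?V \<times> cbox a b) \<times> cbox 0 1)
         (\<lambda>q. (\<lambda>(z, t). K z t) (fst (fst q) + (of_real r * circ (snd q)) *s i, snd (fst q)))"
        using sub[OF _ _ i] r
        by (intro continuous_on_compose2[OF cont] continuous_intros) (auto simp: norm_mult)
      moreover have "continuous_on ((?V \<times> cbox a b) \<times> cbox 0 1) (\<lambda>q. 1 / (complex_of_real r * circ (snd q)))"
        using r by (intro continuous_intros) auto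
      ultimately show "continuous_on ((?V \<times> cbox a b) \<times> cbox 0 1)
         (\<lambda>(p, s). K (fst p + (of_real r * circ s) *s i) (snd p) * (1 / (of_real r * circ s)))"
        unfolding split_beta by (intro continuous_on_mult) auto
    qed
    moreover have "blinfun_apply (case p of (z, t) \<Rightarrow> D z t) i =
        integral (cbox 0 1) (\<lambda>s. K (fst p + (of_real r * circ s) *s i) (snd p) * (1 / (of_real r * circ s)))"
      if p: "p \<in> ?V \<times> cbox a b" for p
    proof -
      obtain z t where [simp]: "p = (z, t)" by (cases p)
      have zt: "z \<in> ?V" "t \<in> cbox a b" using p by auto
      have "blinfun_apply (D z t) i = cderiv (\<lambda>z. K z t) z i"
        using D[of z t] VU zt by auto
      also have "\<dots> = integral {0..1} (\<lambda>s. K (z + (of_real r * circ s) *s i) t * (1 / (of_real r * circ s)))"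
        using zt i by (intro cderiv_Cauchy[OF holo r sub]) auto
      finally show ?thesis by simp
    qed
    ultimately show "continuous_on (?V \<times> cbox a b) (\<lambda>p. blinfun_apply (case p of (z, t) \<Rightarrow> D z t) i)"
      by (subst continuous_on_cong[OF refl]) auto
  qed
  have "holomorphic_several (\<lambda>z. integral (cbox a b) (K z)) ?V"
  proof (rule holomorphic_severalI[where D="\<lambda>z. blinfun_apply (integral (cbox a b) (D z))"])
    fix z assume z: "z \<in> ?V"
    have "((\<lambda>x. integral (cbox a b) (K x)) has_derivative blinfun_apply (integral (cbox a b) (D z))) (at z within ?V)"
    proof (rule leibniz_rule[OF _ _ contD z convex_ball])
      fix x t assume "x \<in> ?V" "t \<in> cbox a b"
      thus "((\<lambda>x. K x t) has_derivative blinfun_apply (D x t)) (at x within ?V)"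
        using D[of x t] has_derivative_cderiv[OF holo, of t x] VU
        by (auto intro!: has_derivative_at_withinI[of _ _ x] simp: subset_iff)
    next
      fix x assume "x \<in> ?V"
      hence "continuous_on (cbox a b) (\<lambda>t. (\<lambda>(z, t). K z t) (x, t))"
        using VU by (intro continuous_on_compose2[OF cont] continuous_intros) auto
      thus "K x integrable_on cbox a b"
        by (intro integrable_continuous) simp
    qed
    thus "((\<lambda>x. integral (cbox a b) (K x)) has_derivative blinfun_apply (integral (cbox a b) (D z))) (at z)"
      using z at_within_open[OF z open_ball] by simp
    fix c v
    have "continuous_on (cbox a b) (\<lambda>t. (\<lambda>(z, t). D z t) (z, t))"
      using z by (intro continuous_on_compose2[OF contD] continuous_intros) auto
    hence int: "D z integrable_on cbox a b"
      by (intro integrable_continuous) simp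
    have "blinfun_apply (integral (cbox a b) (D z)) (c *s v) = integral (cbox a b) (\<lambda>t. blinfun_apply (D z t) (c *s v))"
      by (rule blinfun_apply_integral[OF int])
    also have "\<dots> = integral (cbox a b) (\<lambda>t. c * blinfun_apply (D z t) v)"
    proof (rule integral_cong)
      fix t assume "t \<in> cbox a b"
      thus "blinfun_apply (D z t) (c *s v) = c * blinfun_apply (D z t) v"
        using D[of z t] z VU cderiv_scale[OF holo, of t z] by auto
    qed
    also have "\<dots> = c * integral (cbox a b) (\<lambda>t. blinfun_apply (D z t) v)"
      by simp
    also have "integral (cbox a b) (\<lambda>t. blinfun_apply (D z t) v) = blinfun_apply (integral (cbox a b) (D z)) v"
      by (rule blinfun_apply_integral[OF int, symmetric])
    finally show "blinfun_apply (integral (cbox a b) (D z)) (c *s v) = c * blinfun_apply (integral (cbox a b) (D z)) v" .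
  qed
  thus "\<exists>T. z0 \<in> T \<and> holomorphic_several (\<lambda>z. integral (cbox a b) (K z)) T"
    using r by (intro exI[of _ ?V]) auto
qed

text \<open>By the Cauchy formula the derivative is locally a parameter integral of translates of
  \<open>f\<close>, to which \<open>holomorphic_several_integral\<close> applies.\<close>

lemma holomorphic_several_cderiv:
  assumes f: "holomorphic_several f U" and U: "open U"
  shows "holomorphic_several (\<lambda>z. cderiv f z v) U"
proof (rule holomorphic_several_local)
  fix z0 assume "z0 \<in> U"
  then obtain e where e: "e > 0" "cball z0 e \<subseteq> U"
    using U open_contains_cball by blast
  \<comment> \<open>Adding 1 covers \<open>v = 0\<close>, while \<open>r * norm v\<close> stays at
    most \<open>e / 2\<close>.\<close>
  define r where "r = e / 2 / (norm v + 1)"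
  let ?V = "ball z0 (e / 2)"
  have nv: "norm v + 1 > 0" using norm_ge_zero[of v] by linarith
  have r: "r > 0" using e nv by (simp add: r_def)
  have rv: "r * norm v \<le> e / 2"
    using e nv mult_left_mono[of "norm v" "norm v + 1" "e/2"] by (simp add: r_def field_simps)
  have sub: "z + w *s v \<in> U" if "z \<in> ?V" "cmod w \<le> r" for z w
  proof -
    have "norm (w *s v) \<le> e / 2"
      using mult_right_mono[OF that(2), of "norm v"] rv by (simp add: norm_vector_scalar_mult)
    moreover have "dist z0 (z + w *s v) \<le> dist z0 z + norm (w *s v)"
      by (metis dist_norm add_diff_cancel_left' dist_commute dist_triangle)
    ultimately have "dist z0 (z + w *s v) \<le> e" using that(1) by simp
    thus ?thesis using e by (auto simp: mem_cball)
  qed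
  let ?K = "\<lambda>z s. f (z + (of_real r * circ s) *s v) * (1 / (of_real r * circ s))"
  have "holomorphic_several (\<lambda>z. integral (cbox 0 1) (?K z)) ?V"
  proof (rule holomorphic_several_integral)
    fix s :: real
    have "holomorphic_several (\<lambda>z. f ((of_real r * circ s) *s v + z)) ?V"
      using r sub by (intro holomorphic_several_compose_affine[OF f, of "\<lambda>z. z"])
        (auto simp: norm_mult add.commute intro: linear_id[unfolded id_def])
    thus "holomorphic_several (\<lambda>z. ?K z s) ?V"
      by (intro holomorphic_several_mult holomorphic_several_const) (simp add: add.commute)
  next
    have "continuous_on (?V \<times> cbox 0 1) (\<lambda>q. f (fst q + (of_real r * circ (snd q)) *s v))"
      using sub r
      by (intro continuous_on_compose2[OF holomorphic_several_continuous_on[OF f]] continuous_intros) (auto simp: norm_mult)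
    moreover have "continuous_on (?V \<times> cbox 0 1) (\<lambda>q. 1 / (complex_of_real r * circ (snd q)))"
      using r by (intro continuous_intros) auto
    ultimately show "continuous_on (?V \<times> cbox 0 1) (\<lambda>(z, s). ?K z s)"
      unfolding split_beta by (intro continuous_on_mult)
  qed auto
  moreover have "cderiv f z v = integral (cbox 0 1) (?K z)" if "z \<in> ?V" for z
    using cderiv_Cauchy[OF f r, of z v] sub[OF that] by simp
  ultimately have "holomorphic_several (\<lambda>z. cderiv f z v) ?V"
    by (intro holomorphic_several_cong[of ?V "\<lambda>z. cderiv f z v"]) auto
  thus "\<exists>T. z0 \<in> T \<and> holomorphic_several (\<lambda>z. cderiv f z v) T"
    using e by (intro exI[of _ ?V]) auto
qed

section \<open>The radial derivative and the operator \<open>J_op\<close>\<close>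

lemma complex_partial_eq_cderiv:
  assumes "holomorphic_several g S" "z \<in> S"
  shows "complex_partial k g z = cderiv g z (axis k 1)"
proof -
  let ?a = "z - (z $ k) *s axis k 1"
  have e: "(\<chi> j. if j = k then w else z $ j) = ?a + w *s axis k 1" for w
    by (auto simp: vec_eq_iff axis_def)
  have "((\<lambda>w. g (?a + w *s axis k 1)) has_field_derivative cderiv g (?a + (z $ k) *s axis k 1) (axis k 1)) (at (z $ k))"
    by (rule slice_has_field_derivative[OF assms(1)]) (use assms in auto)
  thus ?thesis
    unfolding complex_partial_def e by (simp add: DERIV_imp_deriv)
qed

lemma cderiv_sum_partials:
  fixes z :: "complex^'n"
  assumes "holomorphic_several g S" "z \<in> S"
  shows "cderiv g z v = (\<Sum>k\<in>UNIV. v $ k * cderiv g z (axis k 1))"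
proof -
  have "v = (\<Sum>k\<in>UNIV. v $ k *s axis k 1)"
    by (auto simp: vec_eq_iff axis_def if_distrib cong: if_cong)
  hence "cderiv g z v = cderiv g z (\<Sum>k\<in>UNIV. v $ k *s axis k 1)" by simp
  also have "\<dots> = (\<Sum>k\<in>UNIV. cderiv g z (v $ k *s axis k 1))"
    by (rule linear_sum[OF linear_cderiv[OF assms]])
  also have "\<dots> = (\<Sum>k\<in>UNIV. v $ k * cderiv g z (axis k 1))"
    by (simp add: cderiv_scale[OF assms])
  finally show ?thesis .
qed

lemma radial_deriv_eq_cderiv:
  assumes "holomorphic_several g S" "z \<in> S"
  shows "radial_deriv g z = cderiv g z z"
  unfolding radial_deriv_def complex_partial_eq_cderiv[OF assms]
  by (rule cderiv_sum_partials[OF assms, symmetric])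

lemma scaleR_in_unit_ball:
  "z \<in> ball (0::'a::real_normed_vector) 1 \<Longrightarrow> t \<in> {0..1} \<Longrightarrow> t *\<^sub>R z \<in> ball 0 1"
  using mult_mono[of t 1 "norm z" "norm z"] by (auto simp: )

text \<open>Complex linearity of the derivative cancels the division by t:
  \<open>radial_deriv g (t *\<^sub>R z)\<close> is t times the derivative in the fixed direction z.
  The new integrand is continuous up to t = 0, where the old one has its default value.\<close>

lemma J_op_eq:
  fixes g f :: "complex^'n \<Rightarrow> complex"
  assumes g: "holomorphic_several g (ball 0 1)" and z: "z \<in> ball 0 1"
  shows "J_op g f z = integral {0..1} (\<lambda>t. f (t *\<^sub>R z) * cderiv g (t *\<^sub>R z) z)"
  unfolding J_op_def
proof (rule integral_spike[of "{0}"])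
  fix t :: real assume t: "t \<in> {0..1} - {0}"
  have tz: "t *\<^sub>R z \<in> ball 0 1"
    using scaleR_in_unit_ball[OF z] t by auto
  have "radial_deriv g (t *\<^sub>R z) = cderiv g (t *\<^sub>R z) (complex_of_real t *s z)"
    by (simp add: radial_deriv_eq_cderiv[OF g tz] of_real_vector_scalar_mult)
  also have "\<dots> = complex_of_real t * cderiv g (t *\<^sub>R z) z"
    by (rule cderiv_scale[OF g tz])
  finally show "f (t *\<^sub>R z) * cderiv g (t *\<^sub>R z) z = f (t *\<^sub>R z) * radial_deriv g (t *\<^sub>R z) / complex_of_real t"
    using t by simp
qed simp

lemma holomorphic_several_J_op:
  fixes g f :: "complex^'n \<Rightarrow> complex"
  assumes f: "holomorphic_several f (ball 0 1)" and g: "holomorphic_several g (ball 0 1)"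
  shows "holomorphic_several (J_op g f) (ball 0 1)"
proof (rule holomorphic_several_cong)
  \<comment> \<open>The direction of differentiation is z itself. Expanding it in coordinates
    separates this linear dependence from the point of evaluation, so that each factor is
    holomorphic in z.\<close>
  let ?K = "\<lambda>z t. f (t *\<^sub>R z) * (\<Sum>k\<in>UNIV. z $ k * cderiv g (t *\<^sub>R z) (axis k 1))"
  show "J_op g f z = integral (cbox 0 1) (?K z)" if "z \<in> ball 0 1" for z
    unfolding J_op_eq[OF g that] cbox_interval
    using cderiv_sum_partials[OF g scaleR_in_unit_ball[OF that]]
    by (intro integral_cong) simp
  have sc: "holomorphic_several (\<lambda>z. h (t *\<^sub>R z)) (ball 0 1)"
    if "holomorphic_several h (ball 0 1)" "t \<in> {0..1}" for h :: "complex^'n \<Rightarrow> complex" and t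
    using holomorphic_several_compose_affine[OF that(1), of "\<lambda>z. t *\<^sub>R z" "ball 0 1" 0] scaleR_in_unit_ball[where 'a="complex^'n", OF _ that(2)]
    by (simp add: scaleR_vector_scalar_mult vec_eq_iff scaleR_conv_of_real[where 'a=complex] linear_iff algebra_simps)
  show "holomorphic_several (\<lambda>z. integral (cbox 0 1) (?K z)) (ball 0 1)"
  proof (rule holomorphic_several_integral)
    show "holomorphic_several (\<lambda>z. ?K z t) (ball 0 1)" if "t \<in> cbox 0 1" for t
      using that sc[OF f, of t] sc[OF holomorphic_several_cderiv[OF g open_ball], of t]
      by (intro holomorphic_several_mult holomorphic_several_sum holomorphic_several_component) auto
    have *: "continuous_on (ball 0 1 \<times> cbox 0 1) (\<lambda>p. h (snd p *\<^sub>R fst p))"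
      if "holomorphic_several h (ball 0 1)" for h :: "complex^'n \<Rightarrow> complex"
      using scaleR_in_unit_ball
      by (intro continuous_on_compose2[OF holomorphic_several_continuous_on[OF that]] continuous_intros) fastforce
    show "continuous_on (ball 0 1 \<times> cbox 0 1) (\<lambda>(z, t). ?K z t)"
      unfolding split_beta
      by (intro continuous_intros *[OF f] *[OF holomorphic_several_cderiv[OF g open_ball]])
  qed auto
qed auto

text \<open>The identity R(J_g f) = f Rg, obtained on the slice through z, where
  \<open>J_op g f\<close> is a primitive. The derivative at \<mu> = 1 is the form to which a Cauchy
  estimate on the slice applies.\<close>

lemma J_op_slice:
  fixes g f :: "complex^'n \<Rightarrow> complex"
  assumes f: "holomorphic_several f (ball 0 1)" and g: "holomorphic_several g (ball 0 1)" and z: "z \<in> ball 0 1"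
  shows "((\<lambda>\<mu>. J_op g f (\<mu> *s z)) has_field_derivative f z * radial_deriv g z) (at 1)"
proof -
  define W where "W = {w::complex. w *s z \<in> ball 0 1}"
  have W_eq: "W = (\<lambda>w. w *s z) -` ball 0 1" by (auto simp: W_def)
  have "open W" unfolding W_eq
    by (rule open_vimage) (auto intro!: continuous_intros)
  have "convex W" unfolding W_eq
    by (rule convex_linear_vimage[OF linear_vector_scalar_mult_left]) simp
  let ?\<phi> = "\<lambda>w. f (w *s z) * cderiv g (w *s z) z"
  have hol: "?\<phi> holomorphic_on W"
    using slice_holomorphic_on[OF f, of W 0 z]
      slice_holomorphic_on[OF holomorphic_several_cderiv[OF g open_ball], of W 0 z z]
    by (intro holomorphic_intros) (auto simp: W_def)
  \<comment> \<open>W is convex and contains 0, so a primitive exists on all of it, and the integral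
    defining \<open>J_op\<close> runs along the segment from 0 to \<mu> inside W.\<close>
  obtain \<Phi> where \<Phi>: "\<And>w. w \<in> W \<Longrightarrow> (\<Phi> has_field_derivative ?\<phi> w) (at w)"
    using holomorphic_convex_primitive'[OF \<open>convex W\<close> \<open>open W\<close> hol] at_within_open[OF _ \<open>open W\<close>]
    by metis
  have J: "J_op g f (\<mu> *s z) = \<Phi> \<mu> - \<Phi> 0" if \<mu>: "\<mu> \<in> W" for \<mu>
  proof -
    have \<mu>z: "\<mu> *s z \<in> ball 0 1" using \<mu> by (simp add: W_def)
    have tW: "complex_of_real t * \<mu> \<in> W" if "t \<in> {0..1}" for t
      using scaleR_in_unit_ball[OF \<mu>z that] by (simp add: W_def scaleR_vector_scalar_mult)
    have "((\<lambda>t. \<mu> * ?\<phi> (of_real t * \<mu>)) has_integral \<Phi> (of_real 1 * \<mu>) - \<Phi> (of_real 0 * \<mu>)) {0..1}"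
    proof (rule fundamental_theorem_of_calculus)
      fix t :: real assume t: "t \<in> {0..1}"
      have "((\<lambda>t. complex_of_real t * \<mu>) has_vector_derivative \<mu>) (at t within {0..1})"
        by (auto intro!: derivative_eq_intros)
      from field_vector_diff_chain_within[OF this has_field_derivative_at_within[OF \<Phi>[OF tW[OF t]]]]
      show "((\<lambda>t. \<Phi> (of_real t * \<mu>)) has_vector_derivative \<mu> * ?\<phi> (of_real t * \<mu>)) (at t within {0..1})"
        by (simp add: o_def)
    qed simp
    hence I: "integral {0..1} (\<lambda>t. \<mu> * ?\<phi> (of_real t * \<mu>)) = \<Phi> (of_real 1 * \<mu>) - \<Phi> (of_real 0 * \<mu>)"
      by (rule integral_unique)
    have "J_op g f (\<mu> *s z) = integral {0..1} (\<lambda>t. \<mu> * ?\<phi> (of_real t * \<mu>))"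
      unfolding J_op_eq[OF g \<mu>z]
    proof (rule integral_cong)
      fix t :: real assume "t \<in> {0..1}"
      from scaleR_in_unit_ball[OF \<mu>z this]
      show "f (t *\<^sub>R (\<mu> *s z)) * cderiv g (t *\<^sub>R (\<mu> *s z)) (\<mu> *s z) = \<mu> * ?\<phi> (of_real t * \<mu>)"
        by (simp add: cderiv_scale[OF g] scaleR_vector_scalar_mult)
    qed
    thus ?thesis unfolding I by simp
  qed
  have "1 \<in> W" using z by (simp add: W_def)
  have "((\<lambda>\<mu>. \<Phi> \<mu> - \<Phi> 0) has_field_derivative ?\<phi> 1) (at 1)"
    using \<Phi>[OF \<open>1 \<in> W\<close>] by (auto intro!: derivative_eq_intros)
  hence "((\<lambda>\<mu>. J_op g f (\<mu> *s z)) has_field_derivative ?\<phi> 1) (at 1)"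
    by (rule has_field_derivative_transform_within_open[OF _ \<open>open W\<close> \<open>1 \<in> W\<close>]) (simp add: J)
  thus ?thesis
    by (simp add: radial_deriv_eq_cderiv[OF g z])
qed

section \<open>Poisson inequality for powers of moduli\<close>

text \<open>For \<open>cmod u = 1\<close> the denominator is also
  \<open>(cmod (u - a))\<^sup>2\<close>, so this is the Poisson kernel of the disc. With
  \<open>1 - cnj a * u\<close> a rotation of u can be moved onto a, as in
  \<open>poisson_rotate\<close>.\<close>

definition poisson :: "complex \<Rightarrow> complex \<Rightarrow> real" where
  "poisson a u = (1 - (cmod a)\<^sup>2) / (cmod (1 - cnj a * u))\<^sup>2"

lemma poisson_nonneg: "cmod a < 1 \<Longrightarrow> 0 \<le> poisson a u"
  by (simp add: poisson_def power_le_one)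

lemma one_minus_cnj_mult_neq_0: "cmod a * cmod u < 1 \<Longrightarrow> 1 - cnj a * u \<noteq> 0"
  by (metis complex_mod_cnj norm_mult norm_one order.irrefl right_minus_eq)

lemma continuous_on_poisson_circ:
  assumes "cmod a < 1"
  shows "continuous_on S (\<lambda>t. poisson a (circ t))"
  unfolding poisson_def using one_minus_cnj_mult_neq_0[of a "circ t" for t] assms
  by (intro continuous_intros) auto

text \<open>Cauchy's formula applied to G times (1 - |a|^2) / (1 - cnj a z): this factor equals 1 at
  z = a, and on the circle it turns the Cauchy kernel into the Poisson kernel.\<close>

lemma Poisson_formula:
  assumes hol: "G holomorphic_on ball 0 R" and R: "R > 1" and a: "cmod a < 1"
  shows "((\<lambda>t. G (circ t) * of_real (poisson a (circ t))) has_integral G a) {0..1}"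
proof -
  define F where "F z = G z * of_real (1 - (cmod a)\<^sup>2) / (1 - cnj a * z)" for z
  have "G holomorphic_on cball 0 1"
    using hol R by (auto intro: holomorphic_on_subset)
  moreover have "1 - cnj a * z \<noteq> 0" if "z \<in> cball 0 1" for z
    using that a mult_left_mono[of "cmod z" 1 "cmod a"] by (intro one_minus_cnj_mult_neq_0) auto
  ultimately have "F holomorphic_on cball 0 1"
    unfolding F_def by (intro holomorphic_intros) auto
  from Cauchy_integral_circlepath_simple[OF this, of a] a
  have "((\<lambda>u. F u / (u - a)) has_contour_integral (2 * of_real pi * \<i> * F a)) (circlepath 0 1)"
    by simp
  from has_integral_mult_right[OF has_integral_circlepath[OF this], of "1 / (2 * of_real pi * \<i>)"]
  have *: "((\<lambda>t. F (circ t) / (circ t - a) * circ t) has_integral F a) {0..1}"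
    by (simp add: mult_ac)
  have "F a = G a"
  proof -
    have "of_real (1 - (cmod a)\<^sup>2) = 1 - cnj a * a"
      by (simp only: complex_norm_square of_real_diff of_real_1 mult.commute)
    moreover have "1 - cnj a * a \<noteq> 0"
      using a mult_strict_mono[of "cmod a" 1 "cmod a" 1] by (intro one_minus_cnj_mult_neq_0) auto
    ultimately show ?thesis by (simp add: F_def)
  qed
  moreover have "F u / (u - a) * u = G u * of_real (poisson a u)" if u: "cmod u = 1" for u
  proof -
    have nz: "1 - cnj a * u \<noteq> 0" "u \<noteq> a" "u \<noteq> 0"
      using one_minus_cnj_mult_neq_0[of a u] a u by auto
    have "u * cnj u = 1" using u by (simp add: complex_norm_square[symmetric])
    hence "u * (a * cnj u) = a" by (simp add: mult.left_commute)
    hence ua: "u - a = u * cnj (1 - cnj a * u)"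
      by (simp add: right_diff_distrib)
    have "F u / (u - a) * u = F u / cnj (1 - cnj a * u)"
      unfolding ua using nz(3) by simp
    also have "\<dots> = G u * of_real (1 - (cmod a)\<^sup>2) / ((1 - cnj a * u) * cnj (1 - cnj a * u))"
      unfolding F_def by (rule divide_divide_eq_left)
    also have "\<dots> = G u * of_real (poisson a u)"
      by (simp only: complex_norm_square[symmetric] poisson_def of_real_divide times_divide_eq_right)
    finally show ?thesis .
  qed
  ultimately show ?thesis using * by simp
qed

text \<open>Without zeros f has a holomorphic logarithm, so |f|^s is the modulus of a holomorphic
  function for every real s, and the Poisson formula with the triangle inequality suffices.\<close>

lemma Poisson_ineq_zero_free:
  assumes hol: "f holomorphic_on ball 0 R" and R: "R > 1" and a: "cmod a < 1"
    and nz: "\<And>z. z \<in> ball 0 R \<Longrightarrow> f z \<noteq> 0"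
  shows "cmod (f a) powr s \<le> integral {0..1} (\<lambda>t. cmod (f (circ t)) powr s * poisson a (circ t))"
proof -
  have "contractible (ball (0::complex) R)"
    by (simp add: convex_imp_contractible)
  then obtain g where g: "g holomorphic_on ball 0 R" "\<And>z. z \<in> ball 0 R \<Longrightarrow> f z = exp (g z)"
    using contractible_imp_holomorphic_log[OF hol _ nz] by blast
  define F where "F z = exp (of_real s * g z)" for z
  have F: "F holomorphic_on ball 0 R"
    unfolding F_def by (intro holomorphic_intros g)
  have nF: "cmod (F z) = cmod (f z) powr s" if "z \<in> ball 0 R" for z
    using that by (simp add: F_def g norm_exp_eq_Re powr_def)
  have I: "((\<lambda>t. F (circ t) * of_real (poisson a (circ t))) has_integral F a) {0..1}"
    by (rule Poisson_formula[OF F R a])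
  have "continuous_on {0..1} (\<lambda>t. F (circ t))"
    using R by (intro continuous_on_compose2[OF holomorphic_on_imp_continuous_on[OF F]] continuous_intros) auto
  hence "continuous_on {0..1} (\<lambda>t. cmod (F (circ t)) * poisson a (circ t))"
    by (intro continuous_intros continuous_on_poisson_circ a)
  hence "norm (integral {0..1} (\<lambda>t. F (circ t) * of_real (poisson a (circ t)))) \<le>
      integral {0..1} (\<lambda>t. cmod (F (circ t)) * poisson a (circ t))"
    using I poisson_nonneg[OF a]
    by (intro integral_norm_bound_integral) (auto simp: norm_mult intro: integrable_continuous_interval)
  also have "\<dots> = integral {0..1} (\<lambda>t. cmod (f (circ t)) powr s * poisson a (circ t))"
    using R by (intro integral_cong) (simp add: nF)
  finally show ?thesis
    using a R by (simp add: integral_unique[OF I] nF)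
qed

text \<open>Compares the two factors exchanged when a zero is removed: the right-hand side shows
  both the equality of moduli on the circle and the sign of the difference inside the disc.\<close>

lemma Blaschke_identity:
  "(cmod (1 - cnj b * a))\<^sup>2 - (cmod (a - b))\<^sup>2 = (1 - (cmod a)\<^sup>2) * (1 - (cmod b)\<^sup>2)"
  unfolding cmod_power2 by (simp add: power2_eq_square algebra_simps)

text \<open>Induction on the number of zeros: the factor \<open>(z - \<xi>)^m\<close> is replaced by
  \<open>(1 - cnj \<xi> * z)^m\<close>, which has the same modulus on the circle and a larger one inside.\<close>

lemma Poisson_ineq_finite_zeros:
  assumes hol: "f holomorphic_on ball 0 R" and R: "R > 1" and a: "cmod a < 1" and s: "s > 0"
    and fin: "finite {z \<in> ball 0 R. f z = 0}"
    and nz: "\<And>z. z \<in> ball 0 R \<Longrightarrow> f z = 0 \<Longrightarrow> cmod z * R \<le> 1"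
  shows "cmod (f a) powr s \<le> integral {0..1} (\<lambda>t. cmod (f (circ t)) powr s * poisson a (circ t))"
  using hol fin nz
proof (induction "card {z \<in> ball 0 R. f z = 0}" arbitrary: f rule: less_induct)
  case less
  show ?case
  proof (cases "\<exists>\<xi>\<in>ball 0 R. f \<xi> = 0")
    case False
    thus ?thesis using Poisson_ineq_zero_free[OF less.prems(1) R a] by blast
  next
    case True
    then obtain \<xi> where \<xi>: "\<xi> \<in> ball 0 R" "f \<xi> = 0" by blast
    have \<xi>R: "cmod \<xi> * R \<le> 1" using less.prems(3) \<xi> by blast
    hence \<xi>1: "cmod \<xi> < 1"
      using R mult_right_mono[of 1 "cmod \<xi>" R] by linarith
    \<comment> \<open>The zero set is assumed finite, so f does not vanish identically and \<xi> is
      a zero of finite order.\<close>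
    have nconst: "\<not> f constant_on ball 0 R"
    proof
      assume "f constant_on ball 0 R"
      hence "{z \<in> ball 0 R. f z = 0} = ball 0 R"
        using \<xi> by (auto simp: constant_on_def)
      thus False using less.prems(2) R finite_imp_not_open[of "ball (0::complex) R"] by auto
    qed
    obtain g r n where g: "0 < n" "0 < r" "ball \<xi> r \<subseteq> ball 0 R" "g holomorphic_on ball \<xi> r"
        "\<And>w. w \<in> ball \<xi> r \<Longrightarrow> f w = (w - \<xi>) ^ n * g w" "\<And>w. w \<in> ball \<xi> r \<Longrightarrow> g w \<noteq> 0"
      using holomorphic_factor_zero_nonconstant[OF less.prems(1) open_ball connected_ball \<xi> nconst] by metis
    define h where "h w = (if w = \<xi> then g \<xi> else f w / (w - \<xi>) ^ n)" for w
    have f_eq: "f w = (w - \<xi>) ^ n * h w" for w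
      using g(1) \<xi> by (simp add: h_def)
    have "h holomorphic_on ball \<xi> r"
      using g(4) by (rule holomorphic_transform) (use g in \<open>auto simp: h_def\<close>)
    moreover have "h holomorphic_on ball 0 R - {\<xi>}"
    proof (rule holomorphic_transform)
      show "(\<lambda>w. f w / (w - \<xi>) ^ n) holomorphic_on ball 0 R - {\<xi>}"
        by (intro holomorphic_intros holomorphic_on_subset[OF less.prems(1)]) auto
    qed (auto simp: h_def)
    ultimately have "h holomorphic_on (ball \<xi> r \<union> (ball 0 R - {\<xi>}))"
      by (intro holomorphic_on_Un) auto
    also have "ball \<xi> r \<union> (ball 0 R - {\<xi>}) = ball 0 R"
      using g \<xi> by auto
    finally have h: "h holomorphic_on ball 0 R" .
    define k where "k w = h w * (1 - cnj \<xi> * w) ^ n" for w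
    have k: "k holomorphic_on ball 0 R"
      unfolding k_def by (intro holomorphic_intros h)
    have k0: "k w = 0 \<longleftrightarrow> f w = 0 \<and> w \<noteq> \<xi>" if w: "w \<in> ball 0 R" for w
    proof -
      \<comment> \<open>The assumption \<open>cmod z * R \<le> 1\<close> at zeros keeps the zero of
        the new factor outside the open disc of radius R, so that k loses the zero \<xi> and gains
        none.\<close>
      have "cmod \<xi> * cmod w < 1"
      proof (cases "\<xi> = 0")
        case False
        hence "cmod \<xi> * cmod w < cmod \<xi> * R" using w by simp
        thus ?thesis using \<xi>R by simp
      qed simp
      hence "1 - cnj \<xi> * w \<noteq> 0" by (rule one_minus_cnj_mult_neq_0)
      moreover have "h \<xi> \<noteq> 0" using g by (simp add: h_def)
      ultimately show ?thesis by (auto simp: k_def f_eq)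
    qed
    have Z: "{z \<in> ball 0 R. k z = 0} = {z \<in> ball 0 R. f z = 0} - {\<xi>}"
      using k0 by auto
    have "card {z \<in> ball 0 R. k z = 0} < card {z \<in> ball 0 R. f z = 0}"
      unfolding Z using less.prems(2) \<xi> by (intro card_Diff1_less) auto
    hence "cmod (k a) powr s \<le> integral {0..1} (\<lambda>t. cmod (k (circ t)) powr s * poisson a (circ t))"
    proof (rule less.hyps[OF _ k])
      show "finite {z \<in> ball 0 R. k z = 0}" unfolding Z using less.prems(2) by auto
      show "cmod z * R \<le> 1" if "z \<in> ball 0 R" "k z = 0" for z
        using that k0 less.prems(3) by blast
    qed
    also have "\<dots> = integral {0..1} (\<lambda>t. cmod (f (circ t)) powr s * poisson a (circ t))"
    proof (rule integral_cong)
      fix t :: real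
      have "(cmod (1 - cnj \<xi> * circ t))\<^sup>2 = (cmod (circ t - \<xi>))\<^sup>2"
        using Blaschke_identity[of \<xi> "circ t"] by simp
      hence "cmod (1 - cnj \<xi> * circ t) = cmod (circ t - \<xi>)"
        by (simp add: power2_eq_iff_nonneg)
      thus "cmod (k (circ t)) powr s * poisson a (circ t) = cmod (f (circ t)) powr s * poisson a (circ t)"
        by (simp add: k_def f_eq norm_mult norm_power mult.commute)
    qed
    finally have "cmod (k a) powr s \<le> \<dots>" .
    moreover have "cmod (f a) \<le> cmod (k a)"
    proof -
      have "(cmod (a - \<xi>))\<^sup>2 \<le> (cmod (1 - cnj \<xi> * a))\<^sup>2"
      proof -
        have "0 \<le> (1 - (cmod a)\<^sup>2) * (1 - (cmod \<xi>)\<^sup>2)"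
          using a \<xi>1 by (intro mult_nonneg_nonneg) (simp_all add: power_le_one)
        thus ?thesis using Blaschke_identity[of \<xi> a] by linarith
      qed
      hence "cmod (a - \<xi>) \<le> cmod (1 - cnj \<xi> * a)"
        by (simp add: power2_le_iff_abs_le)
      thus ?thesis
        by (simp add: k_def f_eq norm_mult norm_power mult.commute[of "cmod (h a)"] mult_right_mono power_mono)
    qed
    ultimately show ?thesis
      using s powr_mono2[of s "cmod (f a)" "cmod (k a)"] by simp
  qed
qed

text \<open>Zeros on the circle, or too close to it relative to R, are not covered by the previous
  lemma. Dilating to f(r z) with r just below 1 cures both, and continuity permits the limit r to
  1.\<close>

lemma Poisson_ineq:
  assumes hol: "f holomorphic_on ball 0 R" and R: "R > 1" and a: "cmod a < 1" and s: "s > 0"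
  shows "cmod (f a) powr s \<le> integral {0..1} (\<lambda>t. cmod (f (circ t)) powr s * poisson a (circ t))"
proof (cases "f constant_on ball 0 R")
  case True
  then obtain c where c: "\<And>z. z \<in> ball 0 R \<Longrightarrow> f z = c" by (auto simp: constant_on_def)
  show ?thesis
  proof (cases "c = 0")
    case True
    thus ?thesis using c a R s by simp
  next
    case False
    thus ?thesis using Poisson_ineq_zero_free[OF hol R a] c by auto
  qed
next
  case False
  define Z where "Z = {z \<in> cball 0 1. f z = 0}"
  have fin: "finite Z"
    unfolding Z_def using R
    by (intro holomorphic_compact_finite_zeros[OF hol _ _ _ _ False]) auto
  have contf: "continuous_on (ball 0 R) f"
    by (rule holomorphic_on_imp_continuous_on[OF hol])
  have rz: "complex_of_real r * z \<in> ball 0 R" if "r \<in> {0..1}" "cmod z \<le> 1" for r z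
    using that R mult_mono[of r 1 "cmod z" 1] by (auto simp: norm_mult)
  have "((\<lambda>r. cmod (f (of_real r * a)) powr s) \<longlongrightarrow> cmod (f (of_real 1 * a)) powr s) (at_left 1)"
    using a rz[of _ a] s
    by (intro continuous_on_Icc_at_leftD[of 0] continuous_on_powr' continuous_on_norm
         continuous_on_compose2[OF contf] continuous_intros) auto
  moreover have "((\<lambda>r. integral (cbox 0 1) (\<lambda>t. cmod (f (of_real r * circ t)) powr s * poisson a (circ t)))
      \<longlongrightarrow> integral (cbox 0 1) (\<lambda>t. cmod (f (of_real 1 * circ t)) powr s * poisson a (circ t))) (at_left 1)"
  proof (rule continuous_on_Icc_at_leftD[of 0], rule integral_continuous_on_param)
    have "continuous_on ({0..1} \<times> cbox 0 1) (\<lambda>p. poisson a (circ (snd p)))"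
      by (rule continuous_on_compose2[OF continuous_on_poisson_circ[OF a, of UNIV]]) (auto intro!: continuous_intros)
    moreover have "continuous_on ({0..1} \<times> cbox 0 1) (\<lambda>p. cmod (f (of_real (fst p) * circ (snd p))) powr s)"
      using rz s
      by (intro continuous_on_powr' continuous_on_norm continuous_on_compose2[OF contf] continuous_intros) auto
    ultimately show "continuous_on ({0..1} \<times> cbox 0 1)
        (\<lambda>(r, t). cmod (f (of_real r * circ t)) powr s * poisson a (circ t))"
      unfolding split_beta by (intro continuous_on_mult)
  qed auto
  moreover have "eventually (\<lambda>r. cmod (f (of_real r * a)) powr s \<le>
      integral (cbox 0 1) (\<lambda>t. cmod (f (of_real r * circ t)) powr s * poisson a (circ t))) (at_left 1)"
  proof -
    \<comment> \<open>The closed unit disc contains finitely many zeros, so \<open>r\<^sup>2\<close>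
      eventually exceeds the modulus of every interior one; this is the condition |z| / r \<le> 1
      for a zero z of the dilate. Zeros of f on the circle are moved out of the open disc of radius
      1 / r.\<close>
    have "eventually (\<lambda>r. cmod z < 1 \<longrightarrow> cmod z < r\<^sup>2) (at_left (1::real))" for z
    proof (cases "cmod z < 1")
      case True
      have "((\<lambda>r::real. r\<^sup>2) \<longlongrightarrow> 1\<^sup>2) (at_left 1)" by (intro tendsto_intros)
      thus ?thesis using True order_tendstoD(1)[of "\<lambda>r::real. r\<^sup>2" "1\<^sup>2" _ "cmod z"]
        by (auto elim: eventually_mono)
    qed simp
    hence "eventually (\<lambda>r. \<forall>z\<in>Z. cmod z < 1 \<longrightarrow> cmod z < r\<^sup>2) (at_left (1::real))"
      by (intro eventually_ball_finite fin) auto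
    moreover have "eventually (\<lambda>r. r \<in> {0<..<1}) (at_left (1::real))"
      by (rule eventually_at_leftI[of 0]) auto
    ultimately show ?thesis
    proof eventually_elim
      case (elim r)
      define g where "g z = f (of_real r * z)" for z
      have r: "0 < r" "r < 1" using elim by auto
      have sm: "cmod (of_real r * z) < 1" if "cmod z < 1 / r" for z
        using that r by (simp add: norm_mult field_simps)
      have "g holomorphic_on ball 0 (1 / r)"
        unfolding g_def using sm R
        by (intro holomorphic_on_compose[OF _ holomorphic_on_subset[OF hol], unfolded o_def] holomorphic_intros)
           (auto, force)
      moreover have zeros: "of_real r * z \<in> Z \<and> cmod z * (1 / r) \<le> 1" if "z \<in> ball 0 (1 / r)" "g z = 0" for z
      proof -
        have Z: "of_real r * z \<in> Z" "cmod (of_real r * z) < 1"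
          using that sm[of z] by (auto simp: Z_def g_def)
        hence "cmod (of_real r * z) < r\<^sup>2" using elim by blast
        thus ?thesis using Z r by (simp add: norm_mult power2_eq_square)
      qed
      moreover have "finite {z \<in> ball 0 (1 / r). g z = 0}"
      proof (rule finite_subset)
        show "finite ((\<lambda>z. z / of_real r) ` Z)" using fin by simp
        show "{z \<in> ball 0 (1 / r). g z = 0} \<subseteq> (\<lambda>z. z / of_real r) ` Z"
        proof
          fix z assume "z \<in> {z \<in> ball 0 (1 / r). g z = 0}"
          hence "of_real r * z \<in> Z" using zeros by blast
          moreover have "z = of_real r * z / of_real r" using r by simp
          ultimately show "z \<in> (\<lambda>z. z / of_real r) ` Z" by blast
        qed
      qed
      ultimately have "cmod (g a) powr s \<le> integral {0..1} (\<lambda>t. cmod (g (circ t)) powr s * poisson a (circ t))"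
        using r by (intro Poisson_ineq_finite_zeros[of g "1 / r"] a s) auto
      thus ?case by (simp add: g_def)
    qed
  qed
  ultimately show ?thesis
    by (intro tendsto_le[of "at_left 1"]) (auto)
qed

lemma nn_integral_Poisson_ineq:
  assumes hol: "f holomorphic_on ball 0 R" and R: "R > 1" and a: "cmod a < 1" and s: "s > 0"
  shows "ennreal (cmod (f a) powr s) \<le>
    (\<integral>\<^sup>+t. ennreal (cmod (f (circ t)) powr s) * ennreal (poisson a (circ t)) * indicator {0..1} t \<partial>lborel)"
proof -
  let ?h = "\<lambda>t. cmod (f (circ t)) powr s * poisson a (circ t)"
  have "continuous_on {0..1} ?h"
    using R s
    by (intro continuous_on_mult continuous_on_poisson_circ a continuous_on_powr' continuous_on_norm
         continuous_on_compose2[OF holomorphic_on_imp_continuous_on[OF hol]] continuous_intros) auto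
  hence "(?h has_integral integral {0..1} ?h) {0..1}"
    by (intro integrable_integral integrable_continuous_interval)
  hence "(\<integral>\<^sup>+t. ennreal (?h t) * indicator {0..1} t \<partial>lborel) = ennreal (integral {0..1} ?h)"
    by (intro nn_integral_has_integral_lebesgue') (auto simp: poisson_nonneg a)
  thus ?thesis
    using Poisson_ineq[OF assms] by (simp add: ennreal_mult' ennreal_leI)
qed

lemma nn_integral_poisson_circ:
  assumes a: "cmod a < 1"
  shows "(\<integral>\<^sup>+t. ennreal (poisson a (circ t)) * indicator {0..1} t \<partial>lborel) = 1"
proof -
  have "((\<lambda>t. (1::complex) * of_real (poisson a (circ t))) has_integral 1) {0..1}"
    by (rule Poisson_formula[OF _ _ a, where R=2]) auto
  from has_integral_Re[OF this]
  have "((\<lambda>t. poisson a (circ t)) has_integral 1) {0..1}" by simp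
  hence "(\<integral>\<^sup>+t. ennreal (poisson a (circ t)) * indicator {0..1} t \<partial>lborel) = ennreal 1"
    by (intro nn_integral_has_integral_lebesgue') (auto simp: poisson_nonneg a)
  thus ?thesis by simp
qed

section \<open>Circle averages with respect to \<open>sph\<close>\<close>

lemma orthogonal_transformation_unit_mult:
  "cmod c = 1 \<Longrightarrow> orthogonal_transformation (\<lambda>z::complex. c * z)"
  by (auto simp: orthogonal_transformation norm_mult linear_iff algebra_simps)

lemma poisson_measurable [measurable]:
  "(\<lambda>p. poisson (fst p) (snd p)) \<in> borel_measurable (borel \<Otimes>\<^sub>M borel)"
  unfolding poisson_def borel_prod
  by (intro borel_measurable_divide borel_measurable_power borel_measurable_continuous_onI continuous_intros)

lemma poisson_measurable2 [measurable (raw)]: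
  assumes [measurable]: "f \<in> borel_measurable M" "g \<in> borel_measurable M"
  shows "(\<lambda>x. poisson (f x) (g x)) \<in> borel_measurable M"
  using measurable_compose[OF measurable_Pair[OF assms] poisson_measurable] by simp

text \<open>Rotation invariance inserts an average over \<open>circ t\<close>, which relates
  \<open>sph\<close> on the plane to parametrized circle integrals without identifying it with arc
  length.\<close>

lemma nn_integral_sph_rotate:
  fixes F :: "complex \<Rightarrow> ennreal"
  assumes [measurable]: "F \<in> borel_measurable borel"
  shows "(\<integral>\<^sup>+u. F u \<partial>sph) = (\<integral>\<^sup>+u. \<integral>\<^sup>+t. F (u * circ t) * indicator {0..1} t \<partial>lborel \<partial>sph)"
proof -
  have [measurable]: "circ \<in> borel_measurable borel"
    by (intro borel_measurable_continuous_onI continuous_intros)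
  have "(\<integral>\<^sup>+u. F u \<partial>sph) = (\<integral>\<^sup>+t. (\<integral>\<^sup>+u. F u \<partial>sph) * indicator {0..1::real} t \<partial>lborel)"
    by (subst nn_integral_cmult) auto
  also have "\<dots> = (\<integral>\<^sup>+t. (\<integral>\<^sup>+u. F (circ t * u) \<partial>sph) * indicator {0..1} t \<partial>lborel)"
    using nn_integral_sph_orthogonal[OF orthogonal_transformation_unit_mult[OF norm_circ] assms] by simp
  also have "\<dots> = (\<integral>\<^sup>+t. \<integral>\<^sup>+u. F (u * circ t) * indicator {0..1} t \<partial>sph \<partial>lborel)"
    by (subst nn_integral_multc) (auto simp: mult.commute)
  also have "\<dots> = (\<integral>\<^sup>+u. \<integral>\<^sup>+t. F (u * circ t) * indicator {0..1} t \<partial>lborel \<partial>sph)"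
    by (rule sph_lborel.Fubini') measurable
  finally show ?thesis .
qed

lemma poisson_rotate:
  assumes "cmod u = 1"
  shows "poisson a (u * v) = poisson (a * cnj u) v"
  using assms by (simp add: poisson_def norm_mult mult.assoc)

lemma nn_integral_sph_poisson:
  assumes "cmod a < 1"
  shows "(\<integral>\<^sup>+u. ennreal (poisson a u) \<partial>sph) = 1"
proof -
  have "(\<integral>\<^sup>+u. ennreal (poisson a u) \<partial>sph) =
      (\<integral>\<^sup>+u. \<integral>\<^sup>+t. ennreal (poisson a (u * circ t)) * indicator {0..1} t \<partial>lborel \<partial>sph)"
    by (rule nn_integral_sph_rotate) measurable
  also have "\<dots> = (\<integral>\<^sup>+u. 1 \<partial>(sph :: complex measure))"
  proof (rule nn_integral_sph_cong)
    fix u :: complex assume elim: "norm u = 1"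
    have "cmod (a * cnj u) < 1" using elim assms by (simp add: norm_mult)
    from nn_integral_poisson_circ[OF this] show "(\<integral>\<^sup>+t. ennreal (poisson a (u * circ t)) * indicator {0..1} t \<partial>lborel) = 1"
      by (simp only: poisson_rotate[OF elim])
  qed
  finally show ?thesis by simp
qed

text \<open>The parametrized inequality is applied to f(u z) at the point a cnj u and averaged over
  u. The separate \<open>F\<close> is a Borel function that agrees with the power of |f| on the
  circle, since \<open>f\<close> is controlled only in the disc.\<close>

lemma sph_Poisson_ineq:
  assumes hol: "f holomorphic_on ball 0 R" and R: "R > 1" and a: "cmod a < 1" and s: "s > 0"
    and F[measurable]: "F \<in> borel_measurable borel"
    and F_eq: "\<And>u. cmod u = 1 \<Longrightarrow> F u = ennreal (cmod (f u) powr s)"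
  shows "ennreal (cmod (f a) powr s) \<le> (\<integral>\<^sup>+u. F u * ennreal (poisson a u) \<partial>sph)"
proof -
  have "ennreal (cmod (f a) powr s) = (\<integral>\<^sup>+u. ennreal (cmod (f a) powr s) \<partial>(sph :: complex measure))"
    by simp
  also have "\<dots> \<le> (\<integral>\<^sup>+u. \<integral>\<^sup>+t. F (u * circ t) * ennreal (poisson a (u * circ t)) * indicator {0..1} t \<partial>lborel \<partial>sph)"
  proof (rule nn_integral_sph_mono)
    fix u :: complex assume elim: "norm u = 1"
    have uu: "u * cnj u = 1" using elim by (simp add: complex_norm_square[symmetric])
    have a': "cmod (a * cnj u) < 1" using elim a by (simp add: norm_mult)
    have "(\<lambda>z. f (u * z)) holomorphic_on ball 0 R"
      using elim
      by (intro holomorphic_on_compose[OF _ holomorphic_on_subset[OF hol], unfolded o_def] holomorphic_intros)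
         (auto simp: norm_mult)
    from nn_integral_Poisson_ineq[OF this R a' s]
    have "ennreal (cmod (f (u * (a * cnj u))) powr s) \<le>
      (\<integral>\<^sup>+t. F (u * circ t) * ennreal (poisson a (u * circ t)) * indicator {0..1} t \<partial>lborel)"
      using elim by (simp add: F_eq norm_mult poisson_rotate)
    moreover have "u * (a * cnj u) = a" using uu by (metis mult.left_commute mult.right_neutral)
    ultimately show "ennreal (cmod (f a) powr s) \<le> (\<integral>\<^sup>+t. F (u * circ t) * ennreal (poisson a (u * circ t)) * indicator {0..1} t \<partial>lborel)" by simp
  qed
  also have "\<dots> = (\<integral>\<^sup>+u. F u * ennreal (poisson a u) \<partial>sph)"
    by (rule nn_integral_sph_rotate[symmetric]) measurable
  finally show ?thesis .
qed

section \<open>A maximal inequality\<close>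

lemma poisson_of_real:
  "poisson (of_real r) u = (1 - r\<^sup>2) / (cmod (1 - of_real r * u))\<^sup>2"
  by (simp add: poisson_def)

lemma one_minus_le_cmod:
  assumes "0 \<le> r" "cmod u = 1"
  shows "1 - r \<le> cmod (1 - of_real r * u)"
  using norm_triangle_ineq2[of 1 "of_real r * u"] assms by (simp add: norm_mult)

text \<open>Both kernels have the same r, so the denominators decide: |1 - r v| \<le> (1 - r) + 2 |1
  - u| and |1 - u| \<le> |1 - r u| + (1 - r). With 1 - r \<le> |1 - r u| the ratio is at most 2 + 3
  = 5, and its square is 25.\<close>

lemma poisson_le_of_dist:
  assumes r: "0 \<le> r" "r < 1" and u: "cmod u = 1" and v: "cmod v = 1" and d: "cmod (1 - v) \<le> 2 * cmod (1 - u)"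
  shows "poisson (of_real r) u \<le> 25 * poisson (of_real r) v"
proof -
  let ?u = "cmod (1 - of_real r * u)" and ?v = "cmod (1 - of_real r * v)"
  have pos: "0 < ?u" "0 < ?v" "1 - r \<le> ?u"
    using one_minus_le_cmod[OF r(1) u] one_minus_le_cmod[OF r(1) v] r by auto
  have "1 - of_real r * v = of_real (1 - r) + of_real r * (1 - v)"
    by (simp add: algebra_simps)
  hence "?v \<le> cmod (of_real (1 - r)) + cmod (of_real r * (1 - v))"
    by (metis norm_triangle_ineq)
  hence "?v \<le> (1 - r) + r * cmod (1 - v)"
    using r by (simp add: norm_mult del: of_real_diff)
  moreover have "r * cmod (1 - v) \<le> cmod (1 - v)"
    using r mult_right_mono[of r 1 "cmod (1 - v)"] by simp
  moreover have "cmod (1 - u) \<le> ?u + (1 - r)"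
  proof -
    have "1 - u = (1 - of_real r * u) - of_real (1 - r) * u"
      by (simp add: algebra_simps)
    hence "cmod (1 - u) \<le> ?u + cmod (of_real (1 - r) * u)"
      by (metis norm_triangle_ineq4)
    thus ?thesis using r u by (simp add: norm_mult del: of_real_diff)
  qed
  ultimately have "?v \<le> 5 * ?u" using d pos by linarith
  hence "?v\<^sup>2 \<le> (5 * ?u)\<^sup>2"
    using pos by (intro power_mono) auto
  hence "1 / ?u\<^sup>2 \<le> 25 * (1 / ?v\<^sup>2)"
    using pos by (simp add: field_simps power_mult_distrib)
  moreover have "0 \<le> 1 - r\<^sup>2" using r by (simp add: power_le_one)
  ultimately have "(1 - r\<^sup>2) * (1 / ?u\<^sup>2) \<le> (1 - r\<^sup>2) * (25 * (1 / ?v\<^sup>2))"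
    by (rule mult_left_mono)
  thus ?thesis by (simp add: poisson_of_real mult_ac)
qed

text \<open>By the triangle inequality |1 - v| \<le> |1 - u| + |1 - u v|, so one of the two is at
  least half of |1 - v|. The kernel with that argument may be replaced by its value at v, at the
  cost of the factor 25.\<close>

lemma poisson_mult_le:
  assumes r: "0 \<le> r" "r < 1" and s: "0 \<le> s" "s < 1" and u: "cmod u = 1" and v: "cmod v = 1"
  shows "poisson (of_real r) u * poisson (of_real s) (u * v) \<le>
     25 * (poisson (of_real r) v * poisson (of_real s) (u * v) + poisson (of_real r) u * poisson (of_real s) v)"
proof -
  have nn: "0 \<le> poisson (of_real r) w" "0 \<le> poisson (of_real s) w" for w
    using r s by (auto intro!: poisson_nonneg)
  have "1 - v = (1 - u * v) + v * (u - 1)" by (simp add: algebra_simps)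
  hence "cmod (1 - v) \<le> cmod (1 - u * v) + cmod (v * (u - 1))"
    by (metis norm_triangle_ineq)
  hence "cmod (1 - v) \<le> cmod (1 - u * v) + cmod (1 - u)"
    using v by (simp add: norm_mult norm_minus_commute)
  then consider "cmod (1 - v) \<le> 2 * cmod (1 - u)" | "cmod (1 - v) \<le> 2 * cmod (1 - u * v)"
    by linarith
  thus ?thesis
  proof cases
    case 1
    from mult_right_mono[OF poisson_le_of_dist[OF r u v 1] nn(2), of "u * v"]
    show ?thesis using mult_nonneg_nonneg[OF nn(1)[of u] nn(2)[of v]] by simp
  next
    case 2
    have "cmod (u * v) = 1" using u v by (simp add: norm_mult)
    from mult_left_mono[OF poisson_le_of_dist[OF s this v 2] nn(1), of u]
    show ?thesis using mult_nonneg_nonneg[OF nn(1)[of v] nn(2)[of "u * v"]] by (simp add: mult.left_commute)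
  qed
qed

lemma poisson_cnj: "poisson (of_real r) (cnj u) = poisson (of_real r) u"
  using complex_mod_cnj[of "1 - of_real r * u"] by (simp add: poisson_of_real)

lemma poisson_bound:
  assumes "0 \<le> r" "r \<le> \<rho>" "\<rho> < 1" "cmod u = 1"
  shows "poisson (of_real r) u \<le> 1 / (1 - \<rho>)\<^sup>2"
  unfolding poisson_of_real
proof (rule frac_le)
  have "1 - \<rho> \<le> cmod (1 - of_real r * u)"
    using one_minus_le_cmod[of r u] assms by simp
  thus "(1 - \<rho>)\<^sup>2 \<le> (cmod (1 - of_real r * u))\<^sup>2"
    using assms by (intro power_mono) auto
qed (use assms in auto)

lemma borel_measurable_vector_scalar_mult [measurable (raw)]:
  fixes f :: "'a \<Rightarrow> complex" and g :: "'a \<Rightarrow> complex^'n"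
  assumes "f \<in> borel_measurable M" "g \<in> borel_measurable M"
  shows "(\<lambda>x. f x *s g x) \<in> borel_measurable M"
  by (rule borel_measurable_continuous_Pair[OF assms]) (intro continuous_intros)

lemma orthogonal_transformation_unit_scalar:
  "cmod c = 1 \<Longrightarrow> orthogonal_transformation (\<lambda>z::complex^'n. c *s z)"
  by (simp add: orthogonal_transformation norm_vector_scalar_mult linear_vector_scalar_mult_right)

lemma orthogonal_transformation_cnj: "orthogonal_transformation cnj"
  by (simp add: orthogonal_transformation linear_iff scaleR_conv_of_real)

lemma cnj_mult_unit: "cmod c = 1 \<Longrightarrow> c * cnj c = 1" "cmod c = 1 \<Longrightarrow> cnj c * c = 1"
  by (simp_all add: complex_norm_square[symmetric] mult.commute)

text \<open>Linearization of the maximal function: with \<open>rad z\<close> a maximizing radius at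
  z, the supremum is bounded by a single Poisson integral. The final constant must therefore be
  independent of \<open>rad\<close>.\<close>

locale radius_function =
  fixes rad :: "complex^'n \<Rightarrow> real"
  assumes rad_measurable [measurable]: "rad \<in> borel_measurable borel"
    and rad: "\<And>z. 0 \<le> rad z" "\<And>z. rad z < 1"
begin

definition ker :: "complex^'n \<Rightarrow> complex \<Rightarrow> ennreal" where
  "ker z u = ennreal (poisson (of_real (rad z)) u)"

lemma ker_measurable [measurable (raw)]:
  assumes [measurable]: "f \<in> borel_measurable M" "g \<in> borel_measurable M"
  shows "(\<lambda>x. ker (f x) (g x)) \<in> borel_measurable M"
  unfolding ker_def by measurable

text \<open>The L^2 adjoint of the operator T that takes f to its Poisson integral over the circle
  through z, evaluated at radius \<open>rad z\<close>. In the adjoint the radius belongs to the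
  rotated point \<open>u *s z\<close>.\<close>

definition T_adj :: "(complex^'n \<Rightarrow> ennreal) \<Rightarrow> complex^'n \<Rightarrow> ennreal" where
  "T_adj w z = (\<integral>\<^sup>+u. ker (u *s z) u * w (u *s z) \<partial>sph)"

lemma T_adj_measurable [measurable]:
  assumes [measurable]: "w \<in> borel_measurable borel"
  shows "T_adj w \<in> borel_measurable borel"
  unfolding T_adj_def by measurable

lemma ker_le: "cmod u = 1 \<Longrightarrow> cmod v = 1 \<Longrightarrow>
  ker z u * ker y (u * v) \<le> 25 * (ker z v * ker y (u * v) + ker z u * ker y v)"
proof -
  assume uv: "cmod u = 1" "cmod v = 1"
  have nn: "0 \<le> poisson (of_real (rad z)) w" for z w
    using rad[of z] by (intro poisson_nonneg) simp
  from poisson_mult_le[OF rad[of z] rad[of y] uv]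
  have "ennreal (poisson (of_real (rad z)) u * poisson (of_real (rad y)) (u * v)) \<le>
      ennreal (25 * (poisson (of_real (rad z)) v * poisson (of_real (rad y)) (u * v)
        + poisson (of_real (rad z)) u * poisson (of_real (rad y)) v))"
    by (rule ennreal_leI)
  thus ?thesis
    unfolding ker_def by (simp add: ennreal_mult nn)
qed

lemma nn_integral_ker: "(\<integral>\<^sup>+u. ker z u \<partial>sph) = 1"
  unfolding ker_def using rad[of z] by (intro nn_integral_sph_poisson) simp

lemma nn_integral_ker_rotate:
  assumes "cmod v = 1"
  shows "(\<integral>\<^sup>+u. ker z (u * v) \<partial>sph) = 1"
  using nn_integral_sph_orthogonal[OF orthogonal_transformation_unit_mult[OF assms], of "ker z"] nn_integral_ker[of z]
  by (simp add: mult.commute)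

text \<open>For fixed u the rotation by \<open>cnj u\<close> moves the circle action from f onto w
  and the kernel. Then u is replaced by its conjugate, which leaves the kernel unchanged because the
  radius is real.\<close>

lemma T_adjoint:
  assumes [measurable]: "f \<in> borel_measurable borel" "w \<in> borel_measurable borel"
  shows "(\<integral>\<^sup>+z. \<integral>\<^sup>+u. w z * ker z u * f (u *s z) \<partial>sph \<partial>sph) = (\<integral>\<^sup>+z. f z * T_adj w z \<partial>sph)"
proof -
  have "(\<integral>\<^sup>+z. \<integral>\<^sup>+u. w z * ker z u * f (u *s z) \<partial>sph \<partial>sph) =
      (\<integral>\<^sup>+u. \<integral>\<^sup>+z. w z * ker z u * f (u *s z) \<partial>sph \<partial>sph)"
    by (rule sph_pair.Fubini') measurable
  also have "\<dots> = (\<integral>\<^sup>+u. \<integral>\<^sup>+z. w (cnj u *s z) * ker (cnj u *s z) u * f z \<partial>sph \<partial>sph)"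
  proof (rule nn_integral_sph_cong)
    fix u :: complex assume elim: "norm u = 1"
    have "orthogonal_transformation (\<lambda>z::complex^'n. cnj u *s z)"
      using elim by (intro orthogonal_transformation_unit_scalar) simp
    from nn_integral_sph_orthogonal[OF this, of "\<lambda>z. w z * ker z u * f (u *s z)"]
    show "(\<integral>\<^sup>+z. w z * ker z u * f (u *s z) \<partial>sph) = (\<integral>\<^sup>+z. w (cnj u *s z) * ker (cnj u *s z) u * f z \<partial>sph)"
      by (simp add: vector_smult_assoc cnj_mult_unit[OF elim])
  qed
  also have "\<dots> = (\<integral>\<^sup>+z. \<integral>\<^sup>+u. w (cnj u *s z) * ker (cnj u *s z) u * f z \<partial>sph \<partial>sph)"
  proof (rule sph_pair.Fubini')
    have [measurable]: "cnj \<in> borel_measurable borel"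
      by (intro borel_measurable_continuous_onI continuous_intros)
    show "(\<lambda>(z, u). w (cnj u *s z) * ker (cnj u *s z) u * f z) \<in> borel_measurable (sph \<Otimes>\<^sub>M sph)"
      by measurable
  qed
  also have "\<dots> = (\<integral>\<^sup>+z. \<integral>\<^sup>+u. w (u *s z) * ker (u *s z) u * f z \<partial>sph \<partial>sph)"
  proof (rule nn_integral_cong)
    fix z :: "complex^'n"
    have "(\<integral>\<^sup>+u. w (u *s z) * ker (u *s z) u * f z \<partial>sph) =
      (\<integral>\<^sup>+u. w (cnj u *s z) * ker (cnj u *s z) (cnj u) * f z \<partial>sph)"
      by (rule nn_integral_sph_orthogonal[OF orthogonal_transformation_cnj, symmetric]) measurable
    thus "(\<integral>\<^sup>+u. w (cnj u *s z) * ker (cnj u *s z) u * f z \<partial>sph) = (\<integral>\<^sup>+u. w (u *s z) * ker (u *s z) u * f z \<partial>sph)"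
      by (simp add: ker_def poisson_cnj)
  qed
  also have "\<dots> = (\<integral>\<^sup>+z. f z * T_adj w z \<partial>sph)"
    unfolding T_adj_def by (subst nn_integral_cmult[symmetric]) (simp_all only: mult_ac, measurable)
  finally show ?thesis .
qed

text \<open>Schematically \<open>T T\<^sup>* \<le> 25 (T + T\<^sup>*)\<close>, because the product of two Poisson kernels is dominated by their sum.\<close>

lemma T_adj_L2:
  assumes w[measurable]: "w \<in> borel_measurable borel"
  shows "(\<integral>\<^sup>+z. (T_adj w z)\<^sup>2 \<partial>sph) \<le> 50 * (\<integral>\<^sup>+z. w z * T_adj w z \<partial>sph)"
proof -
  let ?Q = "\<lambda>z u v. w z * w (v *s z) * (25 * (ker z v * ker (v *s z) (u * v) + ker z u * ker (v *s z) v))"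
  have sq: "(T_adj w z)\<^sup>2 = (\<integral>\<^sup>+u. \<integral>\<^sup>+v. ker (u *s z) u * w (u *s z) * (ker (v *s z) v * w (v *s z)) \<partial>sph \<partial>sph)" for z
    unfolding power2_eq_square T_adj_def
    by (subst nn_integral_cmult, measurable) (subst nn_integral_multc, measurable)
  have "(\<integral>\<^sup>+z. (T_adj w z)\<^sup>2 \<partial>sph) =
      (\<integral>\<^sup>+u. \<integral>\<^sup>+z. \<integral>\<^sup>+v. ker (u *s z) u * w (u *s z) * (ker (v *s z) v * w (v *s z)) \<partial>sph \<partial>sph \<partial>sph)"
    unfolding sq by (rule sph_pair.Fubini') measurable
  also have "\<dots> \<le> (\<integral>\<^sup>+u. \<integral>\<^sup>+z. \<integral>\<^sup>+v. ?Q z u v \<partial>sph \<partial>sph \<partial>sph)"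
  proof (rule nn_integral_sph_mono)
    fix u :: complex assume elim: "norm u = 1"
    let ?H = "\<lambda>z. \<integral>\<^sup>+v. ker (u *s z) u * w (u *s z) * (ker (v *s z) v * w (v *s z)) \<partial>sph"
    have "orthogonal_transformation (\<lambda>z::complex^'n. cnj u *s z)"
      using elim by (intro orthogonal_transformation_unit_scalar) simp
    hence "(\<integral>\<^sup>+z. ?H z \<partial>sph) = (\<integral>\<^sup>+z. ?H (cnj u *s z) \<partial>sph)"
      by (rule nn_integral_sph_orthogonal[symmetric]) measurable
    also have "\<dots> \<le> (\<integral>\<^sup>+z. \<integral>\<^sup>+v. ?Q z u v \<partial>sph \<partial>sph)"
    proof (rule nn_integral_mono)
      fix z :: "complex^'n"
      \<comment> \<open>The rotation of z by \<open>cnj u\<close>, followed by the substitution of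
        \<open>u * v\<close> for v, leaves the radii at z and \<open>v *s z\<close> with arguments u
        and \<open>u * v\<close>: exactly the product that \<open>ker_le\<close> bounds.\<close>
      have "?H (cnj u *s z) = (\<integral>\<^sup>+v. ker z u * w z * (ker ((v * cnj u) *s z) v * w ((v * cnj u) *s z)) \<partial>sph)"
        by (simp add: vector_smult_assoc cnj_mult_unit[OF elim])
      also have "\<dots> = (\<integral>\<^sup>+v. ker z u * w z * (ker (((u * v) * cnj u) *s z) (u * v) * w (((u * v) * cnj u) *s z)) \<partial>sph)"
        by (rule nn_integral_sph_orthogonal[OF orthogonal_transformation_unit_mult[OF elim], symmetric]) measurable
      also have "\<dots> = (\<integral>\<^sup>+v. ker z u * w z * (ker (v *s z) (u * v) * w (v *s z)) \<partial>sph)"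
      proof -
        have "(u * v) * cnj u = v" for v
          using cnj_mult_unit(1)[OF elim] by (metis mult.assoc mult.commute mult.right_neutral)
        thus ?thesis by (simp only:)
      qed
      also have "\<dots> \<le> (\<integral>\<^sup>+v. ?Q z u v \<partial>sph)"
      proof (rule nn_integral_sph_mono)
        fix v :: complex assume v: "cmod v = 1"
        have "ker z u * w z * (ker (v *s z) (u * v) * w (v *s z)) =
            w z * w (v *s z) * (ker z u * ker (v *s z) (u * v))"
          by (simp only: mult_ac)
        also have "\<dots> \<le> ?Q z u v"
          by (intro mult_left_mono ker_le[OF elim v]) simp
        finally show "ker z u * w z * (ker (v *s z) (u * v) * w (v *s z)) \<le> \<dots>" .
      qed
      finally show "?H (cnj u *s z) \<le> \<dots>" .
    qed
    finally show "(\<integral>\<^sup>+z. \<integral>\<^sup>+v. ker (u *s z) u * w (u *s z) * (ker (v *s z) v * w (v *s z)) \<partial>sph \<partial>sph) \<le> (\<integral>\<^sup>+z. \<integral>\<^sup>+v. ?Q z u v \<partial>sph \<partial>sph)" .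
  qed
  also have "\<dots> = (\<integral>\<^sup>+z. \<integral>\<^sup>+u. \<integral>\<^sup>+v. ?Q z u v \<partial>sph \<partial>sph \<partial>sph)"
    by (rule sph_pair.Fubini'[symmetric]) measurable
  also have "\<dots> = (\<integral>\<^sup>+z. 25 * (\<integral>\<^sup>+v. w z * ker z v * w (v *s z) \<partial>sph) + 25 * (w z * T_adj w z) \<partial>sph)"
  proof (rule nn_integral_cong)
    fix z :: "complex^'n"
    have "(\<integral>\<^sup>+u. \<integral>\<^sup>+v. ?Q z u v \<partial>sph \<partial>sph) =
      (\<integral>\<^sup>+v. \<integral>\<^sup>+u. ?Q z u v \<partial>sph \<partial>sph)"
      by (rule sph_pair.Fubini') measurable
    \<comment> \<open>In each summand just one kernel contains u, and it integrates to 1; a single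
      kernel remains.\<close>
    also have "\<dots> = (\<integral>\<^sup>+v. w z * w (v *s z) * (25 * (ker z v + ker (v *s z) v)) \<partial>sph)"
    proof (rule nn_integral_sph_cong)
      fix v :: complex assume v: "cmod v = 1"
      have "(\<integral>\<^sup>+u. ?Q z u v \<partial>sph) =
        w z * w (v *s z) * (25 * (ker z v * (\<integral>\<^sup>+u. ker (v *s z) (u * v) \<partial>sph) + (\<integral>\<^sup>+u. ker z u \<partial>sph) * ker (v *s z) v))"
        by (simp add: nn_integral_cmult nn_integral_add nn_integral_multc)
      thus "(\<integral>\<^sup>+u. ?Q z u v \<partial>sph) =
        w z * w (v *s z) * (25 * (ker z v + ker (v *s z) v))"
        by (simp add: nn_integral_ker nn_integral_ker_rotate[OF v])
    qed
    also have "\<dots> = (\<integral>\<^sup>+v. 25 * (w z * ker z v * w (v *s z)) + 25 * (w z * (ker (v *s z) v * w (v *s z))) \<partial>sph)"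
      by (intro nn_integral_cong) (simp add: algebra_simps)
    also have "\<dots> = 25 * (\<integral>\<^sup>+v. w z * ker z v * w (v *s z) \<partial>sph) + 25 * (w z * T_adj w z)"
      unfolding T_adj_def by (simp add: nn_integral_cmult nn_integral_add)
    finally show "(\<integral>\<^sup>+u. \<integral>\<^sup>+v. ?Q z u v \<partial>sph \<partial>sph) = \<dots>" .
  qed
  also have "\<dots> = 25 * (\<integral>\<^sup>+z. \<integral>\<^sup>+v. w z * ker z v * w (v *s z) \<partial>sph \<partial>sph) + 25 * (\<integral>\<^sup>+z. w z * T_adj w z \<partial>sph)"
    by (simp add: nn_integral_add nn_integral_cmult)
  \<comment> \<open>The first term pairs w with T w and equals the second by adjointness, whence 25
    + 25 = 50.\<close>
  also have "\<dots> = 50 * (\<integral>\<^sup>+z. w z * T_adj w z \<partial>sph)"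
    unfolding T_adjoint[OF w w] by (simp add: distrib_right[symmetric])
  finally show ?thesis .
qed

text \<open>A crude bound depending on \<rho>; it shows that the norms in \<open>maximal_L2\<close>
  are finite before they are cancelled.\<close>

lemma T_adj_bound:
  assumes w[measurable]: "w \<in> borel_measurable borel" and "\<And>z. w z \<le> ennreal B" and \<rho>: "\<rho> < 1" "\<And>z. rad z \<le> \<rho>"
  shows "T_adj w z \<le> ennreal (1 / (1 - \<rho>)\<^sup>2) * ennreal B"
proof -
  have "T_adj w z \<le> (\<integral>\<^sup>+u. ennreal (1 / (1 - \<rho>)\<^sup>2) * ennreal B \<partial>(sph :: complex measure))"
    unfolding T_adj_def
  proof (rule nn_integral_sph_mono)
    fix u :: complex assume elim: "norm u = 1"
    have "ker (u *s z) u \<le> ennreal (1 / (1 - \<rho>)\<^sup>2)"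
      unfolding ker_def using \<rho> rad elim by (intro ennreal_leI poisson_bound) auto
    thus "ker (u *s z) u * w (u *s z) \<le> ennreal (1 / (1 - \<rho>)\<^sup>2) * ennreal B" using assms(2) by (intro mult_mono) auto
  qed
  thus ?thesis by simp
qed

text \<open>Let N, M and F be the squared norms of T* m, m and f. \<open>T_adj_L2\<close> and
  Cauchy-Schwarz give N^2 \<le> 50^2 M N, so N \<le> 2500 M. Since m \<le> T f, duality gives M^2
  \<le> F N \<le> 2500 F M. The bounds on m and \<open>rad\<close> make M and N finite, which
  justifies both cancellations.\<close>

lemma maximal_L2:
  assumes [measurable]: "m \<in> borel_measurable borel" "f \<in> borel_measurable borel"
    and B: "\<And>z. m z \<le> ennreal B" and \<rho>: "\<rho> < 1" "\<And>z. rad z \<le> \<rho>"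
    and le: "AE z in sph. m z \<le> (\<integral>\<^sup>+u. ker z u * f (u *s z) \<partial>sph)"
  shows "(\<integral>\<^sup>+z. (m z)\<^sup>2 \<partial>sph) \<le> 2500 * (\<integral>\<^sup>+z. (f z)\<^sup>2 \<partial>sph)"
proof -
  define N where "N = (\<integral>\<^sup>+z. (T_adj m z)\<^sup>2 \<partial>sph)"
  define M where "M = (\<integral>\<^sup>+z. (m z)\<^sup>2 \<partial>sph)"
  define F where "F = (\<integral>\<^sup>+z. (f z)\<^sup>2 \<partial>sph)"
  have cancel: "x \<le> y" if "x * x \<le> y * x" "x < top" for x y :: ennreal
  proof (cases "x = 0")
    case False
    have "x * x / x \<le> y * x / x" using that(1) by (rule divide_right_mono_ennreal)
    thus ?thesis using False that(2) by (simp add: ennreal_mult_divide_eq)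
  qed simp
  have "N \<le> (\<integral>\<^sup>+z. (ennreal (1 / (1 - \<rho>)\<^sup>2) * ennreal B)\<^sup>2 \<partial>(sph :: (complex^'n) measure))"
    unfolding N_def using T_adj_bound[of m B \<rho>, OF _ B \<rho>] by (intro nn_integral_mono power_mono) auto
  also have "\<dots> < top" by (simp add: ennreal_mult_less_top power2_eq_square)
  finally have N: "N < top" .
  have "M \<le> (\<integral>\<^sup>+z. (ennreal B)\<^sup>2 \<partial>(sph :: (complex^'n) measure))"
    unfolding M_def using B by (intro nn_integral_mono power_mono) auto
  also have "\<dots> < top" by (simp add: ennreal_mult_less_top power2_eq_square)
  finally have M: "M < top" .
  have "N\<^sup>2 \<le> (50 * (\<integral>\<^sup>+z. m z * T_adj m z \<partial>sph))\<^sup>2"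
    unfolding N_def by (intro power_mono T_adj_L2) auto
  also have "\<dots> = 2500 * (\<integral>\<^sup>+z. m z * T_adj m z \<partial>sph)\<^sup>2"
    by (simp add: power_mult_distrib)
  also have "\<dots> \<le> 2500 * (M * N)"
    unfolding M_def N_def by (intro mult_left_mono Cauchy_Schwarz_nn_integral) auto
  finally have "N * N \<le> 2500 * M * N"
    by (simp only: power2_eq_square mult.assoc)
  hence NM: "N \<le> 2500 * M"
    using N by (rule cancel)
  have "M \<le> (\<integral>\<^sup>+z. m z * (\<integral>\<^sup>+u. ker z u * f (u *s z) \<partial>sph) \<partial>sph)"
    unfolding M_def power2_eq_square using le by (intro nn_integral_mono_AE) (auto elim!: eventually_mono intro: mult_left_mono)
  also have "\<dots> = (\<integral>\<^sup>+z. \<integral>\<^sup>+u. m z * ker z u * f (u *s z) \<partial>sph \<partial>sph)"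
    by (intro nn_integral_cong) (simp add: nn_integral_cmult mult.assoc)
  also have "\<dots> = (\<integral>\<^sup>+z. f z * T_adj m z \<partial>sph)"
    by (rule T_adjoint) auto
  finally have "M\<^sup>2 \<le> (\<integral>\<^sup>+z. f z * T_adj m z \<partial>sph)\<^sup>2"
    by (intro power_mono) auto
  also have "\<dots> \<le> F * N"
    unfolding F_def N_def by (intro Cauchy_Schwarz_nn_integral) auto
  also have "\<dots> \<le> F * (2500 * M)"
    using NM by (intro mult_left_mono) auto
  finally have "M * M \<le> F * (2500 * M)"
    by (simp only: power2_eq_square)
  also have "\<dots> = 2500 * F * M"
    by (simp only: mult_ac)
  finally have "M \<le> 2500 * F"
    using M by (rule cancel)
  thus ?thesis unfolding M_def F_def .
qed

end

section \<open>Anisotropic averages and pointwise estimates\<close>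

definition anisotropic :: "'n \<Rightarrow> real \<Rightarrow> real \<Rightarrow> complex^'n \<Rightarrow> complex^'n" where
  "anisotropic k a b w = (\<chi> j. (if j = k then a else b) *\<^sub>R w $ j)"

lemma linear_anisotropic: "linear (anisotropic k a b)"
  by (rule linearI) (auto simp: anisotropic_def vec_eq_iff algebra_simps)

lemma anisotropic_scale: "anisotropic k a b (c *s w) = c *s anisotropic k a b w"
  by (auto simp: anisotropic_def vec_eq_iff)

lemma norm_vec_power2: "(norm (x :: complex^'n))\<^sup>2 = (\<Sum>j\<in>UNIV. (cmod (x $ j))\<^sup>2)"
  by (simp add: norm_vec_def L2_set_def sum_nonneg)

lemma norm_vec_power2_split:
  "(norm (x :: complex^'n))\<^sup>2 = (cmod (x $ k))\<^sup>2 + (\<Sum>j\<in>UNIV-{k}. (cmod (x $ j))\<^sup>2)"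
  unfolding norm_vec_power2 by (rule sum.remove) auto

lemma card_Basis_component:
  fixes k :: "'n::finite"
  shows "card {j \<in> Basis :: (complex^'n) set. j $ k \<noteq> 0} = 2"
    and "card {j \<in> Basis :: (complex^'n) set. \<not> j $ k \<noteq> 0} = 2 * CARD('n) - 2"
proof -
  have "{j \<in> Basis :: (complex^'n) set. j $ k \<noteq> 0} = {axis k 1, axis k \<i>}"
    by (auto simp: Basis_vec_def axis_def Basis_complex_def split: if_splits)
  thus 1: "card {j \<in> Basis :: (complex^'n) set. j $ k \<noteq> 0} = 2"
    by (simp add: axis_eq_axis)
  have "card (Basis :: (complex^'n) set) =
      card ({j \<in> Basis :: (complex^'n) set. j $ k \<noteq> 0} \<union> {j \<in> Basis. \<not> j $ k \<noteq> 0})"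
    by (rule arg_cong[of _ _ card]) auto
  also have "\<dots> = card {j \<in> Basis :: (complex^'n) set. j $ k \<noteq> 0} + card {j \<in> Basis :: (complex^'n) set. \<not> j $ k \<noteq> 0}"
    by (rule card_Un_disjoint) auto
  finally show "card {j \<in> Basis :: (complex^'n) set. \<not> j $ k \<noteq> 0} = 2 * CARD('n) - 2"
    using 1 by simp
qed

lemma nn_integral_lborel_anisotropic:
  fixes f :: "complex^'n \<Rightarrow> ennreal"
  assumes [measurable]: "f \<in> borel_measurable borel" and a: "a > 0" and b: "b > 0"
  shows "(\<integral>\<^sup>+z. f z \<partial>lborel) =
    ennreal (a\<^sup>2 * b ^ (2 * CARD('n) - 2)) * (\<integral>\<^sup>+w. f (t + anisotropic k a b w) \<partial>lborel)"
proof -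
  \<comment> \<open>Two real basis vectors have a nonzero k-th entry, the real and the imaginary
    one; they account for \<open>a\<^sup>2\<close>, and the remaining
    \<open>2 * CARD('n) - 2\<close> for the powers of b.\<close>
  define c where "c j = (if j $ k \<noteq> 0 then a else b)" for j :: "complex^'n"
  have c: "c j \<noteq> 0" for j using a b by (auto simp: c_def)
  have T: "t + (\<Sum>j\<in>Basis. (c j * (x \<bullet> j)) *\<^sub>R j) = t + anisotropic k a b x" for x
  proof -
    have "anisotropic k a b x \<bullet> j = c j * (x \<bullet> j)" if jB: "j \<in> Basis" for j
    proof -
      obtain i u where j: "j = axis i u" "u \<in> Basis"
        using jB by (auto simp: Basis_vec_def)
      hence "c j = (if i = k then a else b)"
        by (auto simp: c_def axis_def)
      thus ?thesis by (simp add: j anisotropic_def inner_axis)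
    qed
    hence "(\<Sum>j\<in>Basis. (c j * (x \<bullet> j)) *\<^sub>R j) = (\<Sum>j\<in>Basis. (anisotropic k a b x \<bullet> j) *\<^sub>R j)"
      by (intro sum.cong) auto
    thus ?thesis by (simp add: euclidean_representation)
  qed
  have [measurable]: "anisotropic k a b \<in> borel_measurable borel"
    by (intro borel_measurable_continuous_onI linear_continuous_on linear_conv_bounded_linear[THEN iffD1] linear_anisotropic)
  have "(\<Prod>j\<in>Basis. \<bar>c j\<bar>) = (\<Prod>j\<in>(Basis :: (complex^'n) set). if j $ k \<noteq> 0 then a else b)"
    using a b by (intro prod.cong) (auto simp: c_def)
  also have "\<dots> = a\<^sup>2 * b ^ (2 * CARD('n) - 2)"
    by (subst prod.If_cases) (simp_all add: Collect_conj_eq[symmetric] Collect_neg_eq[symmetric] card_Basis_component[unfolded not_not] Int_def)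
  finally have P: "(\<Prod>j\<in>Basis. \<bar>c j\<bar>) = a\<^sup>2 * b ^ (2 * CARD('n) - 2)" .
  show ?thesis
    by (subst lborel_affine_euclidean[of c t, OF c])
       (simp add: T P nn_integral_density nn_integral_distr nn_integral_cmult)
qed

section \<open>Hermitian form and unitary maps\<close>

definition hermitian :: "complex^'n \<Rightarrow> complex^'n \<Rightarrow> complex" where
  "hermitian x y = (\<Sum>j\<in>UNIV. x $ j * cnj (y $ j))"

lemma hermitian_add: "hermitian (x + y) z = hermitian x z + hermitian y z"
  by (simp add: hermitian_def algebra_simps sum.distrib)

lemma hermitian_scale: "hermitian (c *s x) z = c * hermitian x z"
  by (simp add: hermitian_def sum_distrib_left mult.assoc)

lemma hermitian_self: "hermitian x x = of_real ((norm x)\<^sup>2)"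
  by (simp add: hermitian_def norm_vec_power2 complex_norm_square[symmetric])

lemma hermitian_cnj: "cnj (hermitian x y) = hermitian y x"
  by (simp add: hermitian_def mult.commute)

lemma hermitian_diff: "hermitian (x - y) z = hermitian x z - hermitian y z" "hermitian z (x - y) = hermitian z x - hermitian z y"
  by (simp_all add: hermitian_def algebra_simps sum_subtractf)

lemma hermitian_scale_right: "hermitian x (c *s z) = cnj c * hermitian x z"
  by (simp add: hermitian_def sum_distrib_left mult_ac)

text \<open>A complex Householder reflection. The phase e makes the Hermitian product of
  \<open>e *s u\<close> and v real and nonnegative; the reflection along w = e u - v then carries e
  u to v. The phase matters because a self-adjoint reflection can exchange two vectors only if their
  product is real.\<close>

lemma exists_unitary:
  fixes u v :: "complex^'n"
  assumes uv: "norm u = norm v"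
  obtains U where "linear U" "\<And>c x. U (c *s x) = c *s U x" "\<And>x. norm (U x) = norm x" "U u = v"
proof -
  define h where "h = hermitian u v"
  define e where "e = (if h = 0 then 1 else cnj h / of_real (cmod h))"
  have e: "cmod e = 1" "e * h = of_real (cmod h)"
    by (auto simp: e_def norm_divide complex_norm_square[symmetric] mult.commute power2_eq_square)
  define w where "w = e *s u - v"
  define U where "U x = (if w = 0 then e *s x
     else e *s x - (2 * hermitian (e *s x) w / of_real ((norm w)\<^sup>2)) *s w)" for x
  have w2: "of_real ((norm w)\<^sup>2) = (2 * of_real ((norm v)\<^sup>2 - cmod h) :: complex)"
  proof -
    have "of_real ((norm w)\<^sup>2) = hermitian w w" by (simp add: hermitian_self)
    also have "\<dots> = hermitian (e *s u) (e *s u) - hermitian (e *s u) v - (hermitian v (e *s u) - hermitian v v)"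
      by (simp add: w_def hermitian_diff)
    also have "hermitian (e *s u) (e *s u) = of_real ((norm v)\<^sup>2)"
      by (simp add: hermitian_self norm_vector_scalar_mult e uv)
    also have "hermitian (e *s u) v = of_real (cmod h)"
      by (simp add: hermitian_scale e h_def[symmetric])
    also have "hermitian v (e *s u) = cnj (hermitian (e *s u) v)"
      by (simp add: hermitian_cnj)
    also have "\<dots> = of_real (cmod h)"
      by (simp add: hermitian_scale e h_def[symmetric] del: complex_cnj_mult)
    finally show ?thesis by (simp add: hermitian_self)
  qed
  have uw: "hermitian (e *s u) w = of_real ((norm v)\<^sup>2 - cmod h)"
    by (simp add: w_def hermitian_diff hermitian_self norm_vector_scalar_mult e uv)
       (simp add: hermitian_scale e h_def[symmetric])
  show ?thesis
  proof
    have lin: "U (x + y) = U x + U y" "U (c *s x) = c *s U x" for x y c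
      by (auto simp: U_def vec_eq_iff hermitian_add hermitian_scale add_divide_distrib algebra_simps)
    show "linear U"
      using lin(1) lin(2)[of "of_real _"] by (intro linearI) (simp_all add: of_real_vector_scalar_mult)
    show "U (c *s x) = c *s U x" for c x by (rule lin)
    show "U u = v"
    proof (cases "w = 0")
      case True thus ?thesis by (simp add: U_def w_def)
    next
      case False
      \<comment> \<open>Because the product of e u and v is real, |w|^2 is twice the product of e u
        with w, so the reflection coefficient at e u is 1.\<close>
      have "2 * hermitian (e *s u) w / of_real ((norm w)\<^sup>2) = 1"
      proof -
        have "complex_of_real ((norm w)\<^sup>2) = 2 * hermitian (e *s u) w"
          by (simp only: w2 uw)
        moreover have "complex_of_real ((norm w)\<^sup>2) \<noteq> 0"
          using False by simp
        ultimately show ?thesis by (metis divide_self)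
      qed
      thus ?thesis using False by (simp add: U_def) (simp add: w_def)
    qed
    show "norm (U x) = norm x" for x
    proof (cases "w = 0")
      case True thus ?thesis by (simp add: U_def norm_vector_scalar_mult e)
    next
      case False
      define y where "y = e *s x"
      define t where "t = 2 * hermitian y w / of_real ((norm w)\<^sup>2)"
      have "of_real ((norm (U x))\<^sup>2) = hermitian (y - t *s w) (y - t *s w)"
        using False by (simp add: hermitian_self U_def y_def t_def)
      also have "\<dots> = hermitian y y - cnj t * hermitian y w - (t * hermitian w y - t * cnj t * hermitian w w)"
        by (simp add: hermitian_diff hermitian_scale hermitian_scale_right algebra_simps)
      also have "hermitian w w = of_real ((norm w)\<^sup>2)"
        by (rule hermitian_self)
      also have "hermitian w y = cnj (hermitian y w)"
        by (simp add: hermitian_cnj)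
      also have "t * cnj t * of_real ((norm w)\<^sup>2) = 2 * t * cnj (hermitian y w)"
      proof -
        have "cnj t * of_real ((norm w)\<^sup>2) = 2 * cnj (hermitian y w)"
          using False by (simp add: t_def)
        thus ?thesis by (simp only: mult.assoc mult.left_commute[of t 2])
      qed
      also have "cnj t * hermitian y w = t * cnj (hermitian y w)"
        by (simp add: t_def)
      also have "hermitian y y = of_real ((norm x)\<^sup>2)"
        by (simp add: hermitian_self y_def norm_vector_scalar_mult e)
      finally have "complex_of_real ((norm (U x))\<^sup>2) = of_real ((norm x)\<^sup>2)" by simp
      hence "(norm (U x))\<^sup>2 = (norm x)\<^sup>2" by (simp only: of_real_eq_iff)
      thus ?thesis by simp
    qed
  qed
qed

text \<open>Values outside the ball are arbitrary, hence possibly not measurable; cutting them off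
  yields a Borel function on the whole space.\<close>

definition ball_ext :: "(complex^'n \<Rightarrow> complex) \<Rightarrow> complex^'n \<Rightarrow> complex" where
  "ball_ext f z = indicator (ball 0 1) z *\<^sub>R f z"

lemma ball_ext_eq: "norm z < 1 \<Longrightarrow> ball_ext f z = f z"
  and ball_ext_eq_0: "\<not> norm z < 1 \<Longrightarrow> ball_ext f z = 0"
  by (simp_all add: ball_ext_def)

lemma ball_ext_measurable:
  assumes "holomorphic_several f (ball 0 1)"
  shows "ball_ext f \<in> borel_measurable borel"
  unfolding ball_ext_def
  by (rule borel_measurable_continuous_on_indicator) (auto intro: holomorphic_several_continuous_on[OF assms])

section \<open>Spherical integral means\<close>

definition integral_mean :: "real \<Rightarrow> (complex^'n \<Rightarrow> complex) \<Rightarrow> real \<Rightarrow> ennreal" where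
  "integral_mean p f r = (\<integral>\<^sup>+z. ennreal (cmod (ball_ext f (r *\<^sub>R z)) powr p) \<partial>sph)"

lemma hardy_integral_eq:
  assumes "holomorphic_several f (ball 0 1)"
  shows "hardy_integral p f = (SUP r\<in>{0<..<1}. integral_mean p f r)"
  unfolding hardy_integral_def
proof (rule SUP_cong)
  fix r :: real assume r: "r \<in> {0<..<1}"
  note [measurable] = ball_ext_measurable[OF assms]
  have "(\<integral>\<^sup>+z. ennreal (cmod (f (r *\<^sub>R z)) powr p) \<partial>normalized_surface_measure) =
     (\<integral>\<^sup>+z. ennreal (cmod (ball_ext f (r *\<^sub>R z)) powr p) \<partial>normalized_surface_measure)"
    using r by (intro nn_integral_cong) (auto simp: normalized_surface_measure_def ball_ext_eq)
  also have "\<dots> = integral_mean p f r"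
    unfolding integral_mean_def by (rule nn_integral_normalized_surface_measure) measurable
  finally show "(\<integral>\<^sup>+z. ennreal (cmod (f (r *\<^sub>R z)) powr p) \<partial>normalized_surface_measure) = integral_mean p f r" .
qed simp

lemma integral_mean_le:
  "holomorphic_several f (ball 0 1) \<Longrightarrow> 0 < r \<Longrightarrow> r < 1 \<Longrightarrow> integral_mean p f r \<le> hardy_integral p f"
  by (auto simp: hardy_integral_eq intro: SUP_upper)

lemma hardy_integral_leI:
  assumes "holomorphic_several f (ball 0 1)" "\<And>r. 0 < r \<Longrightarrow> r < 1 \<Longrightarrow> integral_mean p f r \<le> C"
  shows "hardy_integral p f \<le> C"
  using assms by (auto simp: hardy_integral_eq intro: SUP_least)

text \<open>Lets growth estimates and test functions be set up on a coordinate axis and then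
  rotated.\<close>

lemma hardy_integral_unitary:
  fixes f :: "complex^'n \<Rightarrow> complex" and U :: "complex^'n \<Rightarrow> complex^'n"
  assumes f: "holomorphic_several f (ball 0 1)"
    and U: "linear U" "\<And>c x. U (c *s x) = c *s U x" "\<And>x. norm (U x) = norm x"
  shows "holomorphic_several (\<lambda>z. f (U z)) (ball 0 1)"
    and "hardy_integral p (\<lambda>z. f (U z)) = hardy_integral p f"
proof -
  show h: "holomorphic_several (\<lambda>z. f (U z)) (ball 0 1)"
    using holomorphic_several_compose_affine[OF f U(1,2), of "ball 0 1" 0] by (simp add: U(3))
  note [measurable] = ball_ext_measurable[OF f]
  have ext: "ball_ext (\<lambda>z. f (U z)) z = ball_ext f (U z)" for z
    by (simp add: ball_ext_def indicator_def U(3))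
  have "orthogonal_transformation U"
    using U by (simp add: orthogonal_transformation)
  have "integral_mean p (\<lambda>z. f (U z)) r = integral_mean p f r" for r
    using nn_integral_sph_orthogonal[OF \<open>orthogonal_transformation U\<close>, of "\<lambda>z. ennreal (cmod (ball_ext f (r *\<^sub>R z)) powr p)"]
    by (simp add: integral_mean_def ext linear_scale[OF U(1)])
  thus "hardy_integral p (\<lambda>z. f (U z)) = hardy_integral p f"
    by (simp add: hardy_integral_eq[OF h] hardy_integral_eq[OF f])
qed

section \<open>Growth estimate in the Hardy space\<close>

lemma ball_ext_powr_measurable:
  "(\<lambda>z. ennreal (cmod (ball_ext f z) powr p)) \<in> borel_measurable borel"
  if "holomorphic_several f (ball 0 1)"
  using ball_ext_measurable[OF that] by measurable

text \<open>A tangential displacement of order sqrt \<delta> changes the squared norm only by order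
  \<delta>, so the ellipsoid stays in the shell. The radius 2 for w, twice what the volume average
  uses, leaves room for slices holomorphic on a disc larger than the unit disc.\<close>

lemma norm_anisotropic_shift:
  fixes w :: "complex^'n"
  assumes \<delta>: "0 < \<delta>" "\<delta> \<le> 1" and w: "norm w < 2"
  shows "norm ((1 - \<delta>) *\<^sub>R axis k 1 + anisotropic k (\<delta> / 8) (sqrt \<delta> / 4) w) < 1"
    and "1 - 2 * \<delta> < norm ((1 - \<delta>) *\<^sub>R axis k 1 + anisotropic k (\<delta> / 8) (sqrt \<delta> / 4) w)"
proof -
  let ?z = "(1 - \<delta>) *\<^sub>R axis k 1 + anisotropic k (\<delta> / 8) (sqrt \<delta> / 4) w"
  have zk: "?z $ k = of_real (1 - \<delta>) + of_real (\<delta> / 8) * w $ k"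
    by (simp add: anisotropic_def axis_def scaleR_conv_of_real[where 'a=complex])
  have zj: "cmod (?z $ j) = sqrt \<delta> / 4 * cmod (w $ j)" if "j \<noteq> k" for j
    using that \<delta> by (simp add: anisotropic_def axis_def)
  have nth: "cmod (x $ k) \<le> norm x" for x :: "complex^'n"
    by (rule Finite_Cartesian_Product.norm_nth_le)
  have wk: "cmod (w $ k) < 2" using nth[of w] w by simp
  have d8: "cmod (of_real (\<delta> / 8) * w $ k) = \<delta> / 8 * cmod (w $ k)" using \<delta> by (simp add: norm_mult)
  have "\<delta> / 8 * cmod (w $ k) \<le> \<delta> / 8 * 2" using wk \<delta> by (intro mult_left_mono) auto
  hence d4: "cmod (of_real (\<delta> / 8) * w $ k) \<le> \<delta> / 4" using d8 by simp
  have up: "cmod (?z $ k) \<le> 1 - 3 / 4 * \<delta>"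
  proof -
    have "cmod (?z $ k) \<le> cmod (of_real (1 - \<delta>)) + cmod (of_real (\<delta> / 8) * w $ k)"
      unfolding zk by (rule norm_triangle_ineq)
    thus ?thesis using d4 \<delta> norm_of_real[of "1 - \<delta>", where 'a=complex] by linarith
  qed
  have "cmod (of_real (1 - \<delta>)) - cmod (of_real (\<delta> / 8) * w $ k) \<le> cmod (?z $ k)"
    unfolding zk by (rule norm_diff_ineq)
  hence "1 - 2 * \<delta> < cmod (?z $ k)"
    using d4 \<delta> norm_of_real[of "1 - \<delta>", where 'a=complex] by linarith
  thus "1 - 2 * \<delta> < norm ?z" using nth[of ?z] by simp
  have w4: "(norm w)\<^sup>2 \<le> 4" using w power_mono[of "norm w" 2 2] by simp
  have "(norm ?z)\<^sup>2 = (cmod (?z $ k))\<^sup>2 + (\<Sum>j\<in>UNIV-{k}. (cmod (?z $ j))\<^sup>2)"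
    by (rule norm_vec_power2_split)
  also have "(\<Sum>j\<in>UNIV-{k}. (cmod (?z $ j))\<^sup>2) = (\<Sum>j\<in>UNIV-{k}. \<delta> / 16 * (cmod (w $ j))\<^sup>2)"
  proof (rule sum.cong[OF refl])
    fix j assume "j \<in> UNIV - {k}"
    hence "cmod (?z $ j) = sqrt \<delta> / 4 * cmod (w $ j)" by (intro zj) simp
    hence "(cmod (?z $ j))\<^sup>2 = (sqrt \<delta> / 4 * cmod (w $ j))\<^sup>2" by (rule arg_cong)
    also have "\<dots> = \<delta> / 16 * (cmod (w $ j))\<^sup>2"
      using \<delta> by (simp add: power_mult_distrib power_divide)
    finally show "(cmod (?z $ j))\<^sup>2 = \<delta> / 16 * (cmod (w $ j))\<^sup>2" .
  qed
  also have "\<dots> = \<delta> / 16 * (\<Sum>j\<in>UNIV-{k}. (cmod (w $ j))\<^sup>2)"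
    by (rule sum_distrib_left[symmetric])
  also have "\<dots> \<le> \<delta> / 16 * 4"
  proof (rule mult_left_mono)
    show "(\<Sum>j\<in>UNIV-{k}. (cmod (w $ j))\<^sup>2) \<le> 4"
      using w4 norm_vec_power2_split[of w k] zero_le_power2[of "cmod (w $ k)"] by linarith
  qed (use \<delta> in simp)
  also have "(cmod (?z $ k))\<^sup>2 \<le> (1 - 3 / 4 * \<delta>)\<^sup>2"
    using up by (intro power_mono) auto
  \<comment> \<open>The sum is 1 - (5/4) \<delta> + (9/16) \<delta>^2, which is below 1 since
    \<delta>^2 \<le> \<delta>.\<close>
  also have "(1 - 3 / 4 * \<delta>)\<^sup>2 + \<delta> / 16 * 4 < 1"
  proof -
    have "\<delta> * \<delta> \<le> \<delta>" using \<delta> by (simp add: mult_left_le)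
    thus ?thesis using \<delta> by (simp add: power2_eq_square algebra_simps)
  qed
  finally have "(norm ?z)\<^sup>2 < 1\<^sup>2" by simp
  thus "norm ?z < 1" by (rule power2_less_imp_less) simp
qed

text \<open>The value at the centre of an ellipsoid is below the average over it. The ellipsoid has
  volume of order \<delta>^(n+1) and sits in a shell of thickness at most 2 \<delta>, where the
  integral of |f|^p with the polar weight is at most of order \<delta> times the Hardy integral; the
  quotient is \<delta>^(-n).\<close>

lemma pointwise_axis:
  fixes f :: "complex^'n \<Rightarrow> complex" and \<delta> :: real
  assumes f: "holomorphic_several f (ball 0 1)" and p: "p > 0" and \<delta>: "0 < \<delta>" "\<delta> \<le> 1"
  shows "ennreal ((\<delta> / 8)\<^sup>2 * (sqrt \<delta> / 4) ^ (2 * CARD('n) - 2)) * ennreal (cmod (f ((1 - \<delta>) *\<^sub>R axis k 1)) powr p)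
     \<le> ennreal (4 * CARD('n) * \<delta>) * hardy_integral p f"
proof -
  let ?c = "ennreal ((\<delta> / 8)\<^sup>2 * (sqrt \<delta> / 4) ^ (2 * CARD('n) - 2))"
  let ?b = "(1 - \<delta>) *\<^sub>R axis k 1 :: complex^'n"
  let ?D = "anisotropic k (\<delta> / 8) (sqrt \<delta> / 4)"
  let ?v = "emeasure lborel (ball (0::complex^'n) 1)"
  let ?B = "indicator (ball (0::complex^'n) 1) :: _ \<Rightarrow> ennreal"
  define F where "F z = ennreal (cmod (ball_ext f z) powr p)" for z
  have F[measurable]: "F \<in> borel_measurable borel"
    unfolding F_def by (rule ball_ext_powr_measurable[OF f])
  have D[measurable]: "?D \<in> borel_measurable borel"
    by (intro borel_measurable_continuous_onI linear_continuous_on linear_conv_bounded_linear[THEN iffD1] linear_anisotropic)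
  let ?G = "\<lambda>w. F (?b + ?D w)"
  let ?x = "ennreal (cmod (f ?b) powr p)"
  have step1: "?x \<le> (\<integral>\<^sup>+u. ?G (u *s w) \<partial>sph)" if w: "norm w < 1" for w
  proof -
    have sub: "?b + u *s ?D w \<in> ball 0 1" if "cmod u < 2" for u
    proof -
      have "norm (u *s w) < 2"
        using that w mult_strict_mono[of "cmod u" 2 "norm w" 1] by (simp add: norm_vector_scalar_mult)
      from norm_anisotropic_shift(1)[OF \<delta> this, where k=k] show ?thesis
        by (simp add: anisotropic_scale)
    qed
    have "(\<lambda>u. f (?b + u *s ?D w)) holomorphic_on ball 0 2"
      by (rule slice_holomorphic_on[OF f sub]) simp
    moreover have "(\<lambda>u. ?G (u *s w)) \<in> borel_measurable borel"
      by measurable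
    \<comment> \<open>At a = 0 the Poisson kernel is 1, so this is the sub-mean value property on a
      circle in the slice.\<close>
    ultimately have "ennreal (cmod (f (?b + 0 *s ?D w)) powr p) \<le> (\<integral>\<^sup>+u. ?G (u *s w) * ennreal (poisson 0 u) \<partial>sph)"
      using sub by (intro sph_Poisson_ineq[OF _ _ _ p]) (auto simp: F_def anisotropic_scale ball_ext_eq)
    thus ?thesis
      by (simp add: poisson_def)
  qed
  have "?x * ?v = (\<integral>\<^sup>+w. ?x * ?B w \<partial>lborel)"
    by (simp add: nn_integral_cmult)
  also have "\<dots> \<le> (\<integral>\<^sup>+w. \<integral>\<^sup>+u. ?G (u *s w) * ?B w \<partial>(sph :: complex measure) \<partial>lborel)"
    using step1 by (intro nn_integral_mono) (auto simp: indicator_def)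
  also have "\<dots> = (\<integral>\<^sup>+u. \<integral>\<^sup>+w. ?G (u *s w) * ?B w \<partial>lborel \<partial>(sph :: complex measure))"
    by (rule sph_lborel.Fubini') measurable
  also have "\<dots> = (\<integral>\<^sup>+u. (\<integral>\<^sup>+w. ?G w * ?B w \<partial>lborel) \<partial>(sph :: complex measure))"
  proof (rule nn_integral_sph_cong)
    fix u :: complex assume elim: "norm u = 1"
    have "(\<integral>\<^sup>+w. ?G (u *s w) * ?B w \<partial>lborel) = (\<integral>\<^sup>+w. ?G (u *s w) * ?B (u *s w) \<partial>lborel)"
      using elim by (simp add: indicator_def norm_vector_scalar_mult)
    also have "\<dots> = (\<integral>\<^sup>+w. ?G w * ?B w \<partial>lborel)"
      by (rule nn_integral_lborel_orthogonal[OF orthogonal_transformation_unit_scalar[OF elim]]) measurable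
    finally show "(\<integral>\<^sup>+w. ?G (u *s w) * ?B w \<partial>lborel) = (\<integral>\<^sup>+w. ?G w * ?B w \<partial>lborel)" .
  qed
  also have "\<dots> = (\<integral>\<^sup>+w. ?G w * ?B w \<partial>lborel)"
    by simp
  finally have "?x * ?v \<le> \<dots>" .
  also have "\<dots> \<le> (\<integral>\<^sup>+w. (\<lambda>z. F z * indicator {z. 1 - 2 * \<delta> < norm z} z) (?b + ?D w) \<partial>lborel)"
    using norm_anisotropic_shift(2)[OF \<delta>, where k=k] by (intro nn_integral_mono) (auto simp: indicator_def)
  finally have "?c * (?x * ?v) \<le>
      ?c *
      (\<integral>\<^sup>+w. (\<lambda>z. F z * indicator {z. 1 - 2 * \<delta> < norm z} z) (?b + ?D w) \<partial>lborel)"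
    by (rule mult_left_mono) simp
  also have "\<dots> = (\<integral>\<^sup>+z. F z * indicator {z. 1 - 2 * \<delta> < norm z} z \<partial>lborel)"
    using \<delta> by (intro nn_integral_lborel_anisotropic[symmetric]) auto
  \<comment> \<open>The polar weight is at least 1 inside the ball, so it may be inserted; the
    maximum with 0 covers the case 1 - 2 \<delta> < 0.\<close>
  also have "\<dots> \<le> (\<integral>\<^sup>+z. F z * ennreal (norm z powr (1 - real DIM(complex^'n)))
      * indicator {z. max 0 (1 - 2 * \<delta>) < norm z \<and> norm z < 1} z \<partial>lborel)"
  proof (rule nn_integral_mono_AE)
    have "AE z in lborel. z \<noteq> (0::complex^'n)" by (rule AE_lborel_singleton)
    thus "AE z in lborel. F z * indicator {z. 1 - 2 * \<delta> < norm z} z \<le> F z * ennreal (norm z powr (1 - real DIM(complex^'n)))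
      * indicator {z. max 0 (1 - 2 * \<delta>) < norm z \<and> norm z < 1} z"
    proof eventually_elim
      case (elim z)
      show ?case
      proof (cases "1 - 2 * \<delta> < norm z \<and> norm z < 1")
        case True
        have "1 \<le> norm z powr (1 - real DIM(complex^'n))"
        proof -
          have "1 - real DIM(complex^'n) \<le> 0"
            using DIM_positive[where 'a="complex^'n"] by linarith
          from powr_mono'[OF this, of "norm z"] show ?thesis
            using True elim by simp
        qed
        hence "1 \<le> ennreal (norm z powr (1 - real DIM(complex^'n)))"
          using ennreal_leI by fastforce
        from mult_left_mono[OF this, of "F z"] show ?thesis
          using True elim by simp
      next
        case False
        thus ?thesis by (auto simp: F_def ball_ext_eq_0 indicator_def)
      qed
    qed
  qed
  also have "\<dots> = (\<integral>\<^sup>+r. (\<integral>\<^sup>+z. F (r *\<^sub>R z) \<partial>sph) * indicator {max 0 (1 - 2 * \<delta>)<..<1} r \<partial>lborel) * (DIM(complex^'n) * ?v)"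
  proof -
    have c: "of_nat DIM(complex^'n) * ?v \<noteq> 0" "of_nat DIM(complex^'n) * ?v < top"
      using emeasure_lborel_unit_ball[where 'a="complex^'n"] DIM_positive[where 'a="complex^'n"]
      by (auto simp: ennreal_mult_less_top of_nat_less_top top.not_eq_extremum)
    show ?thesis
      by (subst nn_integral_sph_shell[OF F max.cobounded1])
        (simp only: ennreal_divide_times ennreal_divide_self[OF c] mult_1_right)
  qed
  also have "(\<integral>\<^sup>+r. (\<integral>\<^sup>+z. F (r *\<^sub>R z) \<partial>sph) * indicator {max 0 (1 - 2 * \<delta>)<..<1} r \<partial>lborel) \<le>
      (\<integral>\<^sup>+r. hardy_integral p f * indicator {max 0 (1 - 2 * \<delta>)<..<1} r \<partial>lborel)"
    using integral_mean_le[OF f, of _ p]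
    by (intro nn_integral_mono) (auto simp: indicator_def F_def integral_mean_def)
  also have "\<dots> = hardy_integral p f * ennreal (1 - max 0 (1 - 2 * \<delta>))"
    using \<delta> by (subst nn_integral_cmult) auto
  also have "\<dots> \<le> hardy_integral p f * ennreal (2 * \<delta>)"
    by (intro mult_left_mono ennreal_leI) auto
  finally have "?c * ?x * ?v \<le>
      hardy_integral p f * ennreal (2 * \<delta>) * of_nat (2 * CARD('n)) * ?v"
    by (simp add: mult_right_mono mult_ac)
  hence "?c * ?x * ?v / ?v \<le>
      hardy_integral p f * ennreal (2 * \<delta>) * of_nat (2 * CARD('n)) * ?v / ?v"
    by (rule divide_right_mono_ennreal)
  hence "?c * ?x \<le>
      hardy_integral p f * (ennreal (2 * \<delta>) * of_nat (2 * CARD('n)))"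
    by (simp only: mult_divide_eq_ennreal[OF emeasure_lborel_unit_ball(1,3)]) (simp only: mult.assoc)
  also have "ennreal (2 * \<delta>) * of_nat (2 * CARD('n)) = ennreal (4 * CARD('n) * \<delta>)"
    using \<delta> by (simp add: ennreal_of_nat_eq_real_of_nat ennreal_mult[symmetric] mult_ac del: of_nat_mult)
  finally show ?thesis by (simp add: mult.commute)
qed

text \<open>Two powers of \<delta> come from the complex direction k and half a power from each of
  the 2n - 2 remaining real directions, in total n + 1.\<close>

lemma anisotropic_det:
  assumes "a > 0" "b > 0" "\<delta> > 0" "n > 0"
  shows "(a * \<delta>)\<^sup>2 * (b * sqrt \<delta>) ^ (2 * n - 2) = a\<^sup>2 * (b\<^sup>2) ^ (n - 1) * \<delta> ^ (n + 1)"
proof -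
  have "2 * n - 2 = 2 * (n - 1)" by simp
  hence "(b * sqrt \<delta>) ^ (2 * n - 2) = ((b * sqrt \<delta>)\<^sup>2) ^ (n - 1)"
    by (simp only: power_mult)
  also have "\<dots> = (b\<^sup>2) ^ (n - 1) * \<delta> ^ (n - 1)"
    using assms by (simp add: power_mult_distrib)
  also have "(a * \<delta>)\<^sup>2 * \<dots> = a\<^sup>2 * (b\<^sup>2) ^ (n - 1) * (\<delta> ^ (n - 1) * \<delta>\<^sup>2)"
    by (simp add: power_mult_distrib)
  also have "\<delta> ^ (n - 1) * \<delta>\<^sup>2 = \<delta> ^ (n + 1)"
    using assms by (simp add: power_add[symmetric])
  finally show ?thesis .
qed

text \<open>The inverse of the volume factor (1/8)^2 (1/4)^(2n-2) of the ellipsoid in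
  \<open>pointwise_axis\<close>, times the 4n produced there by the shell.\<close>

definition pointwise_const :: "nat \<Rightarrow> real" where
  "pointwise_const n = 4 * n * 64 * 16 ^ (n - 1)"

lemma pointwise_const_pos: "n > 0 \<Longrightarrow> pointwise_const n > 0"
  by (simp add: pointwise_const_def)

lemma pointwise_estimate:
  fixes f :: "complex^'n \<Rightarrow> complex"
  assumes f: "holomorphic_several f (ball 0 1)" and p: "p > 0" and z: "norm z < 1"
    and M: "hardy_integral p f \<le> ennreal M" "M \<ge> 0"
  shows "cmod (f z) powr p \<le> pointwise_const CARD('n) * M * (1 - norm z) powr (- real CARD('n))"
proof -
  obtain k :: 'n where True by blast
  define \<delta> where "\<delta> = 1 - norm z"
  have \<delta>: "0 < \<delta>" "\<delta> \<le> 1" using z by (auto simp: \<delta>_def)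
  let ?n = "CARD('n)"
  obtain U where U: "linear U" "\<And>c x. U (c *s x) = c *s U x" "\<And>x. norm (U x) = norm x"
      "U (norm z *\<^sub>R axis k 1) = z"
    using exists_unitary[of "norm z *\<^sub>R axis k 1" z] by auto
  note fU = hardy_integral_unitary[OF f U(1-3)]
  have "ennreal ((\<delta> / 8)\<^sup>2 * (sqrt \<delta> / 4) ^ (2 * ?n - 2)) * ennreal (cmod (f (U ((1 - \<delta>) *\<^sub>R axis k 1))) powr p)
     \<le> ennreal (4 * ?n * \<delta>) * hardy_integral p (\<lambda>z. f (U z))"
    by (rule pointwise_axis[OF fU(1) p \<delta>])
  also have "\<dots> \<le> ennreal (4 * ?n * \<delta>) * ennreal M"
    unfolding fU(2) by (intro mult_left_mono M) simp
  finally have "ennreal ((\<delta> / 8)\<^sup>2 * (sqrt \<delta> / 4) ^ (2 * ?n - 2) * cmod (f z) powr p) \<le> ennreal (4 * ?n * \<delta> * M)"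
    using U(4) M \<delta> by (simp add: ennreal_mult \<delta>_def)
  hence "(\<delta> / 8)\<^sup>2 * (sqrt \<delta> / 4) ^ (2 * ?n - 2) * cmod (f z) powr p \<le> 4 * ?n * \<delta> * M"
    using \<delta> M by (subst (asm) ennreal_le_iff) auto
  also have "(\<delta> / 8)\<^sup>2 * (sqrt \<delta> / 4) ^ (2 * ?n - 2) = 1 / 64 * (1 / 16) ^ (?n - 1) * \<delta> ^ (?n + 1)"
    using anisotropic_det[of "1/8" "1/4" \<delta> ?n] \<delta> by (simp add: power_divide)
  finally have "\<delta> ^ ?n * \<delta> * cmod (f z) powr p \<le> 4 * ?n * M * 64 * 16 ^ (?n - 1) * \<delta>"
    by (simp add: field_simps)
  hence "\<delta> ^ ?n * cmod (f z) powr p * \<delta> \<le> pointwise_const ?n * M * \<delta>"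
    by (simp add: pointwise_const_def mult_ac)
  hence "\<delta> ^ ?n * cmod (f z) powr p \<le> pointwise_const ?n * M"
    using \<delta> by (simp only: mult_le_cancel_right_pos)
  hence "\<delta> ^ ?n * cmod (f z) powr p * \<delta> powr (- real ?n) \<le> pointwise_const ?n * M * \<delta> powr (- real ?n)"
    by (rule mult_right_mono) simp
  moreover have "\<delta> ^ ?n * cmod (f z) powr p * \<delta> powr (- real ?n) = cmod (f z) powr p"
    using \<delta> by (simp add: powr_minus powr_realpow)
  ultimately show ?thesis
    by (simp only: \<delta>_def)
qed

lemma pointwise_estimate':
  fixes f :: "complex^'n \<Rightarrow> complex"
  assumes f: "holomorphic_several f (ball 0 1)" and p: "p > 0" and z: "norm z < 1"
    and M: "hardy_integral p f \<le> ennreal M" "M \<ge> 0"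
  shows "cmod (f z) \<le> (pointwise_const CARD('n) * M) powr (1 / p) * (1 - norm z) powr (- real CARD('n) / p)"
proof -
  have "cmod (f z) = (cmod (f z) powr p) powr (1 / p)"
    using p by (simp add: powr_powr)
  also have "\<dots> \<le> (pointwise_const CARD('n) * M * (1 - norm z) powr (- real CARD('n))) powr (1 / p)"
    using p by (intro powr_mono2 pointwise_estimate assms) auto
  also have "\<dots> = (pointwise_const CARD('n) * M) powr (1 / p) * (1 - norm z) powr (- real CARD('n) / p)"
    using M pointwise_const_pos[of "CARD('n)"] by (simp add: powr_mult powr_powr)
  finally show ?thesis .
qed

section \<open>Caps, kernel integrals and test functions\<close>

lemma cap_volume:
  fixes k :: "'n::finite"
  assumes t: "0 < t" "t < 1 / 2"
  shows "(\<integral>\<^sup>+z. indicator {z::complex^'n. cmod (1 - z $ k) < 2 * t \<and> norm z < 1} z \<partial>lborel) \<le>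
    ennreal (16 * 16 ^ (CARD('n) - 1) * t ^ (CARD('n) + 1)) * emeasure lborel (ball (0::complex^'n) 1)"
proof -
  let ?S = "{z::complex^'n. cmod (1 - z $ k) < 2 * t \<and> norm z < 1}"
  have [measurable]: "?S \<in> sets borel"
    by (intro borel_open open_Collect_conj open_Collect_less continuous_intros)
  \<comment> \<open>Here |z_k| > 1 - 2t leaves less than 4t for the squares of the other
    coordinates, so after rescaling |w_k| < 1/2 and the remaining squares sum to less than 1/4. The
    condition t < 1/2 makes 1 - 2t positive, so that the inequality may be squared.\<close>
  have sub: "norm w < 1" if "axis k 1 + anisotropic k (4 * t) (4 * sqrt t) w \<in> ?S" for w
  proof -
    let ?z = "axis k 1 + anisotropic k (4 * t) (4 * sqrt t) w"
    have zk: "?z $ k = 1 + of_real (4 * t) * w $ k"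
      by (simp add: anisotropic_def axis_def scaleR_conv_of_real[where 'a=complex])
    have zj: "cmod (?z $ j) = 4 * sqrt t * cmod (w $ j)" if "j \<noteq> k" for j
      using that t by (simp add: anisotropic_def axis_def)
    have 1: "cmod (1 - ?z $ k) < 2 * t" and 2: "norm ?z < 1"
      using that by auto
    have "4 * t * cmod (w $ k) < 2 * t"
      using 1 t unfolding zk by (simp add: norm_mult)
    hence wk: "cmod (w $ k) < 1 / 2" using t by simp
    have "1 - 2 * t < cmod (?z $ k)"
      using 1 norm_triangle_ineq2[of 1 "1 - ?z $ k"] norm_triangle_ineq2[of 1 "?z $ k"]
        norm_triangle_sub[of 1 "?z $ k"] by simp
    hence "(1 - 2 * t)\<^sup>2 \<le> (cmod (?z $ k))\<^sup>2"
      using t by (intro power_mono) auto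
    moreover have "(norm ?z)\<^sup>2 < 1" using 2 by (simp add: abs_square_less_1)
    ultimately have "(\<Sum>j\<in>UNIV-{k}. (cmod (?z $ j))\<^sup>2) < 1 - (1 - 2 * t)\<^sup>2"
      using norm_vec_power2_split[of ?z k] by linarith
    also have "\<dots> \<le> 4 * t" by (simp add: power2_eq_square algebra_simps)
    also have "(\<Sum>j\<in>UNIV-{k}. (cmod (?z $ j))\<^sup>2) = (\<Sum>j\<in>UNIV-{k}. 16 * t * (cmod (w $ j))\<^sup>2)"
    proof (rule sum.cong[OF refl])
      fix j assume "j \<in> UNIV - {k}"
      hence "cmod (?z $ j) = 4 * sqrt t * cmod (w $ j)" by (intro zj) simp
      hence "(cmod (?z $ j))\<^sup>2 = (4 * sqrt t * cmod (w $ j))\<^sup>2" by (rule arg_cong)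
      also have "\<dots> = 16 * t * (cmod (w $ j))\<^sup>2"
        using t by (simp add: power_mult_distrib)
      finally show "(cmod (?z $ j))\<^sup>2 = 16 * t * (cmod (w $ j))\<^sup>2" .
    qed
    also have "\<dots> = 16 * t * (\<Sum>j\<in>UNIV-{k}. (cmod (w $ j))\<^sup>2)"
      by (rule sum_distrib_left[symmetric])
    finally have "(\<Sum>j\<in>UNIV-{k}. (cmod (w $ j))\<^sup>2) < 1 / 4"
      using t by simp
    moreover have "(cmod (w $ k))\<^sup>2 \<le> (1 / 2)\<^sup>2"
      using wk by (intro power_mono) auto
    ultimately have "(norm w)\<^sup>2 < 1\<^sup>2"
      using norm_vec_power2_split[of w k] by (simp add: power2_eq_square)
    thus ?thesis by (rule power2_less_imp_less) simp
  qed
  have "(\<integral>\<^sup>+z. indicator ?S z \<partial>lborel) = ennreal ((4 * t)\<^sup>2 * (4 * sqrt t) ^ (2 * CARD('n) - 2)) *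
     (\<integral>\<^sup>+w. indicator ?S (axis k 1 + anisotropic k (4 * t) (4 * sqrt t) w) \<partial>lborel)"
    using t by (intro nn_integral_lborel_anisotropic) auto
  also have "\<dots> \<le> ennreal ((4 * t)\<^sup>2 * (4 * sqrt t) ^ (2 * CARD('n) - 2)) * (\<integral>\<^sup>+w. indicator (ball (0::complex^'n) 1) w \<partial>lborel)"
    using sub by (intro mult_left_mono nn_integral_mono) (auto simp: indicator_def)
  also have "(4 * t)\<^sup>2 * (4 * sqrt t) ^ (2 * CARD('n) - 2) = 16 * 16 ^ (CARD('n) - 1) * t ^ (CARD('n) + 1)"
    using anisotropic_det[of 4 4 t "CARD('n)"] t by simp
  finally show ?thesis by simp
qed

text \<open>A cap thickened inwards by t lies in the cap of the ball of twice the size, so t times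
  its measure is bounded by a volume of order t^(n+1).\<close>

lemma cap_measure:
  fixes k :: "'n::finite"
  obtains C where "C > 0" "\<And>t. t > 0 \<Longrightarrow>
    (\<integral>\<^sup>+z. indicator {z::complex^'n. cmod (1 - z $ k) < t} z \<partial>sph) \<le> ennreal (C * t ^ CARD('n))"
proof
  let ?n = "CARD('n)" and ?d = "DIM(complex^'n)" and ?v = "emeasure lborel (ball (0::complex^'n) 1)"
  \<comment> \<open>The first summand serves t \<ge> 1/2, where the total mass 1 is at most (2t)^n;
    the second serves small t, with \<open>2 powr (real ?d - 1)\<close> bounding the polar weight
    for |z| > 1/2.\<close>
  define C where "C = 2 ^ ?n + 2 powr (real ?d - 1) * 16 * 16 ^ (?n - 1)"
  show "C > 0" unfolding C_def by (intro add_pos_nonneg) auto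
  fix t :: real assume t: "t > 0"
  let ?E = "{z::complex^'n. cmod (1 - z $ k) < t}" and ?E2 = "{z::complex^'n. cmod (1 - z $ k) < 2 * t}"
  have [measurable]: "?E \<in> sets borel" "?E2 \<in> sets borel"
    by (intro borel_open open_Collect_less continuous_intros)+
  show "(\<integral>\<^sup>+z. indicator ?E z \<partial>sph) \<le> ennreal (C * t ^ ?n)"
  proof (cases "t < 1 / 2")
    case False
    have "(\<integral>\<^sup>+z. indicator ?E z \<partial>sph) \<le> (\<integral>\<^sup>+z. 1 \<partial>(sph :: (complex^'n) measure))"
      by (intro nn_integral_mono) (auto simp: indicator_def)
    also have "\<dots> = ennreal 1" by simp
    also have "\<dots> \<le> ennreal (C * t ^ ?n)"
    proof (rule ennreal_leI)
      have "1 \<le> (2 * t) ^ ?n" using False by (intro one_le_power) auto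
      also have "\<dots> \<le> C * t ^ ?n"
        using t unfolding C_def power_mult_distrib by (intro mult_right_mono) auto
      finally show "1 \<le> C * t ^ ?n" .
    qed
    finally show ?thesis .
  next
    case True
    let ?I = "\<integral>\<^sup>+z. indicator ?E z \<partial>(sph :: (complex^'n) measure)"
    have "ennreal t * ?I = (\<integral>\<^sup>+r. ?I * indicator {1 - t<..<1} r \<partial>lborel)"
      using t by (subst nn_integral_cmult) (auto simp: mult.commute)
    also have "\<dots> \<le> (\<integral>\<^sup>+r. (\<integral>\<^sup>+z. indicator ?E2 (r *\<^sub>R z) \<partial>(sph :: (complex^'n) measure)) * indicator {1 - t<..<1} r \<partial>lborel)"
    proof (rule nn_integral_mono)
      fix r :: real
      show "?I * indicator {1 - t<..<1} r \<le> (\<integral>\<^sup>+z. indicator ?E2 (r *\<^sub>R z) \<partial>(sph :: (complex^'n) measure)) * indicator {1 - t<..<1} r"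
      proof (cases "r \<in> {1 - t<..<1}")
        case r: True
        have "?I \<le> (\<integral>\<^sup>+z. indicator ?E2 (r *\<^sub>R z) \<partial>(sph :: (complex^'n) measure))"
        proof (rule nn_integral_sph_mono)
          fix z :: "complex^'n" assume elim: "norm z = 1"
          have zk: "cmod (z $ k) \<le> 1"
            using Finite_Cartesian_Product.norm_nth_le[of z k] elim by simp
          have "1 - (r *\<^sub>R z) $ k = (1 - z $ k) + of_real (1 - r) * z $ k"
            by (simp add: scaleR_conv_of_real[where 'a=complex] algebra_simps)
          hence "cmod (1 - (r *\<^sub>R z) $ k) \<le> cmod (1 - z $ k) + cmod (of_real (1 - r) * z $ k)"
            by (metis norm_triangle_ineq)
          also have "cmod (of_real (1 - r) * z $ k) \<le> 1 - r"
            using r zk mult_left_mono[of "cmod (z $ k)" 1 "1 - r"] by (simp add: norm_mult del: of_real_diff)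
          finally have "cmod (1 - z $ k) < t \<Longrightarrow> cmod (1 - (r *\<^sub>R z) $ k) < 2 * t"
            using r by simp
          thus "(indicator ?E z :: ennreal) \<le> indicator ?E2 (r *\<^sub>R z)" by (auto simp: indicator_def)
        qed
        thus ?thesis by (intro mult_right_mono) auto
      qed simp
    qed
    also have "\<dots> = (\<integral>\<^sup>+z. indicator ?E2 z * ennreal (norm z powr (1 - real ?d)) * indicator {z. 1 - t < norm z \<and> norm z < 1} z \<partial>lborel)
        / (?d * ?v)"
      using True by (intro nn_integral_sph_shell) auto
    also have "\<dots> \<le> (\<integral>\<^sup>+z. ennreal (2 powr (real ?d - 1)) * indicator {z. cmod (1 - z $ k) < 2 * t \<and> norm z < 1} z \<partial>lborel) / (?d * ?v)"
    proof (intro divide_right_mono_ennreal nn_integral_mono)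
      fix z :: "complex^'n"
      show "indicator ?E2 z * ennreal (norm z powr (1 - real ?d)) * indicator {z. 1 - t < norm z \<and> norm z < 1} z
         \<le> ennreal (2 powr (real ?d - 1)) * indicator {z. cmod (1 - z $ k) < 2 * t \<and> norm z < 1} z"
      proof (cases "1 - t < norm z \<and> norm z < 1 \<and> cmod (1 - z $ k) < 2 * t")
        case z: True
        have "1 - real ?d \<le> 0"
          using DIM_positive[where 'a="complex^'n"] by linarith
        hence "norm z powr (1 - real ?d) \<le> (1 / 2) powr (1 - real ?d)"
          using z True by (intro powr_mono2') auto
        also have "\<dots> = 2 powr (real ?d - 1)"
          by (simp add: powr_divide powr_minus[symmetric] powr_minus_divide[symmetric])
        finally show ?thesis using z by (simp add: ennreal_leI)
      next
        case False
        thus ?thesis by (auto simp: indicator_def)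
      qed
    qed
    also have "\<dots> = ennreal (2 powr (real ?d - 1)) * (\<integral>\<^sup>+z. indicator {z::complex^'n. cmod (1 - z $ k) < 2 * t \<and> norm z < 1} z \<partial>lborel) / (?d * ?v)"
    proof (subst nn_integral_cmult)
      have "{z::complex^'n. cmod (1 - z $ k) < 2 * t \<and> norm z < 1} \<in> sets borel"
        by (intro borel_open open_Collect_conj open_Collect_less continuous_intros)
      thus "indicator {z::complex^'n. cmod (1 - z $ k) < 2 * t \<and> norm z < 1} \<in> borel_measurable lborel"
        by simp
    qed simp
    also have "\<dots> \<le> ennreal (2 powr (real ?d - 1)) * (ennreal (16 * 16 ^ (?n - 1) * t ^ (?n + 1)) * ?v) / (?d * ?v)"
      using t True by (intro divide_right_mono_ennreal mult_left_mono cap_volume) auto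
    also have "\<dots> = ennreal (2 powr (real ?d - 1) * (16 * 16 ^ (?n - 1) * t ^ (?n + 1))) * ?v / (?d * ?v)"
      using t by (simp add: mult.assoc[symmetric] ennreal_mult[symmetric])
    also have "\<dots> = ennreal (2 powr (real ?d - 1) * (16 * 16 ^ (?n - 1) * t ^ (?n + 1))) / ?d"
      by (rule divide_mult_eq) (use emeasure_lborel_unit_ball[where 'a="complex^'n"] in auto)
    also have "\<dots> = ennreal (2 powr (real ?d - 1) * (16 * 16 ^ (?n - 1) * t ^ (?n + 1)) / real ?d)"
      using t DIM_positive[where 'a="complex^'n"]
      by (subst divide_ennreal[symmetric]) (auto simp: ennreal_of_nat_eq_real_of_nat)
    also have "\<dots> \<le> ennreal (2 powr (real ?d - 1) * (16 * 16 ^ (?n - 1) * t ^ (?n + 1)) / 1)"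
    proof (intro ennreal_leI divide_left_mono)
      show "1 \<le> real ?d" using DIM_positive[where 'a="complex^'n"] by linarith
      thus "0 < real ?d * 1" by linarith
    qed (use t in auto)
    also have "\<dots> = ennreal t * ennreal (2 powr (real ?d - 1) * 16 * 16 ^ (?n - 1) * t ^ ?n)"
      using t by (simp add: ennreal_mult[symmetric] mult_ac)
    finally have "ennreal t * ?I \<le> \<dots>" .
    hence "?I \<le> ennreal (2 powr (real ?d - 1) * 16 * 16 ^ (?n - 1) * t ^ ?n)"
      using t by (subst (asm) ennreal_mult_le_mult_iff) auto
    also have "\<dots> \<le> ennreal (C * t ^ ?n)"
      unfolding C_def using t by (intro ennreal_leI mult_right_mono) auto
    finally show ?thesis .
  qed
qed

text \<open>Layer-cake: the negative power is the integral of M t^(-M-1) over t above |1 - \<rho>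
  z_k|. The sublevel set is null for t \<le> 1 - \<rho> and otherwise lies in a cap of size 2t, of
  measure O(t^n); M > n makes the remaining integral converge at infinity.\<close>

lemma kernel_integral:
  fixes k :: "'n::finite"
  assumes M: "M > real CARD('n)"
  obtains C where "C > 0" "\<And>\<rho>. 0 \<le> \<rho> \<Longrightarrow> \<rho> < 1 \<Longrightarrow>
    (\<integral>\<^sup>+z. ennreal (cmod (1 - of_real \<rho> * (z::complex^'n) $ k) powr (- M)) \<partial>sph) \<le> ennreal (C * (1 - \<rho>) powr (real CARD('n) - M))"
proof -
  let ?n = "CARD('n)"
  obtain C0 where C0: "C0 > 0" "\<And>t. t > 0 \<Longrightarrow>
    (\<integral>\<^sup>+z. indicator {z::complex^'n. cmod (1 - z $ k) < t} z \<partial>sph) \<le> ennreal (C0 * t ^ ?n)"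
    using cap_measure[of k] by metis
  define C where "C = M * C0 * 2 ^ ?n / (M - real ?n)"
  have "C > 0" using C0 M unfolding C_def
    by (intro divide_pos_pos mult_pos_pos) auto
  moreover have "(\<integral>\<^sup>+z. ennreal (cmod (1 - of_real \<rho> * (z::complex^'n) $ k) powr (- M)) \<partial>sph) \<le> ennreal (C * (1 - \<rho>) powr (real ?n - M))"
    if \<rho>: "0 \<le> \<rho>" "\<rho> < 1" for \<rho>
  proof -
    let ?X = "\<lambda>z::complex^'n. cmod (1 - of_real \<rho> * z $ k)"
    have X: "1 - \<rho> \<le> ?X z" "cmod (1 - z $ k) \<le> ?X z + (1 - \<rho>)" if "norm z = 1" for z
    proof -
      have zk: "cmod (z $ k) \<le> 1"
        using Finite_Cartesian_Product.norm_nth_le[of z k] that by simp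
      have "\<rho> * cmod (z $ k) \<le> \<rho>" using zk \<rho> mult_left_mono[of "cmod (z $ k)" 1 \<rho>] by simp
      thus "1 - \<rho> \<le> ?X z"
        using norm_triangle_ineq2[of 1 "of_real \<rho> * z $ k"] \<rho> by (simp add: norm_mult)
      have "1 - z $ k = (1 - of_real \<rho> * z $ k) - of_real (1 - \<rho>) * z $ k"
        by (simp add: algebra_simps)
      hence "cmod (1 - z $ k) \<le> ?X z + cmod (of_real (1 - \<rho>) * z $ k)"
        by (metis norm_triangle_ineq4)
      also have "cmod (of_real (1 - \<rho>) * z $ k) \<le> 1 - \<rho>"
        using \<rho> zk mult_left_mono[of "cmod (z $ k)" 1 "1 - \<rho>"] by (simp add: norm_mult del: of_real_diff)
      finally show "cmod (1 - z $ k) \<le> ?X z + (1 - \<rho>)" by simp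
    qed
    have Xm[measurable]: "?X \<in> borel_measurable borel"
      by (intro borel_measurable_continuous_onI continuous_intros)
    have "(\<integral>\<^sup>+z. ennreal (?X z powr (- M)) \<partial>sph) =
       (\<integral>\<^sup>+z. \<integral>\<^sup>+t. ennreal M * (if ?X z < t then ennreal (t powr (- M - 1)) else 0) \<partial>lborel \<partial>sph)"
    proof (rule nn_integral_sph_cong)
      fix z :: "complex^'n" assume elim: "norm z = 1"
      have "?X z > 0" using X(1)[OF elim] \<rho> by linarith
      thus "ennreal (?X z powr (- M)) = (\<integral>\<^sup>+t. ennreal M * (if ?X z < t then ennreal (t powr (- M - 1)) else 0) \<partial>lborel)" using M
        by (subst nn_integral_cmult) (auto simp: nn_integral_powr_tail ennreal_mult[symmetric])
    qed
    also have "\<dots> = (\<integral>\<^sup>+t. \<integral>\<^sup>+z. ennreal M * (if ?X z < t then ennreal (t powr (- M - 1)) else 0) \<partial>sph \<partial>lborel)"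
      by (rule sph_lborel.Fubini'[symmetric]) measurable
    also have "\<dots> \<le> (\<integral>\<^sup>+t. ennreal (M * C0 * 2 ^ ?n) * (if 1 - \<rho> < t then ennreal (t powr (- (M - real ?n) - 1)) else 0) \<partial>lborel)"
    proof (rule nn_integral_mono)
      fix t :: real
      show "(\<integral>\<^sup>+z. ennreal M * (if ?X z < t then ennreal (t powr (- M - 1)) else 0) \<partial>sph) \<le>
         ennreal (M * C0 * 2 ^ ?n) * (if 1 - \<rho> < t then ennreal (t powr (- (M - real ?n) - 1)) else 0)"
      proof (cases "1 - \<rho> < t")
        case False
        have "(\<integral>\<^sup>+z. ennreal M * (if ?X z < t then ennreal (t powr (- M - 1)) else 0) \<partial>sph) = (\<integral>\<^sup>+z. 0 \<partial>(sph :: (complex^'n) measure))"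
        proof (rule nn_integral_sph_cong)
          fix z :: "complex^'n" assume elim: "norm z = 1"
          hence "\<not> ?X z < t" using X(1)[of z] False by auto
          thus "ennreal M * (if ?X z < t then ennreal (t powr (- M - 1)) else 0) = 0" by simp
        qed
        thus ?thesis by simp
      next
        case True
        hence t: "t > 0" using \<rho> by linarith
        have [measurable]: "{z::complex^'n. cmod (1 - z $ k) < 2 * t} \<in> sets borel"
          by (intro borel_open open_Collect_less continuous_intros)
        have "(\<integral>\<^sup>+z. ennreal M * (if ?X z < t then ennreal (t powr (- M - 1)) else 0) \<partial>sph) \<le>
          (\<integral>\<^sup>+z. ennreal (M * t powr (- M - 1)) * indicator {z::complex^'n. cmod (1 - z $ k) < 2 * t} z \<partial>sph)"
        proof (rule nn_integral_sph_mono)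
          fix z :: "complex^'n" assume elim: "norm z = 1"
          hence "?X z < t \<Longrightarrow> cmod (1 - z $ k) < 2 * t" using X(2)[of z] True by auto
          thus "ennreal M * (if ?X z < t then ennreal (t powr (- M - 1)) else 0) \<le> ennreal (M * t powr (- M - 1)) * indicator {z::complex^'n. cmod (1 - z $ k) < 2 * t} z" using M by (simp add: ennreal_mult)
        qed
        also have "\<dots> = ennreal (M * t powr (- M - 1)) * (\<integral>\<^sup>+z. indicator {z::complex^'n. cmod (1 - z $ k) < 2 * t} z \<partial>sph)"
          by (rule nn_integral_cmult) simp
        also have "\<dots> \<le> ennreal (M * t powr (- M - 1)) * ennreal (C0 * (2 * t) ^ ?n)"
          using t by (intro mult_left_mono C0) auto
        also have "\<dots> = ennreal (M * C0 * 2 ^ ?n) * ennreal (t powr (- M - 1) * t ^ ?n)"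
          using t M C0 by (simp add: ennreal_mult[symmetric] power_mult_distrib mult_ac)
        also have "t powr (- M - 1) * t ^ ?n = t powr (- (M - real ?n) - 1)"
          using t by (simp add: powr_realpow[symmetric] powr_add[symmetric]) (simp add: algebra_simps)
        finally show ?thesis using True by simp
      qed
    qed
    also have "\<dots> = ennreal (M * C0 * 2 ^ ?n) * ennreal ((1 - \<rho>) powr (- (M - real ?n)) / (M - real ?n))"
      using M \<rho> by (subst nn_integral_cmult) (simp_all add: nn_integral_powr_tail)
    also have "\<dots> = ennreal (C * (1 - \<rho>) powr (real ?n - M))"
      using M C0 by (simp add: C_def ennreal_mult[symmetric])
    finally show ?thesis .
  qed
  ultimately show ?thesis by (rule that)
qed

lemma holomorphic_several_inverse:
  assumes f: "holomorphic_several f S" and nz: "\<And>z. z \<in> S \<Longrightarrow> f z \<noteq> 0"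
  shows "holomorphic_several (\<lambda>z. inverse (f z)) S"
proof (rule holomorphic_severalI[where D="\<lambda>z v. - (inverse (f z) * cderiv f z v * inverse (f z))"])
  fix z c v assume z: "z \<in> S"
  show "((\<lambda>z. inverse (f z)) has_derivative (\<lambda>v. - (inverse (f z) * cderiv f z v * inverse (f z)))) (at z)"
    using Deriv.has_derivative_inverse[OF nz[OF z] has_derivative_cderiv[OF f z]] .
  show "- (inverse (f z) * cderiv f z (c *s v) * inverse (f z)) = c * - (inverse (f z) * cderiv f z v * inverse (f z))"
    by (simp add: cderiv_scale[OF f z])
qed

text \<open>Negative integer powers of 1 - |a| z_k, rotated so that the peak points towards a. The
  factor 2 in the lower bound comes from 1 - |a|^2 \<le> 2 (1 - |a|).\<close>

lemma test_function:
  assumes p: "p > 0" and N: "real N * p > real CARD('n::finite)"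
  obtains C where "C > 0" "\<And>a::complex^'n. norm a < 1 \<Longrightarrow>
    \<exists>f. holomorphic_several f (ball 0 1) \<and>
      hardy_integral p f \<le> ennreal (C * (1 - norm a) powr (real CARD('n) - real N * p)) \<and>
      (2 * (1 - norm a)) powr (- real N) \<le> cmod (f a)"
proof -
  obtain k :: 'n where True by blast
  obtain C where C: "C > 0" "\<And>\<rho>. 0 \<le> \<rho> \<Longrightarrow> \<rho> < 1 \<Longrightarrow>
    (\<integral>\<^sup>+z. ennreal (cmod (1 - of_real \<rho> * (z::complex^'n) $ k) powr (- (real N * p))) \<partial>sph)
      \<le> ennreal (C * (1 - \<rho>) powr (real CARD('n) - real N * p))"
    using kernel_integral[OF N, of k] by metis
  have "\<exists>f. holomorphic_several f (ball 0 1) \<and>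
      hardy_integral p f \<le> ennreal (C * (1 - norm a) powr (real CARD('n) - real N * p)) \<and>
      (2 * (1 - norm a)) powr (- real N) \<le> cmod (f a)" if a: "norm a < 1" for a :: "complex^'n"
  proof -
    define h where "h z = inverse (1 - of_real (norm a) * z $ k) ^ N" for z :: "complex^'n"
    have nz: "1 - of_real (norm a) * z $ k \<noteq> 0" if "norm z < 1" for z :: "complex^'n"
    proof -
      have "cmod (z $ k) < 1"
        using Finite_Cartesian_Product.norm_nth_le[of z k] that by simp
      hence "cmod (of_real (norm a) * z $ k) < 1"
        using a mult_strict_mono[of "norm a" 1 "cmod (z $ k)" 1] by (simp add: norm_mult)
      thus ?thesis by auto
    qed
    have "holomorphic_several (\<lambda>z::complex^'n. 1 + (- of_real (norm a)) * z $ k) (ball 0 1)"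
      by (intro holomorphic_several_add holomorphic_several_mult holomorphic_several_const holomorphic_several_component)
    hence h: "holomorphic_several h (ball 0 1)"
      unfolding h_def using nz by (intro holomorphic_several_power holomorphic_several_inverse) auto
    have H: "hardy_integral p h \<le> ennreal (C * (1 - norm a) powr (real CARD('n) - real N * p))"
    proof (rule hardy_integral_leI[OF h])
      fix r :: real assume r: "0 < r" "r < 1"
      define \<rho> where "\<rho> = norm a * r"
      have \<rho>: "0 \<le> \<rho>" "\<rho> < 1" "\<rho> \<le> norm a"
        using a r mult_left_mono[of r 1 "norm a"] by (auto simp: \<rho>_def)
      have "integral_mean p h r = (\<integral>\<^sup>+z. ennreal (cmod (1 - of_real \<rho> * (z::complex^'n) $ k) powr (- (real N * p))) \<partial>sph)"
        unfolding integral_mean_def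
      proof (rule nn_integral_sph_cong)
        fix z :: "complex^'n" assume elim: "norm z = 1"
        have "norm (r *\<^sub>R z) < 1" using elim r by simp
        moreover from nz[OF this] have pos: "cmod (1 - of_real \<rho> * z $ k) > 0"
          by (simp add: \<rho>_def scaleR_conv_of_real[where 'a=complex] mult.assoc)
        ultimately have "cmod (ball_ext h (r *\<^sub>R z)) = inverse (cmod (1 - of_real \<rho> * z $ k)) ^ N"
          by (simp add: ball_ext_eq h_def norm_power norm_inverse \<rho>_def scaleR_conv_of_real[where 'a=complex] mult.assoc)
        also have "\<dots> = cmod (1 - of_real \<rho> * z $ k) powr (- real N)"
          using pos by (simp add: powr_minus powr_realpow power_inverse)
        finally show "ennreal (cmod (ball_ext h (r *\<^sub>R z)) powr p) = ennreal (cmod (1 - of_real \<rho> * (z::complex^'n) $ k) powr (- (real N * p)))" by (simp add: powr_powr)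
      qed
      also have "\<dots> \<le> ennreal (C * (1 - \<rho>) powr (real CARD('n) - real N * p))"
        by (rule C(2)[OF \<rho>(1,2)])
      \<comment> \<open>The exponent is negative by \<open>N\<close>, so replacing 1 - \<rho> by the
        smaller 1 - |a| gives a bound uniform in r.\<close>
      also have "\<dots> \<le> ennreal (C * (1 - norm a) powr (real CARD('n) - real N * p))"
        using C(1) \<rho> a N by (intro ennreal_leI mult_left_mono powr_mono2') auto
      finally show "integral_mean p h r \<le> \<dots>" .
    qed
    obtain V where V: "linear V" "\<And>c x. V (c *s x) = c *s V x" "\<And>x. norm (V x) = norm x"
        "V a = norm a *\<^sub>R axis k 1"
      using exists_unitary[of a "norm a *\<^sub>R axis k 1"] by auto
    note hV = hardy_integral_unitary[OF h V(1-3)]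
    have "cmod (h (V a)) = inverse (1 - (norm a)\<^sup>2) ^ N"
    proof -
      have "1 - of_real (norm a) * (norm a *\<^sub>R axis k 1 :: complex^'n) $ k = of_real (1 - (norm a)\<^sup>2)"
        by (simp add: axis_def scaleR_conv_of_real[where 'a=complex] power2_eq_square)
      hence "cmod (h (V a)) = \<bar>inverse (1 - (norm a)\<^sup>2) ^ N\<bar>"
        by (simp only: h_def V(4) norm_power norm_inverse norm_of_real power_abs abs_inverse)
      moreover have "0 \<le> 1 - (norm a)\<^sup>2" using a by (simp add: power_le_one)
      ultimately show ?thesis by simp
    qed
    also have "\<dots> \<ge> inverse (2 * (1 - norm a)) ^ N"
    proof (intro power_mono le_imp_inverse_le)
      show "0 < 1 - (norm a)\<^sup>2" using a by (simp add: abs_square_less_1)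
      have "1 - (norm a)\<^sup>2 = (1 + norm a) * (1 - norm a)"
        by (simp add: power2_eq_square algebra_simps)
      also have "\<dots> \<le> 2 * (1 - norm a)"
        using a by (intro mult_right_mono) auto
      finally show "1 - (norm a)\<^sup>2 \<le> 2 * (1 - norm a)" .
    qed (use a in auto)
    finally have "(2 * (1 - norm a)) powr (- real N) \<le> cmod (h (V a))"
      using a by (simp add: powr_minus powr_realpow power_inverse)
    thus ?thesis
      using hV(1) H by (intro exI[of _ "\<lambda>z. h (V z)"]) (simp add: hV(2))
  qed
  with C(1) show ?thesis by (rule that)
qed

section \<open>Necessity\<close>

lemma hardy_norm_le_iff:
  assumes p: "p > 0" and K: "K \<ge> 0"
  shows "hardy_norm p f \<le> ennreal K \<longleftrightarrow> hardy_integral p f \<le> ennreal (K powr p)"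
proof (cases "hardy_integral p f")
  case (real h)
  have "h powr (1 / p) \<le> K \<longleftrightarrow> h \<le> K powr p"
  proof
    assume "h powr (1 / p) \<le> K"
    hence "(h powr (1 / p)) powr p \<le> K powr p" using p by (intro powr_mono2) auto
    thus "h \<le> K powr p" using p real by (simp add: powr_powr)
  next
    assume "h \<le> K powr p"
    hence "h powr (1 / p) \<le> (K powr p) powr (1 / p)" using p real by (intro powr_mono2) auto
    thus "h powr (1 / p) \<le> K" using p K by (simp add: powr_powr)
  qed
  thus ?thesis using real K by (simp add: hardy_norm_def)
qed (simp add: hardy_norm_def top_unique)

lemma hardy_integral_cmult_le:
  assumes f: "holomorphic_several f (ball 0 1)"
  shows "hardy_integral p (\<lambda>z. c * f z) \<le> ennreal (cmod c powr p) * hardy_integral p f"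
proof (rule hardy_integral_leI)
  show "holomorphic_several (\<lambda>z. c * f z) (ball 0 1)"
    by (intro holomorphic_several_mult holomorphic_several_const f)
  fix r :: real assume r: "0 < r" "r < 1"
  have "integral_mean p (\<lambda>z. c * f z) r = ennreal (cmod c powr p) * integral_mean p f r"
  proof -
    note [measurable] = ball_ext_measurable[OF f]
    have "ball_ext (\<lambda>z. c * f z) z = c * ball_ext f z" for z
      by (simp add: ball_ext_def)
    hence "ennreal (cmod (ball_ext (\<lambda>z. c * f z) z) powr p) =
        ennreal (cmod c powr p) * ennreal (cmod (ball_ext f z) powr p)" for z
      by (simp only: norm_mult powr_mult ennreal_mult powr_ge_zero)
    thus ?thesis unfolding integral_mean_def by (simp only:) (rule nn_integral_cmult, measurable)
  qed
  also have "\<dots> \<le> ennreal (cmod c powr p) * hardy_integral p f"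
    by (intro mult_left_mono integral_mean_le f r) simp
  finally show "integral_mean p (\<lambda>z. c * f z) r \<le> \<dots>" .
qed

lemma hardy_integral_J_op_le:
  assumes F: "holomorphic_several F (ball 0 1)" "hardy_integral p F \<le> 1"
    and J: "J_norm p q g \<le> ennreal K" and p: "p > 0" and q: "q > 0" and K: "K \<ge> 0"
  shows "hardy_integral q (J_op g F) \<le> ennreal (K powr q)"
proof -
  have "hardy_norm p F \<le> ennreal 1"
    using F p by (subst hardy_norm_le_iff) auto
  moreover have "hardy_integral p F < \<infinity>"
    using F(2) by (rule order.strict_trans1) simp
  ultimately have "F \<in> {f \<in> hardy_space p. hardy_norm p f \<le> 1}"
    using F by (simp add: hardy_space_def)
  hence "hardy_norm q (J_op g F) \<le> J_norm p q g"
    unfolding J_norm_def by (rule SUP_upper)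
  also note J
  finally show ?thesis using q K by (simp add: hardy_norm_le_iff)
qed

text \<open>The test function normalized in H^p is at least of size \<delta>^(-n/p) at a, while its
  image grows at most like K \<delta>^(-n/q) near a. A Cauchy estimate on a circle of radius
  \<delta>/2 costs one more factor 1/\<delta>, and \<open>J_op_slice\<close> identifies the
  derivative with F(a) Rg(a). Both \<alpha> \<le> 1 and \<alpha> > 1 rely on this bound.\<close>

lemma radial_deriv_bound:
  assumes p: "0 < p" "p < q" and \<alpha>: "\<alpha> = real CARD('n::finite) * (1 / p - 1 / q)"
  shows "\<exists>C>0. \<forall>(g :: complex^'n \<Rightarrow> complex) K a. holomorphic_several g (ball 0 1) \<longrightarrow> 0 \<le> K \<longrightarrow>
    J_norm p q g \<le> ennreal K \<longrightarrow> norm a < 1 \<longrightarrow>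
    cmod (radial_deriv g a) \<le> C * K * (1 - norm a) powr (\<alpha> - 1)"
proof -
  let ?n = "real CARD('n)" and ?P = "pointwise_const CARD('n)"
  have q: "q > 0" using p by simp
  obtain N :: nat where "?n / p < real N" using reals_Archimedean2 by blast
  hence N: "real N * p > ?n" using p by (simp add: field_simps)
  obtain C1 where C1: "C1 > 0" "\<And>a::complex^'n. norm a < 1 \<Longrightarrow>
    \<exists>f. holomorphic_several f (ball 0 1) \<and>
      hardy_integral p f \<le> ennreal (C1 * (1 - norm a) powr (?n - real N * p)) \<and>
      (2 * (1 - norm a)) powr (- real N) \<le> cmod (f a)"
    by (rule test_function[OF p(1) N], rule that)
  define C where "C = ?P powr (1 / q) * 2 powr (?n / q + 1) * 2 powr N * C1 powr (1 / p)"
  have C: "C > 0"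
    using C1 pointwise_const_pos[of "CARD('n)"] by (simp add: C_def)
  moreover have "cmod (radial_deriv g a) \<le> C * K * (1 - norm a) powr (\<alpha> - 1)"
    if g: "holomorphic_several g (ball 0 1)" and K: "0 \<le> K" "J_norm p q g \<le> ennreal K" and a: "norm a < 1"
    for g :: "complex^'n \<Rightarrow> complex" and K a
  proof -
    define \<delta> where "\<delta> = 1 - norm a"
    have \<delta>: "0 < \<delta>" using a by (simp add: \<delta>_def)
    obtain f where f: "holomorphic_several f (ball 0 1)"
      "hardy_integral p f \<le> ennreal (C1 * \<delta> powr (?n - real N * p))"
      "(2 * \<delta>) powr (- real N) \<le> cmod (f a)"
      using C1(2)[OF a] by (auto simp: \<delta>_def)
    \<comment> \<open>The p-th root of the bound for \<open>hardy_integral p f\<close>; dividing by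
      it puts F into the unit ball of H^p.\<close>
    define \<kappa> where "\<kappa> = (C1 * \<delta> powr (?n - real N * p)) powr (1 / p)"
    have \<kappa>: "\<kappa> > 0" using C1 \<delta> by (simp add: \<kappa>_def)
    have \<kappa>_eq: "\<kappa> = C1 powr (1 / p) * \<delta> powr (?n / p - N)"
      using C1 p by (simp add: \<kappa>_def powr_mult powr_powr diff_divide_distrib)
    have \<kappa>p: "\<kappa> powr p = C1 * \<delta> powr (?n - real N * p)"
      using p C1 by (simp add: \<kappa>_def powr_powr)
    define F where "F z = of_real (1 / \<kappa>) * f z" for z
    have F: "holomorphic_several F (ball 0 1)"
      unfolding F_def by (intro holomorphic_several_mult holomorphic_several_const f)
    have "hardy_integral p F \<le> ennreal (cmod (of_real (1 / \<kappa>)) powr p) * hardy_integral p f"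
      unfolding F_def by (rule hardy_integral_cmult_le[OF f(1)])
    also have "\<dots> \<le> ennreal (cmod (of_real (1 / \<kappa>)) powr p) * ennreal (\<kappa> powr p)"
      using f(2) unfolding \<kappa>p by (rule mult_left_mono) simp
    also have "\<dots> = 1"
      using \<kappa> by (simp add: ennreal_mult[symmetric] powr_mult[symmetric] norm_divide)
    finally have F1: "hardy_integral p F \<le> 1" .
    define h where "h = J_op g F"
    have h: "holomorphic_several h (ball 0 1)"
      unfolding h_def by (rule holomorphic_several_J_op[OF F g])
    have hq: "hardy_integral q h \<le> ennreal (K powr q)"
      unfolding h_def by (rule hardy_integral_J_op_le[OF F F1 K(2) p(1) q K(1)])
    \<comment> \<open>With this radius (1 + s) |a| \<le> |a| + s = 1 - s, so the slice over the disc
      around \<mu> = 1 stays at distance at least s from the sphere.\<close>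
    define s where "s = \<delta> / 2"
    have s: "s > 0" using \<delta> by (simp add: s_def)
    define B where "B = ?P powr (1 / q) * K * s powr (- ?n / q)"
    have in_ball: "norm (\<mu> *s a) \<le> 1 - s" if "\<mu> \<in> cball 1 s" for \<mu>
    proof -
      have "cmod \<mu> \<le> 1 + s"
        using that norm_triangle_ineq2[of \<mu> 1] by (simp add: dist_norm norm_minus_commute)
      hence "cmod \<mu> * norm a \<le> (1 + s) * norm a" by (intro mult_right_mono) auto
      also have "\<dots> \<le> norm a + s"
        using s a mult_left_mono[of "norm a" 1 s] by (simp add: algebra_simps)
      also have "\<dots> = 1 - s" by (simp add: s_def \<delta>_def field_simps)
      finally show ?thesis by (simp add: norm_vector_scalar_mult)
    qed
    have bound: "cmod (h (\<mu> *s a)) \<le> B" if "\<mu> \<in> cball 1 s" for \<mu>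
    proof -
      have "cmod (h (\<mu> *s a)) \<le> (?P * (K powr q)) powr (1 / q) * (1 - norm (\<mu> *s a)) powr (- ?n / q)"
        using in_ball[OF that] s by (intro pointwise_estimate' h q hq) auto
      also have "(?P * (K powr q)) powr (1 / q) = ?P powr (1 / q) * K"
        using q K pointwise_const_pos[of "CARD('n)"] by (simp add: powr_mult powr_powr)
      also have "(1 - norm (\<mu> *s a)) powr (- ?n / q) \<le> s powr (- ?n / q)"
        using in_ball[OF that] s q by (intro powr_mono2') auto
      finally show ?thesis using K by (simp add: B_def mult_left_mono)
    qed
    have hol: "(\<lambda>\<mu>. h (\<mu> *s a)) holomorphic_on cball 1 s"
      using slice_holomorphic_on[OF h, of "cball 1 s" 0 a] in_ball s by fastforce
    have "norm ((deriv ^^ 1) (\<lambda>\<mu>. h (\<mu> *s a)) 1) \<le> fact 1 * B / s ^ 1"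
    proof (rule Cauchy_inequality)
      show "(\<lambda>\<mu>. h (\<mu> *s a)) holomorphic_on ball 1 s"
        using hol by (rule holomorphic_on_subset) auto
      show "continuous_on (cball 1 s) (\<lambda>\<mu>. h (\<mu> *s a))"
        using hol by (rule holomorphic_on_imp_continuous_on)
      show "cmod (h (\<mu> *s a)) \<le> B" if "cmod (1 - \<mu>) = s" for \<mu>
        using that by (intro bound) (simp add: dist_norm)
    qed (rule s)
    moreover have "deriv (\<lambda>\<mu>. h (\<mu> *s a)) 1 = F a * radial_deriv g a"
      unfolding h_def using a by (intro DERIV_imp_deriv J_op_slice F g) simp
    ultimately have main: "cmod (F a) * cmod (radial_deriv g a) \<le> B / s"
      by (simp add: norm_mult)
    have "(2 * \<delta>) powr (- real N) * (1 / \<kappa>) \<le> cmod (F a)"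
      using f(3) \<kappa> by (simp add: F_def norm_mult norm_divide divide_right_mono)
    hence "(2 * \<delta>) powr (- real N) * (1 / \<kappa>) * cmod (radial_deriv g a) \<le> B / s"
      using main by (meson mult_right_mono norm_ge_zero order_trans)
    hence "(2 * \<delta>) powr (real N) * \<kappa> * ((2 * \<delta>) powr (- real N) * (1 / \<kappa>) * cmod (radial_deriv g a)) \<le> (2 * \<delta>) powr (real N) * \<kappa> * (B / s)"
      using \<kappa> by (intro mult_left_mono) auto
    moreover have "(2 * \<delta>) powr (real N) * (2 * \<delta>) powr (- real N) = 1"
      using \<delta> by (simp add: powr_minus)
    hence "(2 * \<delta>) powr (real N) * \<kappa> * ((2 * \<delta>) powr (- real N) * (1 / \<kappa>) * cmod (radial_deriv g a)) = cmod (radial_deriv g a)"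
      using \<kappa> by simp
    ultimately have le: "cmod (radial_deriv g a) \<le> (2 * \<delta>) powr (real N) * \<kappa> * (B / s)" by simp
    have e1: "B / s = ?P powr (1 / q) * K * (\<delta> powr (- ?n / q - 1) * 2 powr (?n / q + 1))"
    proof -
      have "s powr (- ?n / q) / s = s powr (- ?n / q - 1)"
        using s by (simp add: powr_diff)
      moreover have "s powr (- ?n / q - 1) = \<delta> powr (- ?n / q - 1) * (1 / 2) powr (- ?n / q - 1)"
        using \<delta> powr_mult[of \<delta> "1/2"] by (simp add: s_def)
      moreover have "(1 / 2 :: real) powr (- ?n / q - 1) = 2 powr (- (- ?n / q - 1))"
        by (simp only: powr_divide powr_one_eq_one powr_minus_divide)
      moreover have "- (- ?n / q - 1) = ?n / q + 1" by simp
      ultimately have "s powr (- ?n / q) / s = \<delta> powr (- ?n / q - 1) * 2 powr (?n / q + 1)"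
        by (simp only:)
      thus ?thesis unfolding B_def by (simp only: times_divide_eq_right[symmetric])
    qed
    have e2: "(2 * \<delta>) powr (real N) = 2 powr (real N) * \<delta> powr (real N)"
      by (rule powr_mult)
    \<comment> \<open>The exponents add up to n/p - n/q - 1, from which N has cancelled.\<close>
    have e3: "\<delta> powr N * (\<delta> powr (?n / p - N) * \<delta> powr (- ?n / q - 1)) = \<delta> powr (\<alpha> - 1)"
      by (simp add: powr_add[symmetric] \<alpha> algebra_simps)
    have "(2 * \<delta>) powr (real N) * \<kappa> * (B / s) = C * K * (\<delta> powr N * (\<delta> powr (?n / p - N) * \<delta> powr (- ?n / q - 1)))"
      unfolding e1 e2 \<kappa>_eq C_def by (simp only: mult_ac)
    with le show ?thesis unfolding e3 by (simp only: \<delta>_def)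
  qed
  ultimately show ?thesis by blast
qed

section \<open>Vanishing radial derivative and constant functions\<close>

lemma holomorphic_several_radial_deriv:
  assumes g: "holomorphic_several g (ball 0 1)"
  shows "holomorphic_several (radial_deriv g) (ball 0 1)"
proof (rule holomorphic_several_cong)
  show "holomorphic_several (\<lambda>z. \<Sum>k\<in>UNIV. z $ k * cderiv g z (axis k 1)) (ball 0 1)"
    by (intro holomorphic_several_sum holomorphic_several_mult holomorphic_several_component
        holomorphic_several_cderiv g) auto
  show "radial_deriv g z = (\<Sum>k\<in>UNIV. z $ k * cderiv g z (axis k 1))" if "z \<in> ball 0 1" for z
    using that by (simp add: radial_deriv_def complex_partial_eq_cderiv[OF g])
qed simp

lemma radial_deriv_0: "holomorphic_several g (ball 0 1) \<Longrightarrow> radial_deriv g 0 = 0"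
  by (simp add: radial_deriv_def)

text \<open>Maximum principle on the slice through z: the disc of radius r / |z| contains 1, and its
  boundary is mapped into the sphere of radius r, where the bound is B (1 - r)^c. This tends to 0 as
  r tends to 1.\<close>

lemma radial_deriv_eq_0I:
  assumes g: "holomorphic_several g (ball 0 1)" and c: "c > 0" and z: "norm z < 1"
    and bound: "\<And>a. norm a < 1 \<Longrightarrow> cmod (radial_deriv g a) \<le> B * (1 - norm a) powr c"
  shows "radial_deriv g z = 0"
proof (cases "z = 0")
  case True
  thus ?thesis by (simp add: radial_deriv_0[OF g])
next
  case False
  have le: "cmod (radial_deriv g z) \<le> B * (1 - r) powr c" if r: "norm z < r" "r < 1" for r
  proof -
    let ?S = "cball (0::complex) (r / norm z)"
    have pos: "0 < norm z" using False by simp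
    have r0: "0 < r" using r pos by linarith
    have "(\<lambda>w. radial_deriv g (0 + w *s z)) holomorphic_on ?S"
    proof (rule slice_holomorphic_on[OF holomorphic_several_radial_deriv[OF g]])
      fix w assume "w \<in> ?S"
      hence "cmod w * norm z \<le> r" using pos by (simp add: field_simps)
      thus "0 + w *s z \<in> ball 0 1" using r by (simp add: norm_vector_scalar_mult)
    qed
    hence hol: "(\<lambda>w. radial_deriv g (w *s z)) holomorphic_on ?S" by simp
    have "cmod (radial_deriv g (1 *s z)) \<le> B * (1 - r) powr c"
    proof (rule maximum_modulus_frontier[where S="?S" and f="\<lambda>w. radial_deriv g (w *s z)"])
      show "(\<lambda>w. radial_deriv g (w *s z)) holomorphic_on interior ?S"
        using hol by (rule holomorphic_on_subset) (rule interior_subset)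
      show "continuous_on (closure ?S) (\<lambda>w. radial_deriv g (w *s z))"
        using holomorphic_on_imp_continuous_on[OF hol] by simp
      show "1 \<in> ?S" using r pos by simp
      show "cmod (radial_deriv g (w *s z)) \<le> B * (1 - r) powr c" if "w \<in> frontier ?S" for w
      proof -
        have "norm (w *s z) = r"
          using that pos r0 by (simp add: norm_vector_scalar_mult)
        thus ?thesis using bound[of "w *s z"] r by simp
      qed
    qed simp
    thus ?thesis by simp
  qed
  have "((\<lambda>r. B * (1 - r) powr c) \<longlongrightarrow> B * (1 - 1) powr c) (at_left 1)"
    using c by (intro tendsto_intros) (auto simp: eventually_at_left_field intro!: exI[of _ 0])
  moreover have "eventually (\<lambda>r. cmod (radial_deriv g z) \<le> B * (1 - r) powr c) (at_left 1)"
    using le z by (intro eventually_at_leftI[of "norm z"]) auto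
  ultimately have "cmod (radial_deriv g z) \<le> B * (1 - 1) powr c"
    by (intro tendsto_lowerbound) auto
  thus ?thesis using c by simp
qed

lemma constant_of_radial_deriv_eq_0:
  assumes g: "holomorphic_several g (ball 0 1)" and R: "\<And>z. z \<in> ball 0 1 \<Longrightarrow> radial_deriv g z = 0"
    and z: "z \<in> ball 0 1"
  shows "g z = g 0"
proof -
  define W where "W = {w::complex. w *s z \<in> ball 0 1}"
  have W_eq: "W = (\<lambda>w. w *s z) -` ball 0 1" by (auto simp: W_def)
  have "open W" unfolding W_eq
    by (rule open_vimage) (auto intro!: continuous_intros)
  have "convex W" unfolding W_eq
    by (rule convex_linear_vimage[OF linear_vector_scalar_mult_left]) simp
  have W: "0 \<in> W" "1 \<in> W" using z by (auto simp: W_def)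
  have "(\<lambda>w. g (0 + w *s z)) holomorphic_on W"
    by (rule slice_holomorphic_on[OF g]) (simp add: W_def)
  hence cont: "continuous_on W (\<lambda>w. g (w *s z))"
    by (intro holomorphic_on_imp_continuous_on) simp
  \<comment> \<open>The hypothesis says that w times the slice derivative is 0, which gives no
    information at w = 0; that point is treated as exceptional and bridged by continuity.\<close>
  obtain c where "\<And>w. w \<in> W \<Longrightarrow> g (w *s z) = c"
  proof (rule DERIV_zero_connected_constant[OF convex_connected[OF \<open>convex W\<close>] \<open>open W\<close> _ cont, of "{0}"])
    show "\<forall>w\<in>W - {0}. ((\<lambda>w. g (w *s z)) has_field_derivative 0) (at w)"
    proof
      fix w assume w: "w \<in> W - {0}"
      hence wz: "w *s z \<in> ball 0 1" by (auto simp: W_def)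
      have "w * cderiv g (w *s z) z = radial_deriv g (w *s z)"
        by (simp only: radial_deriv_eq_cderiv[OF g wz] cderiv_scale[OF g wz])
      hence "cderiv g (w *s z) z = 0" using R[OF wz] w by simp
      thus "((\<lambda>w. g (w *s z)) has_field_derivative 0) (at w)"
        using slice_has_field_derivative[OF g, of 0 w z] wz by simp
    qed
  qed auto
  from this[OF W(1)] this[OF W(2)] show ?thesis by simp
qed

lemma J_op_constant:
  fixes g :: "complex^'n \<Rightarrow> complex"
  assumes g: "holomorphic_several g (ball 0 1)" and c: "\<And>z. z \<in> ball 0 1 \<Longrightarrow> g z = c" and z: "z \<in> ball 0 1"
  shows "J_op g f z = 0"
proof -
  have "cderiv g x v = 0" if "x \<in> ball 0 1" for x v
  proof -
    have "(g has_derivative (\<lambda>_. 0)) (at x)"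
      by (rule has_derivative_transform_within_open[OF has_derivative_const open_ball that]) (simp add: c)
    hence "cderiv g x = (\<lambda>_. 0)"
      unfolding cderiv_def by (metis frechet_derivative_at)
    thus ?thesis by simp
  qed
  hence "cderiv g (t *\<^sub>R z) z = 0" if "t \<in> {0..1}" for t
    using scaleR_in_unit_ball[OF z that] by blast
  hence "J_op g f z = integral {0..1} (\<lambda>t::real. 0)"
    unfolding J_op_eq[OF g z] by (intro integral_cong) auto
  thus ?thesis by simp
qed

lemma hardy_integral_0:
  assumes "holomorphic_several f (ball 0 1)" "\<And>z. z \<in> ball 0 1 \<Longrightarrow> f z = 0"
  shows "hardy_integral p f = 0"
proof -
  have "ball_ext f z = 0" for z
    using assms(2)[of z] by (simp add: ball_ext_def indicator_def)
  hence "hardy_integral p f \<le> 0"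
    by (intro hardy_integral_leI assms(1)) (simp add: integral_mean_def)
  thus ?thesis by simp
qed

lemma constant_in_hardy_space:
  assumes "p > 0"
  shows "(\<lambda>_::complex^'n. 1) \<in> hardy_space p"
proof -
  have h: "holomorphic_several (\<lambda>_::complex^'n. 1) (ball 0 1)" by (rule holomorphic_several_const)
  have "hardy_integral p (\<lambda>_::complex^'n. 1) \<le> 1"
  proof (rule hardy_integral_leI[OF h])
    fix r :: real
    have "cmod (ball_ext (\<lambda>_::complex^'n. 1) z) powr p \<le> 1" for z
      using assms by (cases "norm z < 1") (simp_all add: ball_ext_eq ball_ext_eq_0)
    hence "integral_mean p (\<lambda>_::complex^'n. 1) r \<le> (\<integral>\<^sup>+z. 1 \<partial>(sph :: (complex^'n) measure))"
      unfolding integral_mean_def using ennreal_leI by (intro nn_integral_mono) fastforce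
    thus "integral_mean p (\<lambda>_::complex^'n. 1) r \<le> 1" by simp
  qed
  hence "hardy_integral p (\<lambda>_::complex^'n. 1) < \<infinity>"
    by (rule order.strict_trans1) simp
  thus ?thesis using h by (simp add: hardy_space_def)
qed

text \<open>For the converse f = 1 suffices, since the radial derivative of
  \<open>J_op g (\<lambda>_. 1)\<close> is that of g.\<close>

lemma constant_iff_J_op_eq_0:
  fixes g :: "complex^'n \<Rightarrow> complex"
  assumes g: "holomorphic_several g (ball 0 1)" and p: "p > 0"
  shows "(\<exists>c. \<forall>z\<in>ball 0 1. g z = c) \<longleftrightarrow> (\<forall>f\<in>hardy_space p. \<forall>z\<in>ball 0 1. J_op g f z = 0)"
proof
  assume "\<exists>c. \<forall>z\<in>ball 0 1. g z = c"
  thus "\<forall>f\<in>hardy_space p. \<forall>z\<in>ball 0 1. J_op g f z = 0"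
    using J_op_constant[OF g] by blast
next
  assume J: "\<forall>f\<in>hardy_space p. \<forall>z\<in>ball 0 1. J_op g f z = 0"
  have "radial_deriv g z = 0" if z: "z \<in> ball 0 1" for z
  proof -
    let ?h = "\<lambda>\<mu>. J_op g (\<lambda>_. 1) (\<mu> *s z)"
    define W where "W = (\<lambda>w. w *s z) -` ball 0 1"
    have W: "open W" "1 \<in> W" unfolding W_def
      using z by (auto intro!: open_vimage continuous_intros)
    have "(?h has_field_derivative 1 * radial_deriv g z) (at 1)"
      by (rule J_op_slice[OF holomorphic_several_const g z])
    moreover have "(?h has_field_derivative 0) (at 1)"
    proof (rule has_field_derivative_transform_within_open[OF _ W])
      show "((\<lambda>_. 0) has_field_derivative 0) (at (1::complex))" by simp
      show "0 = ?h \<mu>" if "\<mu> \<in> W" for \<mu>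
        using that J constant_in_hardy_space[OF p] by (auto simp: W_def)
    qed
    ultimately show ?thesis using DERIV_unique by fastforce
  qed
  thus "\<exists>c. \<forall>z\<in>ball 0 1. g z = c"
    using constant_of_radial_deriv_eq_0[OF g] by blast
qed

lemma J_bounded_constant:
  fixes g :: "complex^'n \<Rightarrow> complex"
  assumes g: "holomorphic_several g (ball 0 1)" and c: "\<And>z. z \<in> ball 0 1 \<Longrightarrow> g z = c" and q: "q > 0"
  shows "J_bounded p q g"
proof -
  have J: "holomorphic_several (J_op g f) (ball 0 1)" "hardy_integral q (J_op g f) = 0"
    if "f \<in> hardy_space p" for f
  proof -
    show h: "holomorphic_several (J_op g f) (ball 0 1)"
      using that by (intro holomorphic_several_J_op g) (simp add: hardy_space_def)
    show "hardy_integral q (J_op g f) = 0"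
      by (rule hardy_integral_0[OF h]) (rule J_op_constant[OF g c])
  qed
  have "hardy_norm q (J_op g f) \<le> ennreal 0" if "f \<in> hardy_space p" for f
    using J(2)[OF that] q by (subst hardy_norm_le_iff) auto
  hence "J_norm p q g \<le> ennreal 0"
    unfolding J_norm_def by (intro SUP_least) auto
  hence "J_norm p q g < \<infinity>" by simp
  thus ?thesis using J by (auto simp: J_bounded_def hardy_space_def)
qed

section \<open>Sufficiency\<close>

text \<open>Up to t = 1 it is used with a positive exponent \<gamma>, away from t = 1 with a
  negative one; hence the alternative in the assumptions.\<close>

lemma has_integral_one_minus_powr:
  fixes \<gamma> :: real
  assumes ab: "a \<le> b" "b \<le> 1" and \<gamma>: "\<gamma> \<noteq> 0" "b < 1 \<or> \<gamma> > 0"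
  shows "((\<lambda>t. (1 - t) powr (\<gamma> - 1)) has_integral ((1 - a) powr \<gamma> - (1 - b) powr \<gamma>) / \<gamma>) {a..b}"
proof -
  let ?f = "\<lambda>t. - ((1 - t) powr \<gamma>) / \<gamma>"
  have "((\<lambda>t. (1 - t) powr (\<gamma> - 1)) has_integral (?f b - ?f a)) {a..b}"
  proof (rule fundamental_theorem_of_calculus_interior[OF ab(1)])
    show "continuous_on {a..b} ?f"
      using ab \<gamma> by (intro continuous_on_divide continuous_on_minus continuous_on_powr' continuous_intros) auto
    fix t assume t: "t \<in> {a<..<b}"
    have "(?f has_real_derivative (1 - t) powr (\<gamma> - 1)) (at t)"
      using t ab \<gamma> by (auto intro!: derivative_eq_intros)
    thus "(?f has_vector_derivative (1 - t) powr (\<gamma> - 1)) (at t)"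
      by (simp add: has_real_derivative_iff_has_vector_derivative)
  qed
  thus ?thesis by (simp add: diff_divide_distrib)
qed

text \<open>The majorants (1 - t) powr x have the value 0 at t = 1, by the convention 0 powr x = 0,
  and may fail to bound \<phi> there; the point c is excluded for this reason.\<close>

lemma norm_integral_le_except_endpoint:
  fixes \<phi> :: "real \<Rightarrow> complex"
  assumes cont: "continuous_on {a..b} \<phi>" and D: "(D has_integral I) {a..b}"
    and le: "\<And>t. t \<in> {a..b} \<Longrightarrow> t \<noteq> c \<Longrightarrow> cmod (\<phi> t) \<le> D t"
  shows "cmod (integral {a..b} \<phi>) \<le> I"
proof -
  define D' where "D' t = (if t = c then cmod (\<phi> t) else D t)" for t
  have D': "(D' has_integral I) {a..b}"
    by (rule has_integral_spike_finite[OF _ _ D, of "{c}"]) (auto simp: D'_def)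
  have "cmod (\<phi> t) \<le> D' t" if "t \<in> {a..b}" for t
    using le[OF that] by (cases "t = c") (simp_all add: D'_def)
  hence "cmod (integral {a..b} \<phi>) \<le> integral {a..b} D'"
    by (rule integral_norm_bound_integral[OF integrable_continuous_interval[OF cont] has_integral_integrable[OF D']])
  thus ?thesis by (simp only: integral_unique[OF D'])
qed

text \<open>The two bounds cross where 1 - t = e with e^\<beta> = A / F. The second is integrated
  before that point and the first after it; at this choice both contributions are multiples of the
  same product of powers of F and A.\<close>

lemma Hedberg_bound:
  fixes \<phi> :: "real \<Rightarrow> complex"
  assumes cont: "continuous_on {0..1} \<phi>" and F: "F > 0" and A: "A > 0" and c: "c \<ge> 0"
    and \<alpha>: "0 < \<alpha>" "\<alpha> < \<beta>"
    and b1: "\<And>t. t \<in> {0..<1} \<Longrightarrow> cmod (\<phi> t) \<le> c * F * (1 - t) powr (\<alpha> - 1)"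
    and b2: "\<And>t. t \<in> {0..<1} \<Longrightarrow> cmod (\<phi> t) \<le> c * A * (1 - t) powr (\<alpha> - \<beta> - 1)"
  shows "cmod (integral {0..1} \<phi>) \<le> c * (1 / \<alpha> + 1 / (\<beta> - \<alpha>)) * (F powr (1 - \<alpha> / \<beta>) * A powr (\<alpha> / \<beta>))"
proof -
  define e where "e = (A / F) powr (1 / \<beta>)"
  have e: "e > 0" using A F by (simp add: e_def)
  have \<beta>: "\<beta> > 0" using \<alpha> by simp
  let ?X = "F powr (1 - \<alpha> / \<beta>) * A powr (\<alpha> / \<beta>)"
  have Fe: "F * e powr \<alpha> = ?X"
    using A F by (simp add: e_def powr_powr powr_divide powr_diff)
  have Ae: "A * e powr (\<alpha> - \<beta>) = ?X"
  proof -
    have "A * e powr (\<alpha> - \<beta>) = A powr 1 * ((A / F) powr (\<alpha> / \<beta> - 1))"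
      using A \<beta> by (simp add: e_def powr_powr diff_divide_distrib)
    also have "(A / F) powr (\<alpha> / \<beta> - 1) = A powr (\<alpha> / \<beta> - 1) * F powr (1 - \<alpha> / \<beta>)"
      using A F powr_minus_divide[of F "\<alpha> / \<beta> - 1"] by (simp add: powr_divide)
    also have "A powr 1 * (A powr (\<alpha> / \<beta> - 1) * F powr (1 - \<alpha> / \<beta>)) = ?X"
      by (simp only: mult.assoc[symmetric] powr_add[symmetric]) (simp add: mult.commute)
    finally show ?thesis .
  qed
  have near: "cmod (integral {a..1} \<phi>) \<le> c * F * ((1 - a) powr \<alpha> / \<alpha>)" if a: "0 \<le> a" "a \<le> 1" for a
  proof (rule norm_integral_le_except_endpoint[where c=1])
    show "continuous_on {a..1} \<phi>" using cont a by (rule_tac continuous_on_subset) auto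
    have "((\<lambda>t. (1 - t) powr (\<alpha> - 1)) has_integral ((1 - a) powr \<alpha> - (1 - 1) powr \<alpha>) / \<alpha>) {a..1}"
      using a \<alpha> by (intro has_integral_one_minus_powr) auto
    from has_integral_mult_right[OF this, of "c * F"]
    show "((\<lambda>t. c * F * (1 - t) powr (\<alpha> - 1)) has_integral c * F * ((1 - a) powr \<alpha> / \<alpha>)) {a..1}"
      using \<alpha> by simp
    show "cmod (\<phi> t) \<le> c * F * (1 - t) powr (\<alpha> - 1)" if "t \<in> {a..1}" "t \<noteq> 1" for t
      using b1[of t] that a by auto
  qed
  show ?thesis
  proof (cases "e \<ge> 1")
    case True
    \<comment> \<open>The crossing point is not inside the unit interval; the first bound alone
      suffices, since then F \<le> F e^\<alpha>.\<close>
    have "cmod (integral {0..1} \<phi>) \<le> c * F * (1 / \<alpha>)" using near[of 0] by simp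
    also have "\<dots> \<le> c * (F * e powr \<alpha>) * (1 / \<alpha>)"
      using True \<alpha> c F by (intro mult_right_mono mult_left_mono) (auto simp: ge_one_powr_ge_zero)
    also have "\<dots> = c * ?X * (1 / \<alpha>)" unfolding Fe ..
    also have "\<dots> \<le> c * ?X * (1 / \<alpha> + 1 / (\<beta> - \<alpha>))"
      using \<alpha> c A F by (intro mult_left_mono) auto
    finally show ?thesis by (simp add: mult_ac)
  next
    case False
    hence e1: "e < 1" by simp
    have "cmod (integral {0..1 - e} \<phi>) \<le> c * A * (e powr (\<alpha> - \<beta>) / (\<beta> - \<alpha>))"
    proof -
      have "cmod (integral {0..1 - e} \<phi>) \<le> c * A * ((1 - e powr (\<alpha> - \<beta>)) / (\<alpha> - \<beta>))"
      proof (rule norm_integral_le_except_endpoint[where c=1])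
        show "continuous_on {0..1 - e} \<phi>" using cont e by (rule_tac continuous_on_subset) auto
        have "((\<lambda>t. (1 - t) powr ((\<alpha> - \<beta>) - 1)) has_integral ((1 - 0) powr (\<alpha> - \<beta>) - (1 - (1 - e)) powr (\<alpha> - \<beta>)) / (\<alpha> - \<beta>)) {0..1 - e}"
          using e e1 \<alpha> by (intro has_integral_one_minus_powr) auto
        from has_integral_mult_right[OF this, of "c * A"]
        show "((\<lambda>t. c * A * (1 - t) powr (\<alpha> - \<beta> - 1)) has_integral c * A * ((1 - e powr (\<alpha> - \<beta>)) / (\<alpha> - \<beta>))) {0..1 - e}"
          by simp
        show "cmod (\<phi> t) \<le> c * A * (1 - t) powr (\<alpha> - \<beta> - 1)" if "t \<in> {0..1 - e}" for t
          using b2[of t] that e by auto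
      qed
      also have "(1 - e powr (\<alpha> - \<beta>)) / (\<alpha> - \<beta>) = (e powr (\<alpha> - \<beta>) - 1) / (\<beta> - \<alpha>)"
        using minus_divide_divide[of "e powr (\<alpha> - \<beta>) - 1" "\<beta> - \<alpha>"] by simp
      also have "c * A * ((e powr (\<alpha> - \<beta>) - 1) / (\<beta> - \<alpha>)) \<le> c * A * (e powr (\<alpha> - \<beta>) / (\<beta> - \<alpha>))"
        using c A \<alpha> by (intro mult_left_mono divide_right_mono) auto
      finally show ?thesis .
    qed
    moreover have "cmod (integral {1 - e..1} \<phi>) \<le> c * F * (e powr \<alpha> / \<alpha>)"
      using near[of "1 - e"] e e1 by simp
    ultimately have "cmod (integral {0..1 - e} \<phi>) + cmod (integral {1 - e..1} \<phi>) \<le>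
        c * A * (e powr (\<alpha> - \<beta>) / (\<beta> - \<alpha>)) + c * F * (e powr \<alpha> / \<alpha>)"
      by (rule add_mono)
    moreover have "integral {0..1 - e} \<phi> + integral {1 - e..1} \<phi> = integral {0..1} \<phi>"
      using e e1 cont by (intro Henstock_Kurzweil_Integration.integral_combine integrable_continuous_interval) auto
    hence "cmod (integral {0..1} \<phi>) \<le> cmod (integral {0..1 - e} \<phi>) + cmod (integral {1 - e..1} \<phi>)"
      by (metis norm_triangle_ineq)
    ultimately have "cmod (integral {0..1} \<phi>) \<le> c * A * (e powr (\<alpha> - \<beta>) / (\<beta> - \<alpha>)) + c * F * (e powr \<alpha> / \<alpha>)"
      by linarith
    also have "\<dots> = c * (A * e powr (\<alpha> - \<beta>)) / (\<beta> - \<alpha>) + c * (F * e powr \<alpha>) / \<alpha>"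
      by (simp add: mult.assoc)
    also have "\<dots> = c * (1 / \<alpha> + 1 / (\<beta> - \<alpha>)) * ?X"
      unfolding Fe Ae by (simp add: algebra_simps)
    finally show ?thesis .
  qed
qed

text \<open>The hypothesis controls t times the derivative in direction z, which is weak for small
  t. There the maximum principle on |w| \<le> 1/2 moves the estimate to |w| = 1/2, where dividing by
  |w| costs a factor 2; for t \<ge> 1/2 division by t costs no more.\<close>

lemma cderiv_radial_bound:
  fixes g :: "complex^'n \<Rightarrow> complex"
  assumes g: "holomorphic_several g (ball 0 1)" and z: "norm z < 1"
    and \<alpha>: "0 < \<alpha>" "\<alpha> \<le> 1" and L: "L \<ge> 0" and t: "t \<in> {0..<1}"
    and bound: "\<And>a. norm a < 1 \<Longrightarrow> cmod (radial_deriv g a) \<le> L * (1 - (norm a)\<^sup>2) powr (\<alpha> - 1)"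
  shows "cmod (cderiv g (t *\<^sub>R z) z) \<le> 4 * L * (1 - t) powr (\<alpha> - 1)"
proof -
  have scale: "w * cderiv g (w *s z) z = radial_deriv g (w *s z)" if "norm (w *s z) < 1" for w
    using that by (simp add: radial_deriv_eq_cderiv[OF g] cderiv_scale[OF g])
  show ?thesis
  proof (cases "t < 1 / 2")
    case True
    let ?S = "cball (0::complex) (1 / 2)"
    have in_ball: "norm (w *s z) \<le> 1 / 2" if "w \<in> ?S" for w
      using that z mult_mono[of "cmod w" "1/2" "norm z" 1] by (simp add: norm_vector_scalar_mult)
    have "(\<lambda>w. cderiv g (0 + w *s z) z) holomorphic_on ?S"
      using in_ball by (intro slice_holomorphic_on[OF holomorphic_several_cderiv[OF g open_ball]]) fastforce
    hence hol: "(\<lambda>w. cderiv g (w *s z) z) holomorphic_on ?S" by simp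
    have "cmod (cderiv g (of_real t *s z) z) \<le> 4 * L"
    proof (rule maximum_modulus_frontier[where S="?S" and f="\<lambda>w. cderiv g (w *s z) z"])
      show "(\<lambda>w. cderiv g (w *s z) z) holomorphic_on interior ?S"
        using hol by (rule holomorphic_on_subset) (rule interior_subset)
      show "continuous_on (closure ?S) (\<lambda>w. cderiv g (w *s z) z)"
        using holomorphic_on_imp_continuous_on[OF hol] by simp
      show "of_real t \<in> ?S" using True t by simp
      fix w assume "w \<in> frontier ?S"
      hence w: "cmod w = 1 / 2" by simp
      hence wz: "norm (w *s z) \<le> 1 / 2" by (intro in_ball) simp
      hence "(norm (w *s z))\<^sup>2 \<le> (1 / 2)\<^sup>2" by (intro power_mono) auto
      hence 34: "3 / 4 \<le> 1 - (norm (w *s z))\<^sup>2" by (simp add: power2_eq_square)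
      have "w * cderiv g (w *s z) z = radial_deriv g (w *s z)"
        by (rule scale) (use wz in simp)
      hence "1 / 2 * cmod (cderiv g (w *s z) z) = cmod (radial_deriv g (w *s z))"
        by (simp only: norm_mult w flip: \<open>w * cderiv g (w *s z) z = radial_deriv g (w *s z)\<close>)
      also have "\<dots> \<le> L * (1 - (norm (w *s z))\<^sup>2) powr (\<alpha> - 1)"
        using wz by (intro bound) simp
      also have "(1 - (norm (w *s z))\<^sup>2) powr (\<alpha> - 1) \<le> (3 / 4) powr (\<alpha> - 1)"
        using 34 \<alpha> by (intro powr_mono2') auto
      also have "\<dots> \<le> (3 / 4) powr (- 1)"
        using \<alpha> by (intro powr_mono') auto
      also have "\<dots> \<le> 2" by (simp add: powr_minus)
      finally show "cmod (cderiv g (w *s z) z) \<le> 4 * L" using L by (simp add: mult_left_mono)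
    qed simp
    also have "\<dots> \<le> 4 * L * (1 - t) powr (\<alpha> - 1)"
    proof -
      have "1 \<le> (1 - t) powr (\<alpha> - 1)"
        using t \<alpha> powr_mono'[of "\<alpha> - 1" 0 "1 - t"] by auto
      thus ?thesis using L mult_left_mono[of 1 "(1 - t) powr (\<alpha> - 1)" "4 * L"] by simp
    qed
    finally show ?thesis by (simp add: of_real_vector_scalar_mult)
  next
    case False
    have tz: "norm (complex_of_real t *s z) \<le> t"
      using t z mult_left_mono[of "norm z" 1 t] by (simp add: norm_vector_scalar_mult)
    hence "(norm (complex_of_real t *s z))\<^sup>2 \<le> t\<^sup>2" by (intro power_mono) auto
    also have "\<dots> \<le> t" using t by (simp add: power2_eq_square mult_left_le)
    finally have 1: "1 - t \<le> 1 - (norm (complex_of_real t *s z))\<^sup>2" by simp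
    have "1 / 2 * cmod (cderiv g (t *\<^sub>R z) z) \<le> t * cmod (cderiv g (t *\<^sub>R z) z)"
      using False by (intro mult_right_mono) auto
    also have "\<dots> = cmod (radial_deriv g (complex_of_real t *s z))"
    proof -
      have "complex_of_real t * cderiv g (complex_of_real t *s z) z = radial_deriv g (complex_of_real t *s z)"
        by (rule scale) (use tz t in auto)
      hence "cmod (complex_of_real t) * cmod (cderiv g (complex_of_real t *s z) z) = cmod (radial_deriv g (complex_of_real t *s z))"
        by (metis norm_mult)
      thus ?thesis using t by (simp add: of_real_vector_scalar_mult)
    qed
    also have "\<dots> \<le> L * (1 - (norm (complex_of_real t *s z))\<^sup>2) powr (\<alpha> - 1)"
      using tz t by (intro bound) auto
    also have "\<dots> \<le> L * (1 - t) powr (\<alpha> - 1)"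
      using 1 t \<alpha> L by (intro mult_left_mono powr_mono2') auto
    finally have "cmod (cderiv g (t *\<^sub>R z) z) \<le> 2 * L * (1 - t) powr (\<alpha> - 1)" by simp
    also have "\<dots> \<le> 4 * L * (1 - t) powr (\<alpha> - 1)"
      using L by (intro mult_right_mono) auto
    finally show ?thesis .
  qed
qed

text \<open>Multiplying the radial bound for g by either bound for f produces the two hypotheses of
  \<open>Hedberg_bound\<close>, with c = 4 L.\<close>

lemma J_op_pointwise:
  fixes g f :: "complex^'n \<Rightarrow> complex"
  assumes f: "holomorphic_several f (ball 0 1)" and g: "holomorphic_several g (ball 0 1)" and z: "norm z < 1"
    and \<alpha>: "0 < \<alpha>" "\<alpha> \<le> 1" "\<alpha> < \<beta>" and L: "L \<ge> 0" and F: "F > 0" and A: "A > 0"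
    and bound: "\<And>a. norm a < 1 \<Longrightarrow> cmod (radial_deriv g a) \<le> L * (1 - (norm a)\<^sup>2) powr (\<alpha> - 1)"
    and bF: "\<And>t. t \<in> {0..1} \<Longrightarrow> cmod (f (t *\<^sub>R z)) \<le> F"
    and bA: "\<And>t. t \<in> {0..<1} \<Longrightarrow> cmod (f (t *\<^sub>R z)) \<le> A * (1 - t) powr (- \<beta>)"
  shows "cmod (J_op g f z) \<le> 4 * L * (1 / \<alpha> + 1 / (\<beta> - \<alpha>)) * (F powr (1 - \<alpha> / \<beta>) * A powr (\<alpha> / \<beta>))"
proof -
  have zb: "z \<in> ball 0 1" using z by simp
  have cont: "continuous_on {0..1} (\<lambda>t. h (t *\<^sub>R z))" if "holomorphic_several h (ball 0 1)" for h :: "complex^'n \<Rightarrow> complex"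
    using scaleR_in_unit_ball[OF zb]
    by (intro continuous_on_compose2[OF holomorphic_several_continuous_on[OF that]] continuous_intros) blast
  show ?thesis
    unfolding J_op_eq[OF g zb]
  proof (rule Hedberg_bound[OF _ F A _ \<alpha>(1,3)])
    show "continuous_on {0..1} (\<lambda>t. f (t *\<^sub>R z) * cderiv g (t *\<^sub>R z) z)"
      by (intro continuous_on_mult cont f holomorphic_several_cderiv g open_ball)
    fix t :: real assume t: "t \<in> {0..<1}"
    note d = cderiv_radial_bound[OF g z \<alpha>(1,2) L t bound]
    have "cmod (f (t *\<^sub>R z) * cderiv g (t *\<^sub>R z) z) \<le> F * (4 * L * (1 - t) powr (\<alpha> - 1))"
      unfolding norm_mult using t F by (intro mult_mono bF d) auto
    thus "cmod (f (t *\<^sub>R z) * cderiv g (t *\<^sub>R z) z) \<le> 4 * L * F * (1 - t) powr (\<alpha> - 1)"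
      by (simp add: mult_ac)
    have "cmod (f (t *\<^sub>R z) * cderiv g (t *\<^sub>R z) z) \<le> (A * (1 - t) powr (- \<beta>)) * (4 * L * (1 - t) powr (\<alpha> - 1))"
      unfolding norm_mult using t A by (intro mult_mono bA d) auto
    also have "\<dots> = 4 * L * A * ((1 - t) powr (- \<beta>) * (1 - t) powr (\<alpha> - 1))"
      by (simp add: mult_ac)
    also have "(1 - t) powr (- \<beta>) * (1 - t) powr (\<alpha> - 1) = (1 - t) powr (\<alpha> - \<beta> - 1)"
    proof -
      have "- \<beta> + (\<alpha> - 1) = \<alpha> - \<beta> - 1" by simp
      thus ?thesis by (simp only: powr_add[symmetric])
    qed
    finally show "cmod (f (t *\<^sub>R z) * cderiv g (t *\<^sub>R z) z) \<le> 4 * L * A * (1 - t) powr (\<alpha> - \<beta> - 1)" .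
  qed (use L in simp)
qed

text \<open>Finitely many radii make the supremum a maximum, attained at a measurably chosen index,
  and keep the radius below some \<rho> < 1 as \<open>maximal_L2\<close> demands. The constant
  depends neither on N nor on the radii.\<close>

lemma radial_maximal_finite:
  fixes f :: "complex^'n \<Rightarrow> complex"
  assumes f: "holomorphic_several f (ball 0 1)" and p: "p > 0" and R: "0 < R" "R < 1"
    and r: "\<And>k. 0 < r k" "\<And>k::nat. r k < 1"
  shows "(\<integral>\<^sup>+z. (SUP k\<in>{..N}. ennreal (cmod (ball_ext f ((R * r k) *\<^sub>R z)) powr p)) \<partial>sph) \<le> 2500 * integral_mean p f R"
proof -
  \<comment> \<open>The square of |f|^s is |f|^p, and the Poisson inequality holds for every
    positive s.\<close>
  define s where "s = p / 2"
  have s: "s > 0" using p by (simp add: s_def)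
  note [measurable] = ball_ext_measurable[OF f]
  \<comment> \<open>Cut off outside the sphere, so that the bound \<open>a_le\<close> holds at every
    point and not merely almost everywhere.\<close>
  define a where "a k z = (if norm z = 1 then cmod (ball_ext f ((R * r k) *\<^sub>R z)) powr s else 0)" for k and z :: "complex^'n"
  have a_meas[measurable]: "a k \<in> borel_measurable borel" for k
    unfolding a_def by measurable
  \<comment> \<open>The least maximizing index is a measurable choice, being determined by countably
    many comparisons of Borel functions.\<close>
  define best where "best z = (LEAST k. k \<le> N \<and> (\<forall>j. j \<le> N \<longrightarrow> a j z \<le> a k z))" for z
  have best_meas[measurable]: "best \<in> measurable borel (count_space UNIV)"
    unfolding best_def by measurable
  have best: "best z \<le> N" "\<And>j. j \<le> N \<Longrightarrow> a j z \<le> a (best z) z" for z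
  proof -
    have "Max ((\<lambda>j. a j z) ` {..N}) \<in> (\<lambda>j. a j z) ` {..N}"
      by (rule Max_in) auto
    then obtain k where k: "Max ((\<lambda>j. a j z) ` {..N}) = a k z" "k \<in> {..N}" by (rule imageE)
    have "a j z \<le> a k z" if "j \<le> N" for j
      unfolding k(1)[symmetric] using that by (intro Max_ge) auto
    hence "k \<le> N \<and> (\<forall>j. j \<le> N \<longrightarrow> a j z \<le> a k z)" using k by blast
    from LeastI[of "\<lambda>k. k \<le> N \<and> (\<forall>j. j \<le> N \<longrightarrow> a j z \<le> a k z)", OF this]
    show "best z \<le> N" "\<And>j. j \<le> N \<Longrightarrow> a j z \<le> a (best z) z"
      unfolding best_def by auto
  qed
  define rad where "rad z = r (best z)" for z
  have rad_meas: "rad \<in> borel_measurable borel"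
    unfolding rad_def by (rule measurable_compose_countable[OF _ best_meas]) simp
  interpret radius_function rad
    by unfold_locales (use rad_meas r in \<open>auto simp: rad_def less_imp_le\<close>)
  define m where "m z = ennreal (a (best z) z)" for z
  have m_meas: "m \<in> borel_measurable borel"
    unfolding m_def by (rule measurable_compose_countable[OF _ best_meas, of "\<lambda>k z. ennreal (a k z)"]) simp
  define u where "u z = ennreal (cmod (ball_ext f (R *\<^sub>R z)) powr s)" for z
  have u_meas: "u \<in> borel_measurable borel"
    unfolding u_def by measurable
  have "compact (f ` cball 0 R)"
    using R by (intro compact_continuous_image continuous_on_subset[OF holomorphic_several_continuous_on[OF f]]) auto
  then obtain B where B: "\<And>z. norm z \<le> R \<Longrightarrow> cmod (f z) \<le> B"
    by (metis compact_imp_bounded bounded_iff imageI mem_cball_0)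
  define \<rho> where "\<rho> = Max (r ` {..N})"
  have \<rho>: "\<rho> < 1" unfolding \<rho>_def using r by (subst Max_less_iff) auto
  have rad_le: "rad z \<le> \<rho>" for z
    unfolding rad_def \<rho>_def using best(1)[of z] by (intro Max_ge) auto
  have a_le: "a k z \<le> B powr s" for k z
  proof (cases "norm z = 1")
    case True
    have Rr: "0 < R * r k" "R * r k \<le> R"
      using R r[of k] mult_left_le[of "r k" R] by (auto simp: less_imp_le)
    hence Rr1: "R * r k < 1" using R by linarith
    hence "norm ((R * r k) *\<^sub>R z) = R * r k" using True Rr by simp
    thus ?thesis using True s Rr Rr1 B[of "(R * r k) *\<^sub>R z"]
      by (simp add: a_def ball_ext_eq powr_mono2)
  qed (simp add: a_def)
  have "(\<integral>\<^sup>+z. (m z)\<^sup>2 \<partial>sph) \<le> 2500 * (\<integral>\<^sup>+z. (u z)\<^sup>2 \<partial>sph)"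
  proof (rule maximal_L2[OF m_meas u_meas _ \<rho> rad_le])
    show "m z \<le> ennreal (B powr s)" for z
      unfolding m_def by (intro ennreal_leI a_le)
    show "AE z in sph. m z \<le> (\<integral>\<^sup>+v. ker z v * u (v *s z) \<partial>sph)"
      using AE_sph
    proof eventually_elim
      case (elim z)
      \<comment> \<open>On the complex line through z the function f(R w z) is holomorphic for |w| <
        1 / R, a disc larger than the unit disc, as \<open>sph_Poisson_ineq\<close>
        requires.\<close>
      have nR: "norm (w *s (R *\<^sub>R z)) < 1" if "w \<in> ball 0 (1 / R)" for w
        using that R elim by (simp add: norm_vector_scalar_mult field_simps)
      have "(\<lambda>w. f (0 + w *s (R *\<^sub>R z))) holomorphic_on ball 0 (1 / R)"
        using nR by (intro slice_holomorphic_on[OF f]) simp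
      hence hol: "(\<lambda>w. f (w *s (R *\<^sub>R z))) holomorphic_on ball 0 (1 / R)" by simp
      have "ennreal (cmod (f (complex_of_real (rad z) *s (R *\<^sub>R z))) powr s) \<le>
          (\<integral>\<^sup>+v. u (v *s z) * ennreal (poisson (complex_of_real (rad z)) v) \<partial>sph)"
      proof (rule sph_Poisson_ineq[OF hol _ _ s])
        show "1 < 1 / R" using R by simp
        show "cmod (complex_of_real (rad z)) < 1" using rad[of z] by simp
        show "(\<lambda>v. u (v *s z)) \<in> borel_measurable borel"
          using u_meas by measurable
        fix v :: complex assume "cmod v = 1"
        moreover have "R *\<^sub>R (v *s z) = v *s (R *\<^sub>R z)"
          by (simp add: vec_eq_iff)
        ultimately show "u (v *s z) = ennreal (cmod (f (v *s (R *\<^sub>R z))) powr s)"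
          using R nR[of v] by (simp add: u_def ball_ext_eq)
      qed
      moreover have "complex_of_real (rad z) *s (R *\<^sub>R z) = (R * rad z) *\<^sub>R z"
        by (simp add: of_real_vector_scalar_mult mult.commute)
      moreover have "norm ((R * rad z) *\<^sub>R z) < 1"
        using R rad[of z] elim mult_strict_mono[of R 1 "rad z" 1] by simp
      ultimately show ?case
        using elim by (simp add: m_def a_def rad_def ker_def ball_ext_eq mult.commute)
    qed
  qed
  also have "(\<integral>\<^sup>+z. (u z)\<^sup>2 \<partial>sph) = integral_mean p f R"
    unfolding integral_mean_def u_def
    by (intro nn_integral_cong) (simp add: power2_eq_square ennreal_mult[symmetric] powr_add[symmetric] s_def)
  finally have *: "(\<integral>\<^sup>+z. (m z)\<^sup>2 \<partial>sph) \<le> 2500 * integral_mean p f R" .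
  have "(\<integral>\<^sup>+z. (SUP k\<in>{..N}. ennreal (cmod (ball_ext f ((R * r k) *\<^sub>R z)) powr p)) \<partial>sph) \<le> (\<integral>\<^sup>+z. (m z)\<^sup>2 \<partial>sph)"
  proof (rule nn_integral_sph_mono)
    fix z :: "complex^'n" assume elim: "norm z = 1"
    show "(SUP k\<in>{..N}. ennreal (cmod (ball_ext f ((R * r k) *\<^sub>R z)) powr p)) \<le> (m z)\<^sup>2"
    proof (rule SUP_least)
      fix k assume "k \<in> {..N}"
      hence "a k z \<le> a (best z) z" using best by simp
      hence "(a k z)\<^sup>2 \<le> (a (best z) z)\<^sup>2"
        using elim by (intro power_mono) (auto simp: a_def)
      moreover have "cmod (ball_ext f ((R * r k) *\<^sub>R z)) powr p = (a k z)\<^sup>2"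
        using elim by (simp add: a_def power2_eq_square powr_add[symmetric] s_def)
      moreover have "(m z)\<^sup>2 = ennreal ((a (best z) z)\<^sup>2)"
        using elim by (simp add: m_def a_def ennreal_power)
      ultimately show "ennreal (cmod (ball_ext f ((R * r k) *\<^sub>R z)) powr p) \<le> (m z)\<^sup>2"
        by (simp add: ennreal_leI)
    qed
  qed
  thus ?thesis using * by (rule order_trans)
qed

text \<open>Monotone convergence in the number of radii; a countable family keeps the supremum
  measurable.\<close>

lemma radial_maximal:
  fixes f :: "complex^'n \<Rightarrow> complex"
  assumes f: "holomorphic_several f (ball 0 1)" and p: "p > 0" and R: "0 < R" "R < 1"
    and r: "\<And>k. 0 < r k" "\<And>k::nat. r k < 1"
  shows "(\<integral>\<^sup>+z. (SUP k. ennreal (cmod (ball_ext f ((R * r k) *\<^sub>R z)) powr p)) \<partial>sph) \<le> 2500 * integral_mean p f R"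
proof -
  note [measurable] = ball_ext_measurable[OF f]
  define b where "b k z = ennreal (cmod (ball_ext f ((R * r k) *\<^sub>R z)) powr p)" for k and z :: "complex^'n"
  have [measurable]: "b k \<in> borel_measurable borel" for k
    unfolding b_def by measurable
  have "(SUP k. b k z) = (SUP N. SUP k\<in>{..N}. b k z)" for z
  proof (rule antisym)
    show "(SUP k. b k z) \<le> (SUP N. SUP k\<in>{..N}. b k z)"
      by (rule SUP_least) (meson SUP_upper2 UNIV_I atMost_iff order_refl)
    show "(SUP N. SUP k\<in>{..N}. b k z) \<le> (SUP k. b k z)"
      by (intro SUP_least SUP_upper) auto
  qed
  hence "(\<integral>\<^sup>+z. (SUP k. b k z) \<partial>sph) = (\<integral>\<^sup>+z. (SUP N. SUP k\<in>{..N}. b k z) \<partial>sph)" by simp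
  also have "\<dots> = (SUP N. \<integral>\<^sup>+z. (SUP k\<in>{..N}. b k z) \<partial>sph)"
  proof (rule nn_integral_monotone_convergence_SUP)
    show "incseq (\<lambda>N z. SUP k\<in>{..N}. b k z)"
      by (intro incseq_SucI le_funI SUP_subset_mono) auto
  qed measurable
  also have "\<dots> \<le> 2500 * integral_mean p f R"
    unfolding b_def by (intro SUP_least radial_maximal_finite assms)
  finally show ?thesis by (simp add: b_def)
qed

text \<open>Compensates for the restriction to countably many radii in the maximal function: density
  and continuity extend the bound to the whole segment.\<close>

lemma continuous_le_of_rational:
  fixes \<psi> :: "real \<Rightarrow> real"
  assumes cont: "continuous_on {0..1} \<psi>" and le: "\<And>t. t \<in> \<rat> \<inter> {0<..<1} \<Longrightarrow> \<psi> t \<le> F" and t: "t \<in> {0..1}"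
  shows "\<psi> t \<le> F"
proof -
  have "closure ({0<..<1} \<inter> \<rat>) = closure {0<..<1::real}"
    by (rule closure_open_Int_superset) (auto simp: Rats_closure_real)
  hence cl: "closure (\<rat> \<inter> {0<..<1}) = {0..1::real}"
    by (simp add: Int_commute)
  show ?thesis
    by (rule continuous_le_on_closure[of "\<rat> \<inter> {0<..<1}"]) (use cont le t cl in auto)
qed

text \<open>The weight A^(q-p) left over by the pointwise bound is of order M^(q/p - 1), and the
  maximal theorem contributes one more factor M; together they give the power M^(q/p) that
  homogeneity in f requires.\<close>

lemma hardy_integral_J_op_bound:
  assumes p: "0 < p" "p < q" and \<alpha>: "\<alpha> = real CARD('n::finite) * (1 / p - 1 / q)" "\<alpha> \<le> 1"
  shows "\<exists>C>0. \<forall>(g :: complex^'n \<Rightarrow> complex) f L M. holomorphic_several g (ball 0 1) \<longrightarrow>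
    holomorphic_several f (ball 0 1) \<longrightarrow> 0 \<le> L \<longrightarrow> 0 < M \<longrightarrow>
    (\<forall>a. norm a < 1 \<longrightarrow> cmod (radial_deriv g a) \<le> L * (1 - (norm a)\<^sup>2) powr (\<alpha> - 1)) \<longrightarrow>
    hardy_integral p f \<le> ennreal M \<longrightarrow>
    hardy_integral q (J_op g f) \<le> ennreal (C * L powr q * M powr (q / p))"
proof -
  let ?n = "real CARD('n)" and ?P = "pointwise_const CARD('n)"
  define \<beta> where "\<beta> = ?n / p"
  have q: "q > 0" using p by simp
  have n: "?n > 0" by simp
  have \<alpha>0: "0 < \<alpha>" using p n unfolding \<alpha> by (intro mult_pos_pos) (auto simp: frac_less2)
  have \<beta>: "\<beta> > 0" using n p by (simp add: \<beta>_def)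
  have \<beta>\<alpha>: "\<beta> - \<alpha> = ?n / q" by (simp add: \<beta>_def \<alpha> algebra_simps)
  have "?n / q > 0" using n q by simp
  hence \<alpha>\<beta>: "\<alpha> < \<beta>" using \<beta>\<alpha> by linarith
  have ratio: "1 - \<alpha> / \<beta> = p / q" "\<alpha> / \<beta> = 1 - p / q"
  proof -
    have "\<alpha> / \<beta> = (\<beta> - ?n / q) / \<beta>" using \<beta>\<alpha> by simp
    also have "\<dots> = 1 - p / q" using \<beta> p n q by (simp add: diff_divide_distrib) (simp add: \<beta>_def)
    finally show "\<alpha> / \<beta> = 1 - p / q" .
    thus "1 - \<alpha> / \<beta> = p / q" by simp
  qed
  have P: "?P > 0" by (rule pointwise_const_pos) simp
  define c where "c = 4 * (1 / \<alpha> + 1 / (\<beta> - \<alpha>))"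
  have c: "c > 0" using \<alpha>0 \<alpha>\<beta> by (simp add: c_def add_pos_pos)
  define C where "C = c powr q * ?P powr (q / p - 1) * 2500"
  have "C > 0" using c P by (simp add: C_def)
  moreover have "hardy_integral q (J_op g f) \<le> ennreal (C * L powr q * M powr (q / p))"
    if g: "holomorphic_several g (ball 0 1)" and f: "holomorphic_several f (ball 0 1)" and L: "0 \<le> L" and M: "0 < M"
      and bound: "\<And>a. norm a < 1 \<Longrightarrow> cmod (radial_deriv g a) \<le> L * (1 - (norm a)\<^sup>2) powr (\<alpha> - 1)"
      and fM: "hardy_integral p f \<le> ennreal M"
    for g f :: "complex^'n \<Rightarrow> complex" and L M
  proof (rule hardy_integral_leI[OF holomorphic_several_J_op[OF f g]])
    fix R :: real assume R: "0 < R" "R < 1"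
    define A where "A = (?P * M) powr (1 / p)"
    have A: "A > 0" using P M by (simp add: A_def)
    define r where "r = from_nat_into (\<rat> \<inter> {0<..<1::real})"
    have "(1 / 2 :: real) \<in> \<rat> \<inter> {0<..<1}" by auto
    hence ne: "\<rat> \<inter> {0<..<1::real} \<noteq> {}" by blast
    have r_range: "range r = \<rat> \<inter> {0<..<1}"
      unfolding r_def using ne by (intro range_from_nat_into countable_Int1 countable_rat)
    have r: "0 < r k" "r k < 1" for k
      using r_range rangeI[of r k] by auto
    define \<Phi> where "\<Phi> z = (SUP k. ennreal (cmod (ball_ext f ((R * r k) *\<^sub>R z)) powr p))" for z
    note [measurable] = ball_ext_measurable[OF f]
    have \<Phi>_meas[measurable]: "\<Phi> \<in> borel_measurable borel"
      unfolding \<Phi>_def by measurable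
    have "(\<integral>\<^sup>+z. \<Phi> z \<partial>sph) \<le> 2500 * integral_mean p f R"
      unfolding \<Phi>_def by (rule radial_maximal[OF f p(1) R r])
    also have "\<dots> \<le> 2500 * ennreal M"
      using integral_mean_le[OF f R, of p] fM by (intro mult_left_mono) auto
    finally have \<Phi>_int: "(\<integral>\<^sup>+z. \<Phi> z \<partial>sph) \<le> 2500 * ennreal M" .
    also have "\<dots> < \<infinity>" by (simp add: ennreal_mult_less_top)
    \<comment> \<open>Finiteness almost everywhere allows the pointwise argument to run with real
      numbers.\<close>
    finally have "AE z in sph. \<Phi> z \<noteq> \<infinity>"
      by (intro nn_integral_PInf_AE) auto
    define D where "D = (c * L) powr q * A powr (q - p)"
    have D: "D \<ge> 0" by (simp add: D_def)
    have "integral_mean q (J_op g f) R \<le> (\<integral>\<^sup>+z. ennreal D * \<Phi> z \<partial>sph)"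
      unfolding integral_mean_def
    proof (rule nn_integral_mono_AE)
      show "AE z in sph. ennreal (cmod (ball_ext (J_op g f) (R *\<^sub>R z)) powr q) \<le> ennreal D * \<Phi> z"
        using AE_sph \<open>AE z in sph. \<Phi> z \<noteq> \<infinity>\<close>
      proof eventually_elim
        case (elim z)
        define x where "x = enn2real (\<Phi> z)"
        have x: "\<Phi> z = ennreal x" "x \<ge> 0" using elim(2) by (auto simp: x_def less_top)
        have Rz: "norm (R *\<^sub>R z) < 1" using R elim by simp
        hence Rzb: "R *\<^sub>R z \<in> ball 0 1" by simp
        have xle: "cmod (f (t *\<^sub>R (R *\<^sub>R z))) powr p \<le> x" if "t \<in> {0..1}" for t
        proof (rule continuous_le_of_rational[OF _ _ that])
          show "continuous_on {0..1} (\<lambda>t. cmod (f (t *\<^sub>R R *\<^sub>R z)) powr p)"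
            using scaleR_in_unit_ball[OF Rzb] p
            by (intro continuous_on_powr' continuous_on_norm continuous_on_const
                continuous_on_compose2[OF holomorphic_several_continuous_on[OF f]] continuous_intros) auto
          fix t :: real assume t: "t \<in> \<rat> \<inter> {0<..<1}"
          then obtain k where k: "t = r k" using r_range by (metis imageE)
          have "norm ((R * r k) *\<^sub>R z) < 1"
            using R r[of k] elim mult_strict_mono[of R 1 "r k" 1] by simp
          hence "ennreal (cmod (f (t *\<^sub>R (R *\<^sub>R z))) powr p) = ennreal (cmod (ball_ext f ((R * r k) *\<^sub>R z)) powr p)"
            by (simp add: ball_ext_eq k mult.commute)
          also have "\<dots> \<le> \<Phi> z" unfolding \<Phi>_def by (rule SUP_upper) simp
          finally show "cmod (f (t *\<^sub>R (R *\<^sub>R z))) powr p \<le> x"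
            using x by simp
        qed
        have "cmod (J_op g f (R *\<^sub>R z)) powr q \<le> D * x"
        proof (cases "x = 0")
          \<comment> \<open>\<open>J_op_pointwise\<close> asks for F > 0. If the maximal function is
            0, then f vanishes along the radius and so does the integrand of
            \<open>J_op\<close>.\<close>
          case True
          hence "f (t *\<^sub>R (R *\<^sub>R z)) = 0" if "t \<in> {0..1}" for t
            using xle[OF that] powr_gt_zero[of "cmod (f (t *\<^sub>R (R *\<^sub>R z)))" p] by (smt (verit) norm_eq_zero)
          hence "J_op g f (R *\<^sub>R z) = integral {0..1} (\<lambda>t::real. 0)"
            unfolding J_op_eq[OF g Rzb] by (intro integral_cong) simp
          thus ?thesis using True q by simp
        next
          case False
          define F where "F = x powr (1 / p)"
          have F: "F > 0" using False x by (simp add: F_def)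
          have "cmod (J_op g f (R *\<^sub>R z)) \<le>
              4 * L * (1 / \<alpha> + 1 / (\<beta> - \<alpha>)) * (F powr (1 - \<alpha> / \<beta>) * A powr (\<alpha> / \<beta>))"
          proof (rule J_op_pointwise[OF f g Rz \<alpha>0 \<alpha>(2) \<alpha>\<beta> L F A bound])
            fix t :: real
            show "cmod (f (t *\<^sub>R (R *\<^sub>R z))) \<le> F" if "t \<in> {0..1}"
              using powr_mono2[of "1 / p", OF _ _ xle[OF that]] p by (simp add: F_def powr_powr)
            assume t: "t \<in> {0..<1}"
            \<comment> \<open>Points of the radius stay at distance at least 1 - t from the sphere
              whatever R is, so the growth bound is uniform in R.\<close>
            have "norm (t *\<^sub>R (R *\<^sub>R z)) \<le> t"
              using t R elim mult_left_le[of R t] by (simp add: mult_le_cancel_left1)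
            hence 1: "1 - t \<le> 1 - norm (t *\<^sub>R (R *\<^sub>R z))" by linarith
            have "norm (t *\<^sub>R (R *\<^sub>R z)) < 1" using 1 t by auto
            hence "cmod (f (t *\<^sub>R (R *\<^sub>R z))) \<le> A * (1 - norm (t *\<^sub>R (R *\<^sub>R z))) powr (- ?n / p)"
              unfolding A_def using M by (intro pointwise_estimate' f p fM) auto
            also have "\<dots> \<le> A * (1 - t) powr (- ?n / p)"
              using 1 t A p by (intro mult_left_mono powr_mono2') auto
            finally show "cmod (f (t *\<^sub>R (R *\<^sub>R z))) \<le> A * (1 - t) powr (- \<beta>)"
              by (simp add: \<beta>_def)
          qed auto
          also have "\<dots> = c * L * (F powr (p / q) * A powr (1 - p / q))"
            by (simp add: c_def ratio)
          finally have "cmod (J_op g f (R *\<^sub>R z)) powr q \<le> (c * L * (F powr (p / q) * A powr (1 - p / q))) powr q"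
            using q by (intro powr_mono2) auto
          also have "\<dots> = (c * L) powr q * (F powr p * A powr (q - p))"
          proof -
            have "(1 - p / q) * q = q - p" using q by (simp add: field_simps)
            thus ?thesis using c L q by (simp add: powr_mult powr_powr)
          qed
          also have "F powr p = x" using p x by (simp add: F_def powr_powr)
          finally show ?thesis by (simp add: D_def mult_ac)
        qed
        thus ?case using x D Rz by (simp add: ball_ext_eq ennreal_mult[symmetric] ennreal_leI)
      qed
    qed
    also have "\<dots> = ennreal D * (\<integral>\<^sup>+z. \<Phi> z \<partial>sph)"
      by (rule nn_integral_cmult) simp
    also have "\<dots> \<le> ennreal D * (2500 * ennreal M)"
      by (intro mult_left_mono \<Phi>_int) simp
    also have "\<dots> = ennreal (D * (2500 * M))"
      using D M by (simp add: ennreal_mult)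
    also have "D * (2500 * M) = C * L powr q * M powr (q / p)"
    proof -
      have "(q - p) / p = q / p - 1" using p by (simp add: field_simps)
      hence "A powr (q - p) = ?P powr (q / p - 1) * M powr (q / p - 1)"
        using P M by (simp add: A_def powr_powr powr_mult)
      moreover have "M powr (q / p - 1) * M = M powr (q / p)"
        using M by (simp add: powr_diff)
      ultimately show ?thesis
        using c L by (simp add: D_def C_def powr_mult mult_ac)
    qed
    finally show "integral_mean q (J_op g f) R \<le> ennreal (C * L powr q * M powr (q / p))" .
  qed
  ultimately show ?thesis by blast
qed

section \<open>Comparison of the two norms and conclusion\<close>

lemma Lip_norm_le_J_norm:
  assumes p: "0 < p" "p < q" and \<alpha>: "\<alpha> = real CARD('n::finite) * (1 / p - 1 / q)" "\<alpha> \<le> 1"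
  shows "\<exists>C>0. \<forall>g :: complex^'n \<Rightarrow> complex. holomorphic_several g (ball 0 1) \<longrightarrow>
    Lip_norm \<alpha> g \<le> ennreal C * J_norm p q g"
proof -
  obtain C where C: "C > 0" "\<And>(g :: complex^'n \<Rightarrow> complex) K a. holomorphic_several g (ball 0 1) \<Longrightarrow> 0 \<le> K \<Longrightarrow>
    J_norm p q g \<le> ennreal K \<Longrightarrow> norm a < 1 \<Longrightarrow> cmod (radial_deriv g a) \<le> C * K * (1 - norm a) powr (\<alpha> - 1)"
    using radial_deriv_bound[OF p \<alpha>(1)] by blast
  have "Lip_norm \<alpha> g \<le> ennreal (2 * C) * J_norm p q g"
    if g: "holomorphic_several g (ball 0 1)" for g :: "complex^'n \<Rightarrow> complex"
  proof (cases "J_norm p q g")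
    \<comment> \<open>Positivity of the constant matters here, since 0 times infinity is 0 in
      \<open>ennreal\<close>.\<close>
    case top
    thus ?thesis using C(1) by (simp add: ennreal_mult_top)
  next
    case (real K)
    have "(1 - (norm z)\<^sup>2) powr (1 - \<alpha>) * cmod (radial_deriv g z) \<le> 2 * C * K" if z: "z \<in> ball 0 1" for z
    proof -
      define \<delta> where "\<delta> = 1 - norm z"
      have \<delta>: "\<delta> > 0" using z by (simp add: \<delta>_def)
      have sq: "0 \<le> 1 - (norm z)\<^sup>2" using z by (simp add: power_le_one)
      have "1 - (norm z)\<^sup>2 = (1 + norm z) * \<delta>"
        by (simp add: \<delta>_def power2_eq_square algebra_simps)
      also have "\<dots> \<le> 2 * \<delta>"
        using z \<delta> by (intro mult_right_mono) auto
      finally have "(1 - (norm z)\<^sup>2) powr (1 - \<alpha>) \<le> (2 * \<delta>) powr (1 - \<alpha>)"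
        using sq \<alpha> by (intro powr_mono2) auto
      also have "\<dots> = 2 powr (1 - \<alpha>) * \<delta> powr (1 - \<alpha>)"
        by (rule powr_mult)
      also have "\<dots> \<le> 2 * \<delta> powr (1 - \<alpha>)"
      proof -
        have "\<alpha> \<ge> 0" using p unfolding \<alpha> by (intro mult_nonneg_nonneg) (auto simp: frac_le)
        thus ?thesis using powr_mono[of "1 - \<alpha>" 1 "2::real"] by (intro mult_right_mono) auto
      qed
      finally have 1: "(1 - (norm z)\<^sup>2) powr (1 - \<alpha>) \<le> 2 * \<delta> powr (1 - \<alpha>)" .
      have 2: "cmod (radial_deriv g z) \<le> C * K * \<delta> powr (\<alpha> - 1)"
        unfolding \<delta>_def using z real by (intro C g) auto
      have "(1 - (norm z)\<^sup>2) powr (1 - \<alpha>) * cmod (radial_deriv g z) \<le>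
          (2 * \<delta> powr (1 - \<alpha>)) * (C * K * \<delta> powr (\<alpha> - 1))"
        by (intro mult_mono 1 2) auto
      also have "\<dots> = 2 * C * K * (\<delta> powr (1 - \<alpha>) * \<delta> powr (\<alpha> - 1))"
        by (simp only: mult_ac)
      also have "\<delta> powr (1 - \<alpha>) * \<delta> powr (\<alpha> - 1) = 1"
        using \<delta> by (simp flip: powr_add)
      finally show ?thesis by simp
    qed
    hence "Lip_norm \<alpha> g \<le> ennreal (2 * C * K)"
      unfolding Lip_norm_def by (intro SUP_least ennreal_leI) auto
    thus ?thesis using real C(1) by (simp add: ennreal_mult)
  qed
  with C(1) show ?thesis by (intro exI[of _ "2 * C"]) auto
qed

lemma Lip_norm_bound:
  assumes L: "Lip_norm \<alpha> g \<le> ennreal L" "0 \<le> L" and a: "norm a < 1"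
  shows "cmod (radial_deriv g a) \<le> L * (1 - (norm a)\<^sup>2) powr (\<alpha> - 1)"
proof -
  let ?x = "1 - (norm a)\<^sup>2"
  have x: "?x > 0" using a by (simp add: abs_square_less_1)
  have "ennreal (?x powr (1 - \<alpha>) * cmod (radial_deriv g a)) \<le> Lip_norm \<alpha> g"
    unfolding Lip_norm_def using a by (intro SUP_upper) auto
  hence "ennreal (?x powr (1 - \<alpha>) * cmod (radial_deriv g a)) \<le> ennreal L"
    using L(1) by (rule order_trans)
  hence "?x powr (1 - \<alpha>) * cmod (radial_deriv g a) \<le> L"
    using L(2) by simp
  hence "?x powr (\<alpha> - 1) * (?x powr (1 - \<alpha>) * cmod (radial_deriv g a)) \<le> ?x powr (\<alpha> - 1) * L"
    by (intro mult_left_mono) auto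
  also have "?x powr (\<alpha> - 1) * (?x powr (1 - \<alpha>) * cmod (radial_deriv g a)) =
      (?x powr (\<alpha> - 1) * ?x powr (1 - \<alpha>)) * cmod (radial_deriv g a)"
    by (simp only: mult.assoc)
  also have "?x powr (\<alpha> - 1) * ?x powr (1 - \<alpha>) = 1"
    using x by (simp flip: powr_add)
  finally show ?thesis by (simp add: mult.commute)
qed

text \<open>The integral estimate is homogeneous of degree q in L, hence the constant C^(1/q). That
  H^p is mapped into H^q is a separate claim, because \<open>J_norm\<close> sees only functions in
  the unit ball.\<close>

lemma J_norm_le_Lip_norm:
  assumes p: "0 < p" "p < q" and \<alpha>: "\<alpha> = real CARD('n::finite) * (1 / p - 1 / q)" "\<alpha> \<le> 1"
  shows "\<exists>C>0. \<forall>g :: complex^'n \<Rightarrow> complex. holomorphic_several g (ball 0 1) \<longrightarrow>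
    J_norm p q g \<le> ennreal C * Lip_norm \<alpha> g \<and>
    (Lip_norm \<alpha> g < \<infinity> \<longrightarrow> (\<forall>f\<in>hardy_space p. J_op g f \<in> hardy_space q))"
proof -
  have q: "q > 0" using p by simp
  obtain C where C: "C > 0" "\<And>(g :: complex^'n \<Rightarrow> complex) f L M. holomorphic_several g (ball 0 1) \<Longrightarrow>
    holomorphic_several f (ball 0 1) \<Longrightarrow> 0 \<le> L \<Longrightarrow> 0 < M \<Longrightarrow>
    (\<And>a. norm a < 1 \<Longrightarrow> cmod (radial_deriv g a) \<le> L * (1 - (norm a)\<^sup>2) powr (\<alpha> - 1)) \<Longrightarrow>
    hardy_integral p f \<le> ennreal M \<Longrightarrow>
    hardy_integral q (J_op g f) \<le> ennreal (C * L powr q * M powr (q / p))"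
    using hardy_integral_J_op_bound[OF p \<alpha>] by metis
  have "J_norm p q g \<le> ennreal (C powr (1 / q)) * Lip_norm \<alpha> g \<and>
    (Lip_norm \<alpha> g < \<infinity> \<longrightarrow> (\<forall>f\<in>hardy_space p. J_op g f \<in> hardy_space q))"
    if g: "holomorphic_several g (ball 0 1)" for g :: "complex^'n \<Rightarrow> complex"
  proof (cases "Lip_norm \<alpha> g")
    case top
    thus ?thesis using C(1) by (simp add: ennreal_mult_top)
  next
    case (real L)
    have bound: "cmod (radial_deriv g a) \<le> L * (1 - (norm a)\<^sup>2) powr (\<alpha> - 1)" if "norm a < 1" for a
      using real that by (intro Lip_norm_bound) auto
    have "hardy_norm q (J_op g f) \<le> ennreal (C powr (1 / q) * L)"
      if "f \<in> hardy_space p" "hardy_norm p f \<le> 1" for f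
    proof -
      have f: "holomorphic_several f (ball 0 1)" using that by (simp add: hardy_space_def)
      have "hardy_integral p f \<le> ennreal 1"
        using that(2) hardy_norm_le_iff[OF p(1), of 1 f] by simp
      from C(2)[OF g f real(1) zero_less_one bound this]
      have "hardy_integral q (J_op g f) \<le> ennreal (C * L powr q)" by simp
      also have "C * L powr q = (C powr (1 / q) * L) powr q"
        using C(1) q by (simp add: powr_mult powr_powr)
      finally show ?thesis
        using real q by (subst hardy_norm_le_iff) auto
    qed
    hence "J_norm p q g \<le> ennreal (C powr (1 / q) * L)"
      unfolding J_norm_def by (intro SUP_least) auto
    hence "J_norm p q g \<le> ennreal (C powr (1 / q)) * Lip_norm \<alpha> g"
      using real by (simp add: ennreal_mult)
    moreover have "J_op g f \<in> hardy_space q" if "f \<in> hardy_space p" for f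
    proof -
      have f: "holomorphic_several f (ball 0 1)" "hardy_integral p f < \<infinity>"
        using that by (auto simp: hardy_space_def)
      then obtain M where M: "M \<ge> 0" "hardy_integral p f = ennreal M"
        by (cases "hardy_integral p f") auto
      \<comment> \<open>\<open>M + 1\<close> is taken because the estimate asks for a positive
        bound, while M may be 0.\<close>
      hence "hardy_integral p f \<le> ennreal (M + 1)" by (simp add: ennreal_leI)
      from C(2)[OF g f(1) real(1) _ bound this] M
      have "hardy_integral q (J_op g f) \<le> ennreal (C * L powr q * (M + 1) powr (q / p))" by simp
      hence "hardy_integral q (J_op g f) < \<infinity>"
        by (rule order.strict_trans1) simp
      thus ?thesis using holomorphic_several_J_op[OF f(1) g] by (simp add: hardy_space_def)
    qed
    ultimately show ?thesis by blast
  qed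
  with C(1) show ?thesis by (intro exI[of _ "C powr (1 / q)"]) auto
qed

lemma J_bounded_imp_constant:
  fixes g :: "complex^'n::finite \<Rightarrow> complex"
  assumes p: "0 < p" "p < q" and \<alpha>: "\<alpha> = real CARD('n) * (1 / p - 1 / q)" "1 < \<alpha>"
    and g: "holomorphic_several g (ball 0 1)" and J: "J_bounded p q g"
  shows "\<exists>c. \<forall>z\<in>ball 0 1. g z = c"
proof -
  obtain C where C: "C > 0" "\<And>(g :: complex^'n \<Rightarrow> complex) K a. holomorphic_several g (ball 0 1) \<Longrightarrow> 0 \<le> K \<Longrightarrow>
    J_norm p q g \<le> ennreal K \<Longrightarrow> norm a < 1 \<Longrightarrow> cmod (radial_deriv g a) \<le> C * K * (1 - norm a) powr (\<alpha> - 1)"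
    using radial_deriv_bound[OF p \<alpha>(1)] by blast
  obtain K where K: "K \<ge> 0" "J_norm p q g = ennreal K"
    using J by (cases "J_norm p q g") (auto simp: J_bounded_def)
  have "radial_deriv g z = 0" if "z \<in> ball 0 1" for z
    using that \<alpha>(2) K C(2)[OF g K(1)]
    by (intro radial_deriv_eq_0I[OF g, of "\<alpha> - 1" z "C * K"]) auto
  thus ?thesis
    using constant_of_radial_deriv_eq_0[OF g] by blast
qed

theorem theorem1p2:
  fixes p q \<alpha> :: real
  assumes "0 < p" and "p < q"
    and "\<alpha> = real CARD('n::finite) * (1 / p - 1 / q)"
  shows
    "(\<alpha> \<le> 1 \<longrightarrow>
       (\<forall>g :: complex^'n \<Rightarrow> complex. holomorphic_several g (ball 0 1) \<longrightarrow>
          (J_bounded p q g \<longleftrightarrow> g \<in> Lip_space \<alpha>)) \<and>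
       (\<exists>C>0. \<forall>g :: complex^'n \<Rightarrow> complex. holomorphic_several g (ball 0 1) \<longrightarrow>
          ennreal (1 / C) * Lip_norm \<alpha> g \<le> J_norm p q g \<and>
          J_norm p q g \<le> ennreal C * Lip_norm \<alpha> g)) \<and>
     (1 < \<alpha> \<longrightarrow>
       (\<forall>g :: complex^'n \<Rightarrow> complex. holomorphic_several g (ball 0 1) \<longrightarrow>
          (J_bounded p q g \<longleftrightarrow> (\<exists>c. \<forall>z\<in>ball 0 1. g z = c)) \<and>
          ((\<exists>c. \<forall>z\<in>ball 0 1. g z = c) \<longleftrightarrow> (\<forall>f\<in>hardy_space p. \<forall>z\<in>ball 0 1. J_op g f z = 0))))"
proof (rule conjI; rule impI)
  have q: "q > 0" using assms by simp
  {
    assume \<alpha>: "\<alpha> \<le> 1"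
    obtain C1 where C1: "C1 > 0" "\<And>g :: complex^'n \<Rightarrow> complex. holomorphic_several g (ball 0 1) \<Longrightarrow>
        Lip_norm \<alpha> g \<le> ennreal C1 * J_norm p q g"
      using Lip_norm_le_J_norm[OF assms \<alpha>] by blast
    obtain C2 where C2: "C2 > 0" "\<And>g :: complex^'n \<Rightarrow> complex. holomorphic_several g (ball 0 1) \<Longrightarrow>
        J_norm p q g \<le> ennreal C2 * Lip_norm \<alpha> g"
      "\<And>(g :: complex^'n \<Rightarrow> complex) f. holomorphic_several g (ball 0 1) \<Longrightarrow> Lip_norm \<alpha> g < \<infinity> \<Longrightarrow>
        f \<in> hardy_space p \<Longrightarrow> J_op g f \<in> hardy_space q"
      using J_norm_le_Lip_norm[OF assms \<alpha>] by blast
    have iff: "J_bounded p q g \<longleftrightarrow> g \<in> Lip_space \<alpha>"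
      if g: "holomorphic_several g (ball 0 1)" for g :: "complex^'n \<Rightarrow> complex"
    proof
      assume "J_bounded p q g"
      hence "ennreal C1 * J_norm p q g < \<infinity>"
        by (simp add: J_bounded_def ennreal_mult_less_top)
      hence "Lip_norm \<alpha> g < \<infinity>"
        using C1(2)[OF g] by (rule order.strict_trans1[rotated])
      thus "g \<in> Lip_space \<alpha>" using g by (simp add: Lip_space_def)
    next
      assume "g \<in> Lip_space \<alpha>"
      hence L: "Lip_norm \<alpha> g < \<infinity>" by (simp add: Lip_space_def)
      hence "ennreal C2 * Lip_norm \<alpha> g < \<infinity>"
        by (simp add: ennreal_mult_less_top)
      hence "J_norm p q g < \<infinity>"
        using C2(2)[OF g] by (rule order.strict_trans1[rotated])
      thus "J_bounded p q g" using C2(3)[OF g L] by (simp add: J_bounded_def)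
    qed
    \<comment> \<open>The maximum serves both inequalities: C1 / C \<le> 1 gives the lower one and
      C2 \<le> C the upper one.\<close>
    define C where "C = max C1 C2"
    have C: "C > 0" "C1 \<le> C" "C2 \<le> C" using C1 by (auto simp: C_def)
    have "ennreal (1 / C) * Lip_norm \<alpha> g \<le> J_norm p q g \<and> J_norm p q g \<le> ennreal C * Lip_norm \<alpha> g"
      if g: "holomorphic_several g (ball 0 1)" for g :: "complex^'n \<Rightarrow> complex"
    proof
      have "ennreal (1 / C) * Lip_norm \<alpha> g \<le> ennreal (1 / C) * (ennreal C1 * J_norm p q g)"
        by (intro mult_left_mono C1 g) simp
      also have "\<dots> = ennreal (C1 / C) * J_norm p q g"
        using C C1 by (simp add: mult.assoc[symmetric] ennreal_mult[symmetric])
      also have "\<dots> \<le> ennreal 1 * J_norm p q g"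
        using C C1 by (intro mult_right_mono ennreal_leI) auto
      finally show "ennreal (1 / C) * Lip_norm \<alpha> g \<le> J_norm p q g" by simp
      have "J_norm p q g \<le> ennreal C2 * Lip_norm \<alpha> g" by (rule C2(2)[OF g])
      also have "\<dots> \<le> ennreal C * Lip_norm \<alpha> g"
        using C by (intro mult_right_mono ennreal_leI) auto
      finally show "J_norm p q g \<le> ennreal C * Lip_norm \<alpha> g" .
    qed
    with iff C(1) show "(\<forall>g :: complex^'n \<Rightarrow> complex. holomorphic_several g (ball 0 1) \<longrightarrow>
          (J_bounded p q g \<longleftrightarrow> g \<in> Lip_space \<alpha>)) \<and>
       (\<exists>C>0. \<forall>g :: complex^'n \<Rightarrow> complex. holomorphic_several g (ball 0 1) \<longrightarrow>
          ennreal (1 / C) * Lip_norm \<alpha> g \<le> J_norm p q g \<and>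
          J_norm p q g \<le> ennreal C * Lip_norm \<alpha> g)"
      by blast
  next
    assume \<alpha>: "1 < \<alpha>"
    show "\<forall>g :: complex^'n \<Rightarrow> complex. holomorphic_several g (ball 0 1) \<longrightarrow>
          (J_bounded p q g \<longleftrightarrow> (\<exists>c. \<forall>z\<in>ball 0 1. g z = c)) \<and>
          ((\<exists>c. \<forall>z\<in>ball 0 1. g z = c) \<longleftrightarrow> (\<forall>f\<in>hardy_space p. \<forall>z\<in>ball 0 1. J_op g f z = 0))"
      using J_bounded_imp_constant[OF assms \<alpha>] J_bounded_constant[OF _ _ q] constant_iff_J_op_eq_0[OF _ assms(1)]
      by blast
  }
qed

end
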